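(* Let $A$ be a semicircular Klaus–Shaw potential whose phase and tail integrals are polynomials $\Phi(\lambda)=\sum_{p=0}^{\mathcal P}\Phi_p\lambda^{2p}$, $\Xi(\lambda)=\mathrm i\sum_{q=1}^{\mathcal Q}\Xi_q\lambda^{2q-1}$ of exact degrees $2\mathcal P$, $2\mathcal Q-1$; let $M:=\max\{2\mathcal P,2\mathcal Q-1\}$, $\Phi_p:=0$ for $p>\mathcal P$, $\Xi_q:=0$ for $q>\mathcal Q$, and fix $K\in\mathbb Z$; set $t^\circ_{2p}:=-\tfrac12(2K+1)\Phi_p$, $t^\circ_{2q-1}:=-\tfrac12\Xi_q$ ($2\le m\le M$), $x^\circ:=-\tfrac12\Xi_1$, and $\nu:=\frac1{2\pi}\int_0^{A_{\max}}\Phi(\mathrm is)\,ds$. Fix a flow index $n\in\{2,\dots,M\}$ and a real $t^\circ$, and let $\mathbf t_n^\circ:=(t_2^\circ,\dots,t_{n-1}^\circ,t_n^\circ-t^\circ,t_{n+1}^\circ,\dots,t_M^\circ)$. Let $\mathbf e_n$ be the unit vector in the $t_n$-direction of $\mathbb R^{M-1}$ and $\psi(x,t):=\widetilde\psi(x,\mathbf t_n^\circ+t\mathbf e_n)$; this is the solution of the $n$-th pure flow of the focusing NLS hierarchy with initial datum $\psi(x,0)=\widetilde\psi(x,\mathbf t_n^\circ)$. Then $$\psi\Big(x^\circ+\tfrac{\epsilon^2}{\nu}X,\ t^\circ+\tfrac{\epsilon^{n+1}}{\nu^n}T_n\Big)=\mathrm i(-1)^{K+N}\frac{\nu}{\epsilon}\Psi(X,0,\dots,0,T_n,0,\dots,0)+O(1)$$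 (with $T_n$ in the $n$-th time slot of $\Psi$) as $\epsilon=\epsilon_N\downarrow0$, uniformly for bounded $(X,T_n)\in\mathbb R^2$.
   Context: A semicircular Klaus–Shaw potential: $A:\mathbb R\to[0,\infty)$ with support $[X_-,X_+]$ ($X_-<X_+$), of the form $u(x)\sqrt{(X_+-x)(x-X_-)}$ there with $u\ge c>0$ and $u$ analytic on a complex neighborhood of $[X_-,X_+]$, $A\in L^1\cap C^2$, unique maximizer $x_0$, $A''(x_0)<0$, $A_{\max}=A(x_0)$. With $x_-(s)<x_+(s)$ solving $A(x)=s$, $\Phi(\mathrm is):=\int_{x_-}^{x_+}\sqrt{A^2-s^2}dx$, $\Xi(\mathrm is):=(x_++x_-)s+\int_{-\infty}^{x_-}(\sqrt{s^2-A^2}-s)dx-\int_{x_+}^\infty(\sqrt{s^2-A^2}-s)dx$ ($0<s<A_{\max}$), as functions of $\lambda=\mathrm is$, analytically continued. Semiclassical soliton ensemble: $\epsilon=\epsilon_N:=\frac1{N\pi}\int A$; $\Phi(\mathrm i\tilde s_n)=(n+\tfrac12)\epsilon\pi$, $n=0,\dots,N-1$; $\tilde\tau_n:=(-1)^{n+1}e^{\Xi(\mathrm i\tilde s_n)/\epsilon}$; $\mathbf t=(t_2,\dots,t_M)$, $Q(\lambda;x,\mathbf t):=\lambda x+\sum_{m=2}^M\lambda^mt_m$; $c_n:=\tilde\tau_n\frac{\prod_j(\mathrm i\tilde s_n+\mathrm i\tilde s_j)}{\prod_{j\ne n}(\mathrm i\tilde s_n-\mathrm i\tilde s_j)}e^{2\mathrm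 iQ(\mathrm i\tilde s_n;x,\mathbf t)/\epsilon}$; $\widetilde{\mathbf M}$ the unique $2\times2$ matrix meromorphic in $\lambda$ with simple poles only at $\pm\mathrm i\tilde s_n$, $\operatorname{Res}_{\mathrm i\tilde s_n}\widetilde{\mathbf M}=\lim\widetilde{\mathbf M}\begin{pmatrix}0&0\\c_n&0\end{pmatrix}$, $\operatorname{Res}_{-\mathrm i\tilde s_n}\widetilde{\mathbf M}=\lim\widetilde{\mathbf M}\begin{pmatrix}0&-c_n^*\\0&0\end{pmatrix}$, $\widetilde{\mathbf M}\to\mathbb I$; $\widetilde\psi(x,\mathbf t):=2\mathrm i\lim_{\lambda\to\infty}\lambda\widetilde M_{12}$; it solves simultaneously the first $M-1$ flows of the focusing NLS hierarchy. $\Psi(X,T_2,\dots,T_M):=2\mathrm i\lim_{\Lambda\to\infty}\Lambda R_{12}$, with $\mathbf R$ the unique $2\times2$ matrix analytic in $|\Lambda|\ne1$, $\mathbf R_+=\mathbf R_-e^{-\mathrm i\theta\sigma_3}\mathbf Q^{-1}e^{\mathrm i\theta\sigma_3}$ on $|\Lambda|=1$ ($\mathbf R_-$ interior, $\mathbf R_+$ exterior), $\theta=\Lambda X+\sum_{m=2}^M\Lambda^mT_m+2\Lambda^{-1}$, $\mathbf Q=\frac1{\sqrt2}\begin{pmatrix}1&-1\\1&1\end{pmatrix}$, $\mathbf R\to\mathbb I$. *)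

theory Defs
  imports "HOL-Analysis.Analysis"
begin

definition mat2 :: "complex \<Rightarrow> complex \<Rightarrow> complex \<Rightarrow> complex \<Rightarrow> complex^2^2" where
  "mat2 a b c d = (\<chi> i j. if i = 1 then (if j = 1 then a else b) else (if j = 1 then c else d))"

definition cscale :: "complex \<Rightarrow> complex^2^2 \<Rightarrow> complex^2^2" where
  "cscale z M = (\<chi> i j. z * M $ i $ j)"

definition mholo :: "(complex \<Rightarrow> complex^2^2) \<Rightarrow> complex set \<Rightarrow> bool" where
  "mholo M S \<longleftrightarrow> (\<forall>i j. (\<lambda>z. M z $ i $ j) holomorphic_on S)"

definition C2_on :: "real set \<Rightarrow> (real \<Rightarrow> real) \<Rightarrow> bool" where
  "C2_on S f \<longleftrightarrow> (\<forall>x\<in>S. f differentiable (at x) \<and> deriv f differentiable (at x))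
                 \<and> continuous_on S (deriv (deriv f))"

definition semicircular_KS ::
  "(real \<Rightarrow> real) \<Rightarrow> real \<Rightarrow> real \<Rightarrow> real \<Rightarrow> bool" where
  "semicircular_KS A Xm Xp x0 \<longleftrightarrow>
     Xm < Xp
   \<and> (\<forall>x. x < Xm \<or> Xp < x \<longrightarrow> A x = 0)
   \<and> (\<exists>u c. c > 0
        \<and> (\<forall>x\<in>{Xm..Xp}. A x = u x * sqrt ((Xp - x) * (x - Xm)) \<and> c \<le> u x)
        \<and> (\<exists>S U. open S \<and> complex_of_real ` {Xm..Xp} \<subseteq> S \<and> U holomorphic_on S
               \<and> (\<forall>x\<in>{Xm..Xp}. U (complex_of_real x) = complex_of_real (u x))))
   \<and> (\<forall>x. 0 \<le> A x)
   \<and> A integrable_on UNIV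
   \<and> C2_on (- {Xm, Xp}) A
   \<and> x0 \<in> {Xm<..<Xp}
   \<and> (\<forall>x. x \<noteq> x0 \<longrightarrow> A x < A x0)
   \<and> deriv (deriv A) x0 < 0
   \<and> (\<forall>x\<in>{Xm<..<x0}. deriv A x > 0)
   \<and> (\<forall>x\<in>{x0<..<Xp}. deriv A x < 0)"

text \<open>turning points x_-(s) < x_+(s), A(x) = s, for 0 < s < A_max = A x0\<close>
definition xminus :: "(real \<Rightarrow> real) \<Rightarrow> real \<Rightarrow> real \<Rightarrow> real" where
  "xminus A x0 s = (THE x. x \<le> x0 \<and> A x = s)"

definition xplus :: "(real \<Rightarrow> real) \<Rightarrow> real \<Rightarrow> real \<Rightarrow> real" where
  "xplus A x0 s = (THE x. x0 \<le> x \<and> A x = s)"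

text \<open>PhiR A x0 s = Phi(i s) (real), XiR A x0 s = Xi(i s) (real), for 0 < s < A_max\<close>
definition PhiR :: "(real \<Rightarrow> real) \<Rightarrow> real \<Rightarrow> real \<Rightarrow> real" where
  "PhiR A x0 s = integral {xminus A x0 s .. xplus A x0 s} (\<lambda>x. sqrt ((A x)^2 - s^2))"

definition XiR :: "(real \<Rightarrow> real) \<Rightarrow> real \<Rightarrow> real \<Rightarrow> real" where
  "XiR A x0 s = (xplus A x0 s + xminus A x0 s) * s
      + integral {.. xminus A x0 s} (\<lambda>x. sqrt (s^2 - (A x)^2) - s)
      - integral {xplus A x0 s ..} (\<lambda>x. sqrt (s^2 - (A x)^2) - s)"

definition eps :: "(real \<Rightarrow> real) \<Rightarrow> nat \<Rightarrow> real" where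
  "eps A N = integral UNIV A / (real N * pi)"

definition stil :: "(real \<Rightarrow> real) \<Rightarrow> real \<Rightarrow> nat \<Rightarrow> nat \<Rightarrow> real" where
  "stil A x0 N k = (THE s. 0 < s \<and> s < A x0 \<and> PhiR A x0 s = (real k + 1/2) * eps A N * pi)"

definition tautil :: "(real \<Rightarrow> real) \<Rightarrow> real \<Rightarrow> nat \<Rightarrow> nat \<Rightarrow> real" where
  "tautil A x0 N k = (-1) ^ (k + 1) * exp (XiR A x0 (stil A x0 N k) / eps A N)"

definition Qfun :: "nat \<Rightarrow> real \<Rightarrow> (nat \<Rightarrow> real) \<Rightarrow> complex \<Rightarrow> complex" where
  "Qfun M x t z = z * of_real x + (\<Sum>m=2..M. z ^ m * of_real (t m))"

definition ccoef :: "(real \<Rightarrow> real) \<Rightarrow> real \<Rightarrow> nat \<Rightarrow> nat \<Rightarrow> real \<Rightarrow> (nat \<Rightarrow> real) \<Rightarrow> nat \<Rightarrow> complex" where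
  "ccoef A x0 N M x t k =
     (let s = stil A x0 N in
       of_real (tautil A x0 N k)
       * (\<Prod>j<N. \<i> * of_real (s k) + \<i> * of_real (s j))
       / (\<Prod>j\<in>{..<N} - {k}. \<i> * of_real (s k) - \<i> * of_real (s j))
       * exp (2 * \<i> * Qfun M x t (\<i> * of_real (s k)) / of_real (eps A N)))"

definition discrete_RHP :: "nat \<Rightarrow> (nat \<Rightarrow> real) \<Rightarrow> (nat \<Rightarrow> complex) \<Rightarrow> (complex \<Rightarrow> complex^2^2) \<Rightarrow> bool" where
  "discrete_RHP N s c Mt \<longleftrightarrow>
     mholo Mt (- ((\<lambda>k. \<i> * of_real (s k)) ` {..<N} \<union> (\<lambda>k. - \<i> * of_real (s k)) ` {..<N}))
   \<and> (\<forall>k<N. \<exists>L. ((\<lambda>w. Mt w ** mat2 0 0 (c k) 0) \<longlongrightarrow> L) (at (\<i> * of_real (s k)))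
               \<and> ((\<lambda>w. cscale (w - \<i> * of_real (s k)) (Mt w)) \<longlongrightarrow> L) (at (\<i> * of_real (s k))))
   \<and> (\<forall>k<N. \<exists>L. ((\<lambda>w. Mt w ** mat2 0 (- cnj (c k)) 0 0) \<longlongrightarrow> L) (at (- \<i> * of_real (s k)))
               \<and> ((\<lambda>w. cscale (w + \<i> * of_real (s k)) (Mt w)) \<longlongrightarrow> L) (at (- \<i> * of_real (s k))))
   \<and> (Mt \<longlongrightarrow> mat 1) at_infinity"

definition psitil :: "(real \<Rightarrow> real) \<Rightarrow> real \<Rightarrow> nat \<Rightarrow> nat \<Rightarrow> real \<Rightarrow> (nat \<Rightarrow> real) \<Rightarrow> complex" where
  "psitil A x0 N M x t = (THE y. \<exists>Mt.
      discrete_RHP N (stil A x0 N) (ccoef A x0 N M x t) Mt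
      \<and> ((\<lambda>z. 2 * \<i> * z * Mt z $ 1 $ 2) \<longlongrightarrow> y) at_infinity)"

definition Qmat :: "complex^2^2" where
  "Qmat = mat2 (1 / sqrt 2) (- 1 / sqrt 2) (1 / sqrt 2) (1 / sqrt 2)"

definition thetaR :: "nat \<Rightarrow> real \<Rightarrow> (nat \<Rightarrow> real) \<Rightarrow> complex \<Rightarrow> complex" where
  "thetaR M X T z = z * of_real X + (\<Sum>m=2..M. z ^ m * of_real (T m)) + 2 / z"

definition jumpR :: "complex \<Rightarrow> complex^2^2" where
  "jumpR th = mat2 (exp (- \<i> * th)) 0 0 (exp (\<i> * th)) ** matrix_inv Qmat
              ** mat2 (exp (\<i> * th)) 0 0 (exp (- \<i> * th))"

definition model_RHP :: "nat \<Rightarrow> real \<Rightarrow> (nat \<Rightarrow> real) \<Rightarrow> (complex \<Rightarrow> complex^2^2) \<Rightarrow> bool" where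
  "model_RHP M X T R \<longleftrightarrow>
     mholo R {z. cmod z \<noteq> 1}
   \<and> (\<forall>z. cmod z = 1 \<longrightarrow> (\<exists>Rm Rp. (R \<longlongrightarrow> Rm) (at z within ball 0 1)
                               \<and> (R \<longlongrightarrow> Rp) (at z within - cball 0 1)
                               \<and> Rp = Rm ** jumpR (thetaR M X T z)))
   \<and> (R \<longlongrightarrow> mat 1) at_infinity"

definition PsiR :: "nat \<Rightarrow> real \<Rightarrow> (nat \<Rightarrow> real) \<Rightarrow> complex" where
  "PsiR M X T = (THE y. \<exists>R. model_RHP M X T R
      \<and> ((\<lambda>z. 2 * \<i> * z * R z $ 1 $ 2) \<longlongrightarrow> y) at_infinity)"

end

theory Submission
  imports Defs "HOL-Complex_Analysis.Great_Picard"
begin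

text \<open>
  At the base point the phase quantization turns every connection coefficient times
  \<open>exp (2\<i>Q/\<epsilon>)\<close> into one sign constant \<open>\<tau> = \<i>(-1)\<^bsup>K+N\<^esup>\<close>. In the variable \<open>z = \<epsilon>\<lambda>/\<nu>\<close> the
  residue coefficients are therefore \<open>\<tau>\<close> times the residues of
  \<open>exp (2\<i>\<phi>(z)) \<Prod>\<^sub>j (z + \<i>y\<^sub>j)/(z - \<i>y\<^sub>j)\<close>, where the \<open>y\<^sub>j = O(\<epsilon>)\<close> sum to \<open>2 + O(\<epsilon>)\<close>, and on
  \<open>|z| = 1\<close> this product is \<open>O(\<epsilon>)\<close>-close to the exponential of \<open>2\<i>(\<phi> + 2/z)\<close> in the model
  problem. Unitarity on the real axis and the maximum principle bound the discrete solutions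
  uniformly; a determinant formed from the first rows of two solutions compares their moments at
  infinity, and normal families give a solution of the model problem. The \<open>O(\<epsilon>)\<close> discrepancy,
  multiplied by \<open>\<nu>/\<epsilon>\<close>, is the \<open>O(1)\<close> error.
\<close>

text \<open>All \<open>N\<close> poles collapse onto the origin and their residue coefficients are
  products of about \<open>2 N\<close> factors, so neither the linear system nor its coefficients
  give bounds uniform in \<open>N\<close>. What stays bounded is the sum of the \<open>y j\<close>:
  where a Blaschke factor is at most \<open>exp (c * y j)\<close>, the whole product is at most
  \<open>exp (c * \<Sum> y j)\<close>. On a circle through the origin this holds although the poles
  approach it, and there unitarity bounds the entry whose poles lie in the other half plane. The
  jump relation makes the remaining entry an entire function up to a bounded term, and the entire
  function disappears from an exterior Cauchy integral. To first order
  \<open>(z + \<i> y) / (z - \<i> y)\<close> is \<open>exp (2 \<i> y / z)\<close>; this is the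
  origin of the term \<open>2 / z\<close>, and \<open>\<nu>\<close> is the normalization that makes
  its numerator 2. The determinant of two first rows needs no inverse and no second row, so
  uniqueness and stability are one estimate. The model problem is solved with artificial poles
  chosen for their sum alone, independently of the potential.\<close>

section \<open>Preliminaries: square linear systems, removable singularities, boundary values on the
  unit circle\<close>

text \<open>Gaussian elimination, one pivot at a time. Rows and columns carry separate index sets so
  that the pivot row \<open>r\<close> and the pivot column \<open>m\<close> can be deleted
  independently.\<close>

lemma square_system_solvable:
  fixes a :: "'r \<Rightarrow> 'c \<Rightarrow> complex"
  assumes "finite R" "finite C" "card R = card C"
    and "\<And>x. \<forall>i\<in>R. (\<Sum>j\<in>C. a i j * x j) = 0 \<Longrightarrow> \<forall>j\<in>C. x j = 0"
  shows "\<exists>x. \<forall>i\<in>R. (\<Sum>j\<in>C. a i j * x j) = b i"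
  using assms
proof (induction "card C" arbitrary: R C a b)
  case 0
  then show ?case by simp
next
  case (Suc n)
  then obtain m where m: "m \<in> C" by (metis card.empty ex_in_conv nat.distinct(1))
  \<comment> \<open>A zero column would put the unit vector at \<open>m\<close> into the
    kernel.\<close>
  have "\<exists>i\<in>R. a i m \<noteq> 0"
  proof (rule ccontr)
    assume *: "\<not> (\<exists>i\<in>R. a i m \<noteq> 0)"
    have "\<forall>i\<in>R. (\<Sum>j\<in>C. a i j * (if j = m then 1 else 0)) = 0"
      using * m Suc.prems(2) by (simp add: if_distrib cong: if_cong)
    from Suc.prems(4)[OF this] m show False by auto
  qed
  then obtain r where r: "r \<in> R" "a r m \<noteq> 0" by blast
  define a' where "a' = (\<lambda>i j. a i j - a i m * a r j / a r m)"
  define b' where "b' = (\<lambda>i. b i - a i m * b r / a r m)"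
  \<comment> \<open>Back-substitution: unknown \<open>m\<close> is chosen so that row
    \<open>r\<close> attains the value \<open>c\<close>. By \<open>row\<close>, the other rows then
    see only the Schur complement \<open>a'\<close>.\<close>
  define ext where "ext = (\<lambda>x c j. if j = m then (c - (\<Sum>j\<in>C - {m}. a r j * x j)) / a r m else x j)"
  have row: "(\<Sum>j\<in>C. a i j * ext x c j) = a i m * c / a r m + (\<Sum>j\<in>C - {m}. a' i j * x j)" for i x c
  proof -
    have "(\<Sum>j\<in>C. a i j * ext x c j) = a i m * ext x c m + (\<Sum>j\<in>C - {m}. a i j * ext x c j)"
      using m Suc.prems(2) by (simp add: sum.remove)
    also have "(\<Sum>j\<in>C - {m}. a i j * ext x c j) = (\<Sum>j\<in>C - {m}. a i j * x j)"
      by (rule sum.cong) (auto simp: ext_def)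
    also have "ext x c m = (c - (\<Sum>j\<in>C - {m}. a r j * x j)) / a r m"
      by (simp add: ext_def)
    finally show ?thesis
      by (simp add: a'_def sum_subtractf left_diff_distrib right_diff_distrib diff_divide_distrib
          sum_distrib_left sum_divide_distrib mult.assoc)
  qed
  have "\<exists>x. \<forall>i\<in>R - {r}. (\<Sum>j\<in>C - {m}. a' i j * x j) = b' i"
  proof (rule Suc.hyps(1))
    show "n = card (C - {m})" using Suc.hyps(2) m by simp
    show "finite (R - {r})" "finite (C - {m})" using Suc.prems by auto
    show "card (R - {r}) = card (C - {m})" using Suc.prems m r by simp
    fix x assume x: "\<forall>i\<in>R - {r}. (\<Sum>j\<in>C - {m}. a' i j * x j) = 0"
    have "\<forall>i\<in>R. (\<Sum>j\<in>C. a i j * ext x 0 j) = 0"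
    proof
      fix i assume "i \<in> R"
      then show "(\<Sum>j\<in>C. a i j * ext x 0 j) = 0"
        using x r by (cases "i = r") (auto simp: row a'_def)
    qed
    from Suc.prems(4)[OF this] have "\<forall>j\<in>C. ext x 0 j = 0" .
    then show "\<forall>j\<in>C - {m}. x j = 0" by (simp add: ext_def split: if_splits) (metis DiffE insertI1)
  qed
  then obtain x where x: "\<forall>i\<in>R - {r}. (\<Sum>j\<in>C - {m}. a' i j * x j) = b' i" ..
  have "\<forall>i\<in>R. (\<Sum>j\<in>C. a i j * ext x (b r) j) = b i"
  proof
    fix i assume "i \<in> R"
    then show "(\<Sum>j\<in>C. a i j * ext x (b r) j) = b i"
      using x r by (cases "i = r") (auto simp: row a'_def b'_def)
  qed
  then show ?case by blast
qed

text \<open>The vanishing limit excludes even a simple pole, so the points can be filled in one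
  after the other.\<close>

lemma removable_finite_singularities:
  assumes "finite S" and "f holomorphic_on (- S)"
    and "\<And>\<xi>. \<xi> \<in> S \<Longrightarrow> ((\<lambda>z. (z - \<xi>) * f z) \<longlongrightarrow> 0) (at \<xi>)"
  obtains h where "h holomorphic_on UNIV" "\<And>z. z \<notin> S \<Longrightarrow> h z = f z"
proof -
  have "\<exists>h. h holomorphic_on UNIV \<and> (\<forall>z. z \<notin> S \<longrightarrow> h z = f z)"
    using assms
  proof (induction S arbitrary: f rule: finite_induct)
    case empty
    then show ?case by auto
  next
    case (insert a S)
    have op: "open (- S)" using insert.hyps by (simp add: finite_imp_closed open_Compl)
    have "\<exists>g. g holomorphic_on (- S) \<and> (\<forall>z \<in> - S - {a}. g z = f z)"
    proof (subst holomorphic_on_extend_lim)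
      show "f holomorphic_on - S - {a}" using insert.prems(1) by (simp add: Compl_insert)
      show "a \<in> interior (- S)" using insert.hyps op by (simp add: interior_open)
      show "((\<lambda>z. (z - a) * f z) \<longlongrightarrow> 0) (at a)" using insert.prems(2) by simp
    qed
    then obtain g where g: "g holomorphic_on (- S)" "\<And>z. z \<notin> insert a S \<Longrightarrow> g z = f z" by auto
    have "\<exists>h. h holomorphic_on UNIV \<and> (\<forall>z. z \<notin> S \<longrightarrow> h z = g z)"
    proof (rule insert.IH[OF g(1)])
      fix x assume x: "x \<in> S"
      have "\<forall>\<^sub>F z in at x. z \<notin> insert a S"
      proof -
        have "open (- (insert a S - {x}))"
          using insert.hyps by (intro open_Compl finite_imp_closed) auto
        then have "\<forall>\<^sub>F z in at x. z \<in> - (insert a S - {x})"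
          by (intro eventually_at_in_open') auto
        moreover have "\<forall>\<^sub>F z in at x. z \<noteq> x" by (simp add: eventually_neq_at_within)
        ultimately show ?thesis by eventually_elim auto
      qed
      then have "\<forall>\<^sub>F z in at x. (z - x) * f z = (z - x) * g z"
        by eventually_elim (auto simp: g(2))
      then show "((\<lambda>z. (z - x) * g z) \<longlongrightarrow> 0) (at x)"
        using insert.prems(2)[of x] x by (auto intro: Lim_transform_eventually)
    qed
    then show ?case using g(2) by (metis insertCI)
  qed
  then show ?thesis using that by blast
qed

text \<open>Riemann-Hilbert boundary values are given only as pointwise limits, with no uniformity
  along the circle. Continuity is automatic all the same: near any \<open>y\<close> in the closure
  there is a point of \<open>S\<close> at which \<open>f\<close> is close to \<open>F y\<close>, so
  two boundary values are compared through points of \<open>S\<close>.\<close>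

lemma continuous_on_closure_by_limits:
  fixes f F :: "'a::metric_space \<Rightarrow> 'b::metric_space"
  assumes lim: "\<And>z. z \<in> closure S \<Longrightarrow> (f \<longlongrightarrow> F z) (at z within S)"
    and eq: "\<And>z. z \<in> S \<Longrightarrow> F z = f z"
  shows "continuous_on (closure S) F"
  unfolding continuous_on_iff
proof (intro ballI allI impI)
  fix z and e :: real assume z: "z \<in> closure S" and e: "e > 0"
  obtain d where d: "d > 0" "\<And>x. x \<in> S \<Longrightarrow> x \<noteq> z \<Longrightarrow> dist x z < d \<Longrightarrow> dist (f x) (F z) < e / 2"
    using lim[OF z] e unfolding Lim_within by (metis half_gt_zero zero_less_dist_iff)
  have d': "dist (f x) (F z) < e / 2" if "x \<in> S" "dist x z < d" for x
    using d(2)[OF that(1) _ that(2)] e eq[OF that(1)] by (cases "x = z") auto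
  have "dist (F y) (F z) < e" if y: "y \<in> closure S" and yz: "dist y z < d" for y
  proof -
    have "\<exists>x\<in>S. dist x z < d \<and> dist (f x) (F y) < e / 2"
    proof (cases "y \<in> S")
      case True
      then show ?thesis using yz e eq by (intro bexI[of _ y]) auto
    next
      case False
      obtain c where c: "c > 0" "\<And>x. x \<in> S \<Longrightarrow> x \<noteq> y \<Longrightarrow> dist x y < c \<Longrightarrow> dist (f x) (F y) < e / 2"
        using lim[OF y] e unfolding Lim_within by (metis half_gt_zero zero_less_dist_iff)
      obtain x where x: "x \<in> S" "dist x y < min c (d - dist y z)"
        using y c yz closure_approachable[of y S] by (metis diff_gt_0_iff_gt min_less_iff_conj)
      have "dist x z < d" using x(2) dist_triangle[of x z y] by auto
      then show ?thesis using x c(2)[of x] False by auto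
    qed
    then obtain x where "x \<in> S" "dist x z < d" "dist (f x) (F y) < e / 2" by blast
    then show ?thesis using d'[of x] dist_triangle3[of "F y" "F z" "f x"] by simp
  qed
  then show "\<exists>d>0. \<forall>y\<in>closure S. dist y z < d \<longrightarrow> dist (F y) (F z) < e" using d(1) by blast
qed

text \<open>Inversion runs through the circle backwards. The reversed orientation and the minus sign
  in \<open>d(1/z) = - dz / z^2\<close> cancel, hence the same value \<open>I\<close>.\<close>

lemma has_contour_integral_circlepath_inversion:
  assumes "(f has_contour_integral I) (circlepath 0 1)"
  shows "((\<lambda>z. f (1 / z) / z\<^sup>2) has_contour_integral I) (circlepath 0 1)"
proof -
  define e where "e = (\<lambda>x::real. exp (2 * complex_of_real pi * \<i> * of_real x))"
  have c: "circlepath 0 1 x = e x" for x by (simp add: circlepath e_def)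
  have vd: "vector_derivative (circlepath 0 1) (at x within {0..1}) = 2 * pi * \<i> * e x"
    if "x \<in> {0..1}" for x
    using vector_derivative_circlepath01[of x 0 1] that by (simp add: e_def)
  have e1: "e (1 - x) = 1 / e x" for x
    by (simp add: e_def algebra_simps exp_diff)
  have e0: "e x \<noteq> 0" for x by (simp add: e_def)
  have "((\<lambda>x. f (e x) * (2 * pi * \<i> * e x)) has_integral I) {0..1}"
    using assms unfolding has_contour_integral_def
    by (subst has_integral_cong[where g="\<lambda>x. f (circlepath 0 1 x) * vector_derivative (circlepath 0 1) (at x within {0..1})"])
      (simp_all only: vd c)
  then have "((\<lambda>x. f (e (1 - x)) * (2 * pi * \<i> * e (1 - x))) has_integral I) {0..1}"
    using has_integral_affinity[of "\<lambda>x. f (e x) * (2 * pi * \<i> * e x)" I "0::real" 1 "-1" 1]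
    by simp
  then have "((\<lambda>x. f (1 / e x) * (2 * pi * \<i> * (1 / e x))) has_integral I) {0..1}"
    by (simp only: e1)
  also have "?this \<longleftrightarrow> ?thesis" unfolding has_contour_integral_def
  proof (rule has_integral_cong)
    fix x :: real assume "x \<in> {0..1}"
    then show "f (1 / e x) * (2 * pi * \<i> * (1 / e x)) = f (1 / circlepath 0 1 x) / (circlepath 0 1 x)\<^sup>2 *
       vector_derivative (circlepath 0 1) (at x within {0..1})"
      using e0[of x] by (simp only: vd c) (simp add: power2_eq_square)
  qed
  finally show ?thesis .
qed

text \<open>The integral of \<open>h (1 / z)\<close> over the circle is \<open>2 \<pi> \<i>\<close>
  times the derivative of \<open>h\<close> at 0, while that of \<open>k\<close> vanishes. Hence an
  exterior function that nearly matches an interior one on the circle has a small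
  \<open>1 / z\<close> coefficient. Continuity up to the circle is enough.\<close>

lemma circle_moment_bound:
  assumes h: "continuous_on (cball 0 1) h" "h holomorphic_on ball 0 1"
    and k: "continuous_on (cball 0 1) k" "k holomorphic_on ball 0 1"
    and d: "\<And>z. cmod z = 1 \<Longrightarrow> cmod (h (1 / z) - k z) \<le> d"
  shows "cmod (deriv h 0) \<le> d"
proof -
  \<comment> \<open>Cauchy's formula for \<open>u * k u\<close> at the point 0 is Cauchy's theorem
    for \<open>k\<close>, with mere continuity on the circle.\<close>
  have "((\<lambda>u. (u * k u) / (u - 0)) has_contour_integral (2 * of_real pi * \<i> * (0 * k 0))) (circlepath 0 1)"
    using k by (intro Cauchy_integral_circlepath continuous_intros holomorphic_intros) auto
  then have k0: "(k has_contour_integral 0) (circlepath 0 1)"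
    by (subst has_contour_integral_cong[where f'="\<lambda>u. (u * k u) / (u - 0)" and g'="circlepath 0 1"]) auto
  have "((\<lambda>u. h u / (u - 0) ^ Suc 1) has_contour_integral (2 * pi * \<i>) / fact 1 * (deriv ^^ 1) h 0) (circlepath 0 1)"
    using h by (intro Cauchy_has_contour_integral_higher_derivative_circlepath) auto
  from has_contour_integral_circlepath_inversion[OF this]
  have "((\<lambda>z. h (1 / z)) has_contour_integral 2 * pi * \<i> * deriv h 0) (circlepath 0 1)"
    by (rule has_contour_integral_cong[THEN iffD1, rotated -1]) (auto simp: power2_eq_square)
  from has_contour_integral_diff[OF this k0]
  have "((\<lambda>z. h (1 / z) - k z) has_contour_integral 2 * pi * \<i> * deriv h 0) (circlepath 0 1)" by simp
  moreover have "0 \<le> d" using d[of 1] by (meson norm_ge_zero norm_one order_trans)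
  ultimately have "cmod (2 * pi * \<i> * deriv h 0) \<le> d * (2 * pi * 1)"
    by (rule has_contour_integral_bound_circlepath) (use d in auto)
  then show ?thesis by (simp add: norm_mult)
qed

text \<open>Inversion moves infinity to the origin, where the limit \<open>l\<close> makes the
  singularity removable; limits taken from outside become values on the circle.\<close>

lemma exterior_extension:
  fixes f :: "complex \<Rightarrow> complex"
  assumes hol: "f holomorphic_on {z. 1 < cmod z}" and inf: "(f \<longlongrightarrow> l) at_infinity"
    and bd: "\<And>z. cmod z = 1 \<Longrightarrow> (f \<longlongrightarrow> B z) (at z within - cball 0 1)"
  obtains U where "continuous_on (cball 0 1) U" "U holomorphic_on ball 0 1" "U 0 = l"
    "\<And>w. w \<noteq> 0 \<Longrightarrow> cmod w < 1 \<Longrightarrow> U w = f (1 / w)"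
    "\<And>w. cmod w = 1 \<Longrightarrow> U w = B (1 / w)"
proof -
  define F where "F = (\<lambda>w. if w = 0 then l else f (1 / w))"
  define U where "U = (\<lambda>w. if cmod w = 1 then B (1 / w) else F w)"
  have hF: "F holomorphic_on ball 0 1 - {0}"
  proof -
    have "(\<lambda>w. f (1 / w)) holomorphic_on ball 0 1 - {0}"
    proof (rule holomorphic_on_compose_gen[OF _ hol, of "\<lambda>w. 1 / w", unfolded o_def])
      show "(\<lambda>w. 1 / w) holomorphic_on ball 0 1 - {0::complex}" by (intro holomorphic_intros) auto
      show "(\<lambda>w. 1 / w) ` (ball 0 1 - {0}) \<subseteq> {z. 1 < cmod z}"
        by (auto simp: norm_divide less_divide_eq)
    qed
    then show ?thesis by (rule holomorphic_transform) (auto simp: F_def)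
  qed
  have lim0: "(F \<longlongrightarrow> l) (at 0)"
  proof -
    have "((\<lambda>w. f (1 / w)) \<longlongrightarrow> l) (at 0)"
      using inf by (simp add: lim_at_infinity_0 o_def inverse_eq_divide)
    then show ?thesis
      by (rule Lim_transform_eventually) (auto simp: F_def eventually_at intro!: exI[of _ 1])
  qed
  have cF: "continuous_on (ball 0 1) F"
  proof -
    have "isCont F w" if "w \<in> ball 0 1" for w
    proof (cases "w = 0")
      case True
      then show ?thesis using lim0 by (simp add: isCont_def F_def)
    next
      case False
      then show ?thesis using that holomorphic_on_imp_continuous_on[OF hF]
        by (metis DiffI continuous_on_interior interior_open open_ball open_delete singletonD)
    qed
    then show ?thesis by (simp add: continuous_at_imp_continuous_on)
  qed
  have hF': "F holomorphic_on ball 0 1"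
    using no_isolated_singularity[OF cF hF] by simp
  have "continuous_on (closure (ball 0 1)) U"
  proof (rule continuous_on_closure_by_limits[where f = F])
    fix z :: complex assume "z \<in> closure (ball 0 1)"
    then have "cmod z \<le> 1" by simp
    show "(F \<longlongrightarrow> U z) (at z within ball 0 1)"
    proof (cases "cmod z = 1")
      case False
      then have "z \<in> ball 0 1" using \<open>cmod z \<le> 1\<close> by simp
      then have "(F \<longlongrightarrow> F z) (at z within ball 0 1)" using cF by (simp add: continuous_on_def)
      then show ?thesis using False by (simp add: U_def)
    next
      case True
      then have z0: "z \<noteq> 0" by auto
      have "((\<lambda>w. f (1 / w)) \<longlongrightarrow> B (1 / z)) (at z within ball 0 1)"
      proof (rule filterlim_compose[OF bd])
        show "cmod (1 / z) = 1" using True by (simp add: norm_divide)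
        have 1: "((\<lambda>w. 1 / w) \<longlongrightarrow> 1 / z) (at z within ball 0 1)"
          using z0 by (intro tendsto_intros)
        show "filterlim (\<lambda>w. 1 / w) (at (1 / z) within - cball 0 1) (at z within ball 0 1)"
          unfolding filterlim_at
        proof
          show "\<forall>\<^sub>F w in at z within ball 0 1. 1 / w \<in> - cball 0 1 \<and> 1 / w \<noteq> 1 / z"
            unfolding eventually_at
          proof (intro exI[of _ 1] conjI ballI impI)
            fix w assume "w \<in> ball 0 1" "w \<noteq> z \<and> dist w z < 1"
            then have "w \<noteq> 0" "cmod w < 1" "w \<noteq> z" using True by auto
            then show "1 / w \<in> - cball 0 1" "1 / w \<noteq> 1 / z" using z0
              by (auto simp: norm_divide divide_simps)
          qed auto
        qed (fact 1)
      qed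
      then have "(F \<longlongrightarrow> B (1 / z)) (at z within ball 0 1)"
      proof (rule Lim_transform_eventually)
        have "\<forall>\<^sub>F w in at z within ball 0 1. w \<noteq> 0" by (rule eventually_neq_at_within)
        then show "\<forall>\<^sub>F w in at z within ball 0 1. f (1 / w) = F w"
          by eventually_elim (simp add: F_def)
      qed
      then show ?thesis using True by (simp add: U_def)
    qed
  qed (auto simp: U_def)
  then have "continuous_on (cball 0 1) U" by simp
  moreover have "U holomorphic_on ball 0 1"
    using hF' by (rule holomorphic_transform) (auto simp: U_def)
  ultimately show ?thesis by (rule that) (auto simp: U_def F_def)
qed

lemma interior_extension:
  fixes f :: "complex \<Rightarrow> complex"
  assumes hol: "f holomorphic_on ball 0 1"
    and bd: "\<And>z. cmod z = 1 \<Longrightarrow> (f \<longlongrightarrow> B z) (at z within ball 0 1)"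
  obtains p where "continuous_on (cball 0 1) p" "p holomorphic_on ball 0 1"
    "\<And>w. cmod w = 1 \<Longrightarrow> p w = B w"
proof -
  define p where "p = (\<lambda>w. if cmod w = 1 then B w else f w)"
  have "continuous_on (closure (ball 0 1)) p"
  proof (rule continuous_on_closure_by_limits[where f = f])
    fix z :: complex assume "z \<in> closure (ball 0 1)"
    then show "(f \<longlongrightarrow> p z) (at z within ball 0 1)"
      using bd[of z] holomorphic_on_imp_continuous_on[OF hol]
      by (cases "cmod z = 1") (auto simp: p_def continuous_on_def)
  qed (auto simp: p_def)
  then have "continuous_on (cball 0 1) p" by simp
  moreover have "p holomorphic_on ball 0 1"
    using hol by (rule holomorphic_transform) (auto simp: p_def)
  ultimately show ?thesis by (rule that) (auto simp: p_def)
qed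

text \<open>The \<open>1 / z\<close> coefficient at infinity, through which \<open>PsiR\<close> is
  defined, becomes a derivative at the origin.\<close>

lemma deriv_exterior_extension:
  fixes U :: "complex \<Rightarrow> complex"
  assumes "U holomorphic_on ball 0 r" "0 < r" "U 0 = 0" "\<And>w. w \<noteq> 0 \<Longrightarrow> cmod w < r \<Longrightarrow> U w = f (1 / w)"
  shows "((\<lambda>z. z * f z) \<longlongrightarrow> deriv U 0) at_infinity"
proof -
  have "(U has_field_derivative deriv U 0) (at 0)"
    using assms by (intro holomorphic_derivI[of U "ball 0 r"]) auto
  then have "((\<lambda>w. (U w - U 0) / (w - 0)) \<longlongrightarrow> deriv U 0) (at 0)"
    by (simp add: has_field_derivative_iff)
  then have "((\<lambda>w. (1 / w) * f (1 / w)) \<longlongrightarrow> deriv U 0) (at 0)"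
    by (rule Lim_transform_eventually)
      (use assms in \<open>auto simp: eventually_at intro!: exI[of _ r]\<close>)
  then show ?thesis by (simp add: lim_at_infinity_0 o_def inverse_eq_divide)
qed

section \<open>The model problem reduced to its first row\<close>

lemma mat2_nth [simp]:
  "mat2 a b c d $ 1 $ 1 = a" "mat2 a b c d $ 1 $ 2 = b"
  "mat2 a b c d $ 2 $ 1 = c" "mat2 a b c d $ 2 $ 2 = d"
  by (simp_all add: mat2_def)

lemma matrix_mult_2_nth:
  fixes A B :: "complex^2^2"
  shows "(A ** B) $ i $ j = A $ i $ 1 * B $ 1 $ j + A $ i $ 2 * B $ 2 $ j"
  by (simp add: matrix_matrix_mult_def sum_2)

lemma mat2_cong: "(A::complex^2^2) = B \<longleftrightarrow>
    A$1$1 = B$1$1 \<and> A$1$2 = B$1$2 \<and> A$2$1 = B$2$1 \<and> A$2$2 = B$2$2"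
  by (auto simp: vec_eq_iff forall_2)

lemma matrix_inv_Qmat: "matrix_inv Qmat = mat2 (1 / sqrt 2) (1 / sqrt 2) (- 1 / sqrt 2) (1 / sqrt 2)"
proof -
  let ?B = "mat2 (1 / sqrt 2) (1 / sqrt 2) (- 1 / sqrt 2) (1 / sqrt 2)"
  have s: "complex_of_real (sqrt 2) * complex_of_real (sqrt 2) = 2"
    by (simp flip: of_real_mult)
  have 1: "Qmat ** ?B = mat 1" "?B ** Qmat = mat 1"
    by (simp_all add: mat2_cong Qmat_def matrix_mult_2_nth mat_def s)
  then have "\<exists>A'. Qmat ** A' = mat 1 \<and> A' ** Qmat = mat 1" by blast
  from someI_ex[OF this] have "Qmat ** matrix_inv Qmat = mat 1" by (simp add: matrix_inv_def)
  then have "?B ** (Qmat ** matrix_inv Qmat) = ?B ** mat 1" by simp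
  then show ?thesis unfolding matrix_mul_assoc 1 by simp
qed

lemma jumpR_eq:
  "jumpR th = mat2 (1 / sqrt 2) (exp (- 2 * \<i> * th) / sqrt 2) (- exp (2 * \<i> * th) / sqrt 2) (1 / sqrt 2)"
proof -
  have 1: "exp (- (\<i> * th)) * exp (- (\<i> * th)) = exp (- (2 * \<i> * th))"
     "exp (\<i> * th) * exp (\<i> * th) = exp (2 * \<i> * th)" "exp (- (\<i> * th)) * exp (\<i> * th) = 1"
     "exp (\<i> * th) * exp (- (\<i> * th)) = 1"
    by (simp_all add: mult.assoc flip: exp_add)
  show ?thesis
    by (simp add: mat2_cong jumpR_def matrix_inv_Qmat matrix_mult_2_nth 1)
qed

text \<open>First row of a solution, with the exterior pulled back to the disc:
  \<open>U (1 / z)\<close> and \<open>W (1 / z)\<close> are the exterior boundary values,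
  \<open>g\<close> plays the role of \<open>exp (2 \<i> \<theta>)\<close>, and in the model problem
  \<open>p\<close> and \<open>q\<close> are \<open>sqrt 2\<close> times the interior entries.
  Leaving \<open>g\<close> arbitrary lets the same notion cover the pole problem and its
  limit.\<close>

definition row_sol ::
  "(complex \<Rightarrow> complex) \<Rightarrow> (complex \<Rightarrow> complex) \<Rightarrow> (complex \<Rightarrow> complex) \<Rightarrow> (complex \<Rightarrow> complex) \<Rightarrow> (complex \<Rightarrow> complex) \<Rightarrow> bool"
  where "row_sol g U W p q \<longleftrightarrow>
    (\<forall>f \<in> {U, W, p, q}. continuous_on (cball 0 1) f \<and> f holomorphic_on ball 0 1)
    \<and> U 0 = 1 \<and> W 0 = 0
    \<and> (\<forall>z. cmod z = 1 \<longrightarrow> g z \<noteq> 0 \<and> p z = U (1 / z) + g z * W (1 / z) \<and> q z = W (1 / z) - U (1 / z) / g z)"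

text \<open>Since \<open>U 0 = 1\<close> and \<open>W 0 = 0\<close>, the determinant
  \<open>W1 U2 - U1 W2\<close> has the difference of the two moments as its derivative at 0. Its
  interior counterpart is halved because the linear map from \<open>(U, W)\<close> to
  \<open>(p, q)\<close> has determinant 2.\<close>

lemma row_sol_deriv_diff:
  assumes 1: "row_sol g1 U1 W1 p1 q1" and 2: "row_sol g2 U2 W2 p2 q2"
    and d: "\<And>z. cmod z = 1 \<Longrightarrow> cmod (W1 (1 / z) * U2 (1 / z) - U1 (1 / z) * W2 (1 / z) - (p2 z * q1 z - p1 z * q2 z) / 2) \<le> d"
  shows "cmod (deriv W1 0 - deriv W2 0) \<le> d"
proof -
  let ?h = "\<lambda>w. W1 w * U2 w - U1 w * W2 w"
  have dd: "(f has_field_derivative deriv f 0) (at 0)" if "f \<in> {U1, W1, U2, W2}" for f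
    using that 1 2 by (intro holomorphic_derivI[of f "ball 0 1"]) (auto simp: row_sol_def)
  have "(?h has_field_derivative (deriv W1 0 * U2 0 + deriv U2 0 * W1 0) - (deriv U1 0 * W2 0 + deriv W2 0 * U1 0)) (at 0)"
    by (intro DERIV_diff DERIV_mult dd) auto
  then have "deriv ?h 0 = deriv W1 0 - deriv W2 0"
    using 1 2 by (simp add: row_sol_def DERIV_imp_deriv)
  moreover have "cmod (deriv ?h 0) \<le> d"
    by (rule circle_moment_bound[where k = "\<lambda>z. (p2 z * q1 z - p1 z * q2 z) / 2"])
      (use 1 2 d in \<open>auto simp: row_sol_def intro!: continuous_intros holomorphic_intros\<close>)
  ultimately show ?thesis by simp
qed

text \<open>With a common \<open>g\<close> the exterior and interior determinants agree on the
  circle, so the previous bound applies with \<open>d = 0\<close>.\<close>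

lemma row_sol_unique:
  assumes 1: "row_sol g U1 W1 p1 q1" and 2: "row_sol g U2 W2 p2 q2"
  shows "deriv W1 0 = deriv W2 0"
proof -
  have "cmod (deriv W1 0 - deriv W2 0) \<le> 0"
  proof (rule row_sol_deriv_diff[OF 1 2])
    fix z :: complex assume "cmod z = 1"
    then have "g z \<noteq> 0" "p1 z = U1 (1 / z) + g z * W1 (1 / z)" "q1 z = W1 (1 / z) - U1 (1 / z) / g z"
      "p2 z = U2 (1 / z) + g z * W2 (1 / z)" "q2 z = W2 (1 / z) - U2 (1 / z) / g z"
      using 1 2 by (auto simp: row_sol_def)
    note e = this
    show "cmod (W1 (1 / z) * U2 (1 / z) - U1 (1 / z) * W2 (1 / z) - (p2 z * q1 z - p1 z * q2 z) / 2) \<le> 0"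
      unfolding e(2-5) using e(1) by (simp add: field_simps)
  qed
  then show ?thesis by simp
qed

lemma row_sol_compare:
  assumes 1: "row_sol g1 U1 W1 p1 q1" and 2: "row_sol g2 U2 W2 p2 q2"
    and C: "\<And>w f. cmod w = 1 \<Longrightarrow> f \<in> {U1, W1, U2, W2} \<Longrightarrow> cmod (f w) \<le> C"
    and G: "\<And>z. cmod z = 1 \<Longrightarrow> cmod (1 / g1 z) \<le> G \<and> cmod (1 / g2 z) \<le> G"
    and d: "\<And>z. cmod z = 1 \<Longrightarrow> cmod (g1 z - g2 z) \<le> d"
  shows "cmod (deriv W1 0 - deriv W2 0) \<le> C\<^sup>2 * (1 + G)\<^sup>2 * d"
proof (rule row_sol_deriv_diff[OF 1 2])
  fix z :: complex assume z: "cmod z = 1"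
  have z': "cmod (1 / z) = 1" using z by (simp add: norm_divide)
  note C' = C[OF z']
  define a1 a2 b1 b2 where ab: "a1 = U1 (1 / z)" "a2 = U2 (1 / z)" "b1 = W1 (1 / z)" "b2 = W2 (1 / z)"
  have C: "cmod a1 \<le> C" "cmod a2 \<le> C" "cmod b1 \<le> C" "cmod b2 \<le> C" using C' by (auto simp: ab)
  define h1 h2 where h: "h1 = 1 / g1 z" "h2 = 1 / g2 z"
  have gn: "g1 z \<noteq> 0" "g2 z \<noteq> 0" using z 1 2 by (auto simp: row_sol_def)
  have p: "p1 z = a1 + g1 z * b1" "q1 z = b1 - a1 * h1" "p2 z = a2 + g2 z * b2" "q2 z = b2 - a2 * h2"
    using z 1 2 by (auto simp: row_sol_def ab h)
  let ?D = "g1 z - g2 z"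
  \<comment> \<open>Every term of the mismatch carries the factor \<open>g1 - g2\<close>. The four
    coefficients are at most \<open>G^2\<close>, 1, \<open>G\<close> and \<open>G\<close> times
    \<open>C^2\<close>, which add up to \<open>C^2 (1 + G)^2\<close>.\<close>
  have e: "b1 * a2 - a1 * b2 - (p2 z * q1 z - p1 z * q2 z) / 2
     = ((a1 * a2) * (h1 * h2) * (- ?D) + (b1 * b2) * ?D + (b2 * a1) * (- h1) * ?D + (b1 * a2) * (- h2) * ?D) / 2"
  proof -
    have hg: "h1 * g1 z = 1" "h2 * g2 z = 1" using gn by (auto simp: h)
    then show ?thesis unfolding p by algebra
  qed
  have nb: "cmod h1 \<le> G" "cmod h2 \<le> G" "cmod ?D \<le> d" using G[OF z] d[OF z] by (auto simp: h)
  have pos: "0 \<le> C" "0 \<le> G" "0 \<le> d" using C(1) nb norm_ge_zero order_trans by blast+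
  have "cmod ((a1 * a2) * (h1 * h2) * (- ?D) + (b1 * b2) * ?D + (b2 * a1) * (- h1) * ?D + (b1 * a2) * (- h2) * ?D)
     \<le> (C * C) * (G * G) * d + (C * C) * d + (C * C) * G * d + (C * C) * G * d"
    by (intro order_trans[OF norm_triangle_ineq] add_mono)
      (auto simp: norm_mult norm_minus_commute intro!: mult_mono C nb pos mult_nonneg_nonneg)
  also have "\<dots> = C\<^sup>2 * (1 + G)\<^sup>2 * d" by (simp add: power2_eq_square algebra_simps)
  finally have "cmod (b1 * a2 - a1 * b2 - (p2 z * q1 z - p1 z * q2 z) / 2) \<le> C\<^sup>2 * (1 + G)\<^sup>2 * d / 2"
    unfolding e by (simp add: norm_divide)
  also have "\<dots> \<le> C\<^sup>2 * (1 + G)\<^sup>2 * d" using pos by (simp add: mult_nonneg_nonneg)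
  finally show "cmod (W1 (1 / z) * U2 (1 / z) - U1 (1 / z) * W2 (1 / z) - (p2 z * q1 z - p1 z * q2 z) / 2)
      \<le> C\<^sup>2 * (1 + G)\<^sup>2 * d" by (simp add: ab)
qed

lemma row_sol_of_model_RHP:
  assumes R: "model_RHP M X T R" and y: "((\<lambda>z. 2 * \<i> * z * R z $ 1 $ 2) \<longlongrightarrow> y) at_infinity"
  shows "\<exists>U W p q. row_sol (\<lambda>z. exp (2 * \<i> * thetaR M X T z)) U W p q \<and> y = 2 * \<i> * deriv W 0"
proof -
  let ?g = "\<lambda>z. exp (2 * \<i> * thetaR M X T z)"
  have hol: "(\<lambda>z. R z $ i $ j) holomorphic_on {z. cmod z \<noteq> 1}" for i j
    using R by (auto simp: model_RHP_def mholo_def)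
  have inf: "((\<lambda>z. R z $ i $ j) \<longlongrightarrow> (mat 1 :: complex^2^2) $ i $ j) at_infinity" for i j
    using R by (auto simp: model_RHP_def intro!: tendsto_vec_nth)
  have "\<forall>z. \<exists>Rm Rp. cmod z = 1 \<longrightarrow> (R \<longlongrightarrow> Rm) (at z within ball 0 1)
       \<and> (R \<longlongrightarrow> Rp) (at z within - cball 0 1) \<and> Rp = Rm ** jumpR (thetaR M X T z)"
    using R by (auto simp: model_RHP_def)
  from choice[OF this] obtain Rm where "\<forall>z. \<exists>Rp. cmod z = 1 \<longrightarrow> (R \<longlongrightarrow> Rm z) (at z within ball 0 1)
       \<and> (R \<longlongrightarrow> Rp) (at z within - cball 0 1) \<and> Rp = Rm z ** jumpR (thetaR M X T z)" ..
  from choice[OF this] obtain Rp where RR': "\<forall>z. cmod z = 1 \<longrightarrow> (R \<longlongrightarrow> Rm z) (at z within ball 0 1)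
       \<and> (R \<longlongrightarrow> Rp z) (at z within - cball 0 1) \<and> Rp z = Rm z ** jumpR (thetaR M X T z)" ..
  have RR: "\<And>z. cmod z = 1 \<Longrightarrow> (R \<longlongrightarrow> Rm z) (at z within ball 0 1)"
      "\<And>z. cmod z = 1 \<Longrightarrow> (R \<longlongrightarrow> Rp z) (at z within - cball 0 1)"
      "\<And>z. cmod z = 1 \<Longrightarrow> Rp z = Rm z ** jumpR (thetaR M X T z)"
    using RR' by auto
  have holx: "(\<lambda>z. R z $ i $ j) holomorphic_on {z. 1 < cmod z}" for i j
    using hol by (rule holomorphic_on_subset) auto
  have holi: "(\<lambda>z. R z $ i $ j) holomorphic_on ball 0 1" for i j
    using hol by (rule holomorphic_on_subset) auto
  have inf11: "((\<lambda>z. R z $ 1 $ 1) \<longlongrightarrow> 1) at_infinity" and inf12: "((\<lambda>z. R z $ 1 $ 2) \<longlongrightarrow> 0) at_infinity"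
    using inf[of 1 1] inf[of 1 2] by (simp_all add: mat_def)
  have RX: "((\<lambda>z. R z $ i $ j) \<longlongrightarrow> Rp z $ i $ j) (at z within - cball 0 1)"
    and RI: "((\<lambda>z. R z $ i $ j) \<longlongrightarrow> Rm z $ i $ j) (at z within ball 0 1)" if "cmod z = 1" for z i j
    using RR(1,2)[OF that] by (auto intro!: tendsto_vec_nth)
  obtain U where U: "continuous_on (cball 0 1) U" "U holomorphic_on ball 0 1" "U 0 = 1"
    "\<And>w. cmod w = 1 \<Longrightarrow> U w = Rp (1 / w) $ 1 $ 1"
    using exterior_extension[OF holx inf11 RX] by metis
  obtain W where W: "continuous_on (cball 0 1) W" "W holomorphic_on ball 0 1" "W 0 = 0"
    "\<And>w. w \<noteq> 0 \<Longrightarrow> cmod w < 1 \<Longrightarrow> W w = R (1 / w) $ 1 $ 2"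
    "\<And>w. cmod w = 1 \<Longrightarrow> W w = Rp (1 / w) $ 1 $ 2"
    using exterior_extension[OF holx inf12 RX] by metis
  obtain P where P: "continuous_on (cball 0 1) P" "P holomorphic_on ball 0 1"
    "\<And>w. cmod w = 1 \<Longrightarrow> P w = Rm w $ 1 $ 1"
    using interior_extension[OF holi RI] by metis
  obtain Q where Q: "continuous_on (cball 0 1) Q" "Q holomorphic_on ball 0 1"
    "\<And>w. cmod w = 1 \<Longrightarrow> Q w = Rm w $ 1 $ 2"
    using interior_extension[OF holi RI] by metis
  \<comment> \<open>The factor \<open>sqrt 2\<close> absorbs the normalization of
    \<open>Qmat\<close>, so the relations in \<open>row_sol\<close> carry no constants.\<close>
  define p q where "p = (\<lambda>z. sqrt 2 * P z)" and "q = (\<lambda>z. sqrt 2 * Q z)"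
  have "row_sol ?g U W p q"
    unfolding row_sol_def
  proof (intro conjI allI impI)
    show "\<forall>f\<in>{U, W, p, q}. continuous_on (cball 0 1) f \<and> f holomorphic_on ball 0 1"
      using U W P Q by (auto simp: p_def q_def intro!: continuous_intros holomorphic_intros)
  next
    fix z :: complex assume z: "cmod z = 1"
    have z': "cmod (1 / z) = 1" using z by (simp add: norm_divide)
    have s: "complex_of_real (sqrt 2) * complex_of_real (sqrt 2) = 2" "complex_of_real (sqrt 2) \<noteq> 0"
      by (simp_all flip: of_real_mult)
    define s2 g where "s2 = complex_of_real (sqrt 2)" and "g = ?g z"
    have s2: "s2 * s2 = 2" "s2 \<noteq> 0" using s by (simp_all add: s2_def)
    have g: "g \<noteq> 0" "exp (- 2 * \<i> * thetaR M X T z) = 1 / g"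
      by (simp_all add: g_def exp_minus inverse_eq_divide)
    have "U (1 / z) = P z / s2 - g * Q z / s2" "W (1 / z) = P z / (g * s2) + Q z / s2"
      using U(4)[OF z'] W(5)[OF z'] P(3)[OF z] Q(3)[OF z] RR(3)[OF z]
      unfolding jumpR_eq g(2) by (simp_all add: matrix_mult_2_nth s2_def g_def)
    then have UW: "U (1 / z) * s2 = P z - g * Q z" "W (1 / z) * s2 * g = P z + g * Q z"
      using g s2(2) by (simp_all add: field_simps)
    show "?g z \<noteq> 0" by simp
    have "s2 * (s2 * P z) = s2 * (U (1 / z) + g * W (1 / z))" using UW s2(1) by algebra
    then show "p z = U (1 / z) + ?g z * W (1 / z)"
      using s2 by (simp add: p_def s2_def[symmetric] g_def[symmetric])
    have "s2 * (g * (s2 * Q z)) = s2 * (g * W (1 / z) - U (1 / z))" using UW s2(1) by algebra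
    then have "g * (s2 * Q z) = g * W (1 / z) - U (1 / z)" using s2(2) mult_left_cancel by blast
    also have "\<dots> = g * (W (1 / z) - U (1 / z) / g)" using g(1) by (simp add: right_diff_distrib)
    finally have "g * (s2 * Q z) = g * (W (1 / z) - U (1 / z) / g)" .
    then show "q z = W (1 / z) - U (1 / z) / ?g z"
      using s2 g(1) by (simp add: q_def s2_def[symmetric] g_def[symmetric])
  qed (use U W in auto)
  moreover have "y = 2 * \<i> * deriv W 0"
  proof -
    have "((\<lambda>z. z * R z $ 1 $ 2) \<longlongrightarrow> deriv W 0) at_infinity"
      by (rule deriv_exterior_extension[of W 1]) (use W in auto)
    then have "((\<lambda>z. 2 * \<i> * (z * R z $ 1 $ 2)) \<longlongrightarrow> 2 * \<i> * deriv W 0) at_infinity"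
      by (intro tendsto_intros)
    from tendsto_unique[OF trivial_limit_at_infinity y this[folded mult.assoc]] show ?thesis
      by (simp add: mult.assoc)
  qed
  ultimately show ?thesis by blast
qed

lemma cnj_holomorphic_on:
  assumes "f holomorphic_on S" "open S" "\<And>z. z \<in> S \<Longrightarrow> cnj z \<in> S"
  shows "(\<lambda>z. cnj (f (cnj z))) holomorphic_on S"
proof -
  have "cnj ` S = S" using assms(3) by (metis complex_cnj_cnj image_subset_iff subsetI subset_antisym image_iff)
  then show ?thesis using holomorphic_on_compose_cnj_cnj[of f S] assms by (simp add: o_def)
qed

lemma tendsto_cnj_within:
  assumes "(f \<longlongrightarrow> l) (at (cnj z) within S)" "\<And>w. w \<in> S \<longleftrightarrow> cnj w \<in> S"
  shows "((\<lambda>w. cnj (f (cnj w))) \<longlongrightarrow> cnj l) (at z within S)"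
proof (rule tendsto_cnj, rule filterlim_compose[OF assms(1)])
  show "filterlim cnj (at (cnj z) within S) (at z within S)"
    unfolding filterlim_at
    using assms(2) by (auto simp: eventually_at intro!: tendsto_intros exI[of _ 1])
qed

lemma model_RHP_of_row_sol:
  assumes rs: "row_sol (\<lambda>z. exp (2 * \<i> * thetaR M X T z)) U W p q"
  shows "\<exists>R. model_RHP M X T R \<and> ((\<lambda>z. 2 * \<i> * z * R z $ 1 $ 2) \<longlongrightarrow> 2 * \<i> * deriv W 0) at_infinity"
proof -
  let ?g = "\<lambda>z. exp (2 * \<i> * thetaR M X T z)"
  define u w where "u = (\<lambda>z. U (1 / z))" and "w = (\<lambda>z. W (1 / z))"
  define st where "st = (\<lambda>f z. cnj (f (cnj z)))" for f :: "complex \<Rightarrow> complex"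
  define c where "c = complex_of_real (1 / sqrt 2)"
  define E where "E = (\<lambda>z. mat2 (u z) (w z) (- st w z) (st u z))"
  define I where "I = (\<lambda>z. mat2 (c * p z) (c * q z) (- c * st q z) (c * st p z))"
  define R where "R = (\<lambda>z. if cmod z < 1 then I z else E z)"
  have ho: "f holomorphic_on ball 0 1" "continuous_on (cball 0 1) f" if "f \<in> {U, W, p, q}" for f
    using rs that by (auto simp: row_sol_def)
  have inv: "(\<lambda>z. f (1 / z)) holomorphic_on {z. 1 < cmod z}" if "f \<in> {U, W}" for f
  proof (rule holomorphic_on_compose_gen[of "\<lambda>z. 1 / z", unfolded o_def])
    show "f holomorphic_on ball 0 1" using ho that by auto
    show "(\<lambda>z. 1 / z) holomorphic_on {z. 1 < cmod z}" by (intro holomorphic_intros) auto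
    show "(\<lambda>z. 1 / z) ` {z. 1 < cmod z} \<subseteq> ball 0 1"
      by (auto simp: norm_divide divide_less_eq)
  qed
  have opn: "open {z::complex. 1 < cmod z}" "open {z::complex. cmod z < 1}" by (auto intro!: open_Collect_less continuous_intros)
  have hE: "(\<lambda>z. E z $ i $ j) holomorphic_on {z. 1 < cmod z}" for i j
    using exhaust_2[of i] exhaust_2[of j] inv[of U] inv[of W]
    by (auto simp: E_def st_def u_def[symmetric] w_def[symmetric] intro!: holomorphic_intros cnj_holomorphic_on opn)
  have hI: "(\<lambda>z. I z $ i $ j) holomorphic_on {z. cmod z < 1}" for i j
  proof -
    have b: "ball 0 1 = {z::complex. cmod z < 1}" by auto
    have h: "p holomorphic_on {z. cmod z < 1}" "q holomorphic_on {z. cmod z < 1}"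
      using ho(1)[of p] ho(1)[of q] unfolding b by auto
    have "st p holomorphic_on {z. cmod z < 1}" "st q holomorphic_on {z. cmod z < 1}"
      unfolding st_def by (intro cnj_holomorphic_on h opn; simp)+
    with h have "(\<lambda>z. c * p z) holomorphic_on {z. cmod z < 1}" "(\<lambda>z. c * q z) holomorphic_on {z. cmod z < 1}"
      "(\<lambda>z. - c * st q z) holomorphic_on {z. cmod z < 1}" "(\<lambda>z. c * st p z) holomorphic_on {z. cmod z < 1}"
      by (auto intro!: holomorphic_on_mult holomorphic_on_const holomorphic_on_minus)
    then show ?thesis
      using exhaust_2[of i] exhaust_2[of j] unfolding I_def by auto
  qed
  have "mholo R {z. cmod z \<noteq> 1}"
    unfolding mholo_def
  proof (intro allI)
    fix i j :: 2
    have "(\<lambda>z. R z $ i $ j) holomorphic_on {z. 1 < cmod z} \<union> {z. cmod z < 1}"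
    proof (intro holomorphic_on_Un opn)
      show "(\<lambda>z. R z $ i $ j) holomorphic_on {z. 1 < cmod z}"
        using hE by (rule holomorphic_transform) (auto simp: R_def)
      show "(\<lambda>z. R z $ i $ j) holomorphic_on {z. cmod z < 1}"
        using hI by (rule holomorphic_transform) (auto simp: R_def)
    qed
    also have "{z. 1 < cmod z} \<union> {z. cmod z < 1} = {z. cmod z \<noteq> 1}" by auto
    finally show "(\<lambda>z. R z $ i $ j) holomorphic_on {z. cmod z \<noteq> 1}" .
  qed
  moreover have "\<exists>Rm Rp. (R \<longlongrightarrow> Rm) (at z within ball 0 1) \<and> (R \<longlongrightarrow> Rp) (at z within - cball 0 1)
       \<and> Rp = Rm ** jumpR (thetaR M X T z)" if z: "cmod z = 1" for z
  proof (intro exI conjI)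
    have pq: "(f \<longlongrightarrow> f z) (at z within ball 0 1)" if "f \<in> {p, q}" "cmod z = 1" for f z
    proof -
      have "(f \<longlongrightarrow> f z) (at z within cball 0 1)" using ho(2)[of f] that by (auto simp: continuous_on_def)
      then show ?thesis by (rule tendsto_within_subset) auto
    qed
    have uw: "((\<lambda>z. f (1 / z)) \<longlongrightarrow> f (1 / z)) (at z within - cball 0 1)" if "f \<in> {U, W}" "cmod z = 1" for f z
    proof -
      have "continuous_on (- ball 0 1) (\<lambda>z. f (1 / z))"
        by (rule continuous_on_compose2[OF ho(2)])
          (use that in \<open>auto intro!: continuous_intros simp: norm_divide divide_le_eq\<close>)
      then have "((\<lambda>z. f (1 / z)) \<longlongrightarrow> f (1 / z)) (at z within - ball 0 1)"
        using that by (auto simp: continuous_on_def)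
      then show ?thesis by (rule tendsto_within_subset) auto
    qed
    have cz: "cmod (cnj z) = 1" using z by simp
    have stI: "(st f \<longlongrightarrow> st f z) (at z within ball 0 1)" if "f \<in> {p, q}" for f
      unfolding st_def by (rule tendsto_cnj_within) (use pq[OF that cz] in auto)
    have stE: "(st (\<lambda>z. f (1 / z)) \<longlongrightarrow> st (\<lambda>z. f (1 / z)) z) (at z within - cball 0 1)" if "f \<in> {U, W}" for f
      unfolding st_def by (rule tendsto_cnj_within) (use uw[OF that cz] in auto)
    have "(I \<longlongrightarrow> I z) (at z within ball 0 1)"
      unfolding I_def mat2_def
      by (intro vec_tendstoI) (auto intro!: tendsto_intros pq[of p] pq[of q] stI[of p] stI[of q] z)
    then show "(R \<longlongrightarrow> I z) (at z within ball 0 1)"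
      by (rule Lim_transform_eventually) (auto simp: eventually_at R_def intro!: exI[of _ 1])
    have "(E \<longlongrightarrow> E z) (at z within - cball 0 1)"
      unfolding E_def mat2_def
      by (intro vec_tendstoI) (auto intro!: tendsto_intros uw[of U] uw[of W] stE[of U] stE[of W] z simp: u_def w_def)
    then show "(R \<longlongrightarrow> E z) (at z within - cball 0 1)"
      by (rule Lim_transform_eventually) (auto simp: eventually_at R_def intro!: exI[of _ 1])
    show "E z = I z ** jumpR (thetaR M X T z)"
    proof -
      define g where "g = ?g z"
      have g0: "g \<noteq> 0" by (simp add: g_def)
      have th: "cnj (thetaR M X T (cnj z)) = thetaR M X T z"
        by (simp add: thetaR_def)
      have cg: "cnj (?g (cnj z)) = 1 / g"
        using th by (simp add: g_def exp_cnj exp_minus inverse_eq_divide)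
      have pq: "p z = u z + g * w z" "q z = w z - u z / g"
        using rs z by (auto simp: row_sol_def u_def w_def g_def)
      have pqc: "p (cnj z) = u (cnj z) + ?g (cnj z) * w (cnj z)" "q (cnj z) = w (cnj z) - u (cnj z) / ?g (cnj z)"
        using rs cz by (auto simp: row_sol_def u_def w_def)
      have st: "st p z = st u z + st w z / g" "st q z = st w z - st u z * g"
      proof -
        show "st p z = st u z + st w z / g" unfolding st_def pqc by (simp add: cg)
        have "cnj (u (cnj z) / ?g (cnj z)) = st u z * g"
          unfolding complex_cnj_divide cg st_def by simp
        then show "st q z = st w z - st u z * g" unfolding st_def pqc by simp
      qed
      have cc: "c * c = 1 / 2" by (simp add: c_def flip: of_real_mult)
      have J: "jumpR (thetaR M X T z) = mat2 c (c / g) (- c * g) c"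
        by (simp add: jumpR_eq c_def g_def exp_minus inverse_eq_divide mult.commute)
      show ?thesis
        unfolding J mat2_cong matrix_mult_2_nth E_def I_def mat2_nth st pq
      proof (intro conjI)
        have k: "c * a * c + c * b * (- c * g) = (a - g * b) / 2" "c * a * (c / g) + c * b * c = (a / g + b) / 2"
          "- c * a * c + c * b * (- c * g) = (- a - g * b) / 2" "- c * a * (c / g) + c * b * c = (- a / g + b) / 2" for a b
          using cc by (simp_all add: field_simps)
        show "u z = c * (u z + g * w z) * c + c * (w z - u z / g) * (- c * g)"
          unfolding k using g0 by (simp add: field_simps)
        show "w z = c * (u z + g * w z) * (c / g) + c * (w z - u z / g) * c"
          unfolding k using g0 by (simp add: field_simps)
        show "- st w z = - c * (st w z - st u z * g) * c + c * (st u z + st w z / g) * (- c * g)"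
          unfolding k using g0 by (simp add: field_simps)
        show "st u z = - c * (st w z - st u z * g) * (c / g) + c * (st u z + st w z / g) * c"
          unfolding k using g0 by (simp add: field_simps)
      qed
    qed
  qed
  moreover have inf: "(u \<longlongrightarrow> 1) at_infinity" "(w \<longlongrightarrow> 0) at_infinity"
  proof -
    have "isCont f 0" if "f \<in> {U, W}" for f
      using ho(1)[of f] that by (auto intro!: field_differentiable_imp_continuous_at
         simp: holomorphic_on_open field_differentiable_def)
    from this[of U] this[of W] have "(U \<longlongrightarrow> 1) (at 0)" "(W \<longlongrightarrow> 0) (at 0)"
      using rs by (auto simp: isCont_def row_sol_def)
    then show "(u \<longlongrightarrow> 1) at_infinity" "(w \<longlongrightarrow> 0) at_infinity"
      by (simp_all add: lim_at_infinity_0 u_def w_def o_def inverse_eq_divide)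
  qed
  have Req: "\<forall>\<^sub>F z in at_infinity. E z = R z"
    unfolding eventually_at_infinity by (rule exI[of _ 1]) (auto simp: R_def)
  have cinf: "filterlim cnj at_infinity at_infinity"
    unfolding filterlim_at_infinity_conv_norm_at_top by (simp add: filterlim_norm_at_top)
  have "(R \<longlongrightarrow> mat 1) at_infinity"
  proof (rule Lim_transform_eventually[OF _ Req])
    have sinf: "(st f \<longlongrightarrow> cnj l) at_infinity" if "(f \<longlongrightarrow> l) at_infinity" for f l
      unfolding st_def by (intro tendsto_cnj filterlim_compose[OF that cinf])
    show "(E \<longlongrightarrow> mat 1) at_infinity"
    proof (rule vec_tendstoI, rule vec_tendstoI)
      fix i j :: 2
      show "((\<lambda>z. E z $ i $ j) \<longlongrightarrow> (mat 1 :: complex^2^2) $ i $ j) at_infinity"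
        using inf sinf[OF inf(1)] tendsto_minus[OF sinf[OF inf(2)]] exhaust_2[of i] exhaust_2[of j]
        by (auto simp: E_def mat_def)
    qed
  qed
  moreover have "((\<lambda>z. 2 * \<i> * z * R z $ 1 $ 2) \<longlongrightarrow> 2 * \<i> * deriv W 0) at_infinity"
  proof -
    have "((\<lambda>z. z * w z) \<longlongrightarrow> deriv W 0) at_infinity"
      by (rule deriv_exterior_extension[of W 1]) (use rs in \<open>auto simp: row_sol_def w_def\<close>)
    then have "((\<lambda>z. 2 * \<i> * (z * w z)) \<longlongrightarrow> 2 * \<i> * deriv W 0) at_infinity"
      by (intro tendsto_intros)
    then show ?thesis
    proof (rule Lim_transform_eventually)
      show "\<forall>\<^sub>F z in at_infinity. 2 * \<i> * (z * w z) = 2 * \<i> * z * R z $ 1 $ 2"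
        using Req
      proof eventually_elim
        case (elim z)
        show ?case unfolding elim[symmetric] by (simp add: E_def)
      qed
    qed
  qed
  ultimately show ?thesis by (auto simp: model_RHP_def)
qed

text \<open>\<open>PsiR\<close> is a definite description of the moment and not of the matrix, so
  one solution together with uniqueness of the moment determines it.\<close>

lemma PsiR_eq:
  assumes "row_sol (\<lambda>z. exp (2 * \<i> * thetaR M X T z)) U W p q"
  shows "PsiR M X T = 2 * \<i> * deriv W 0"
  unfolding PsiR_def
proof (rule the_equality)
  show "\<exists>R. model_RHP M X T R \<and> ((\<lambda>z. 2 * \<i> * z * R z $ 1 $ 2) \<longlongrightarrow> 2 * \<i> * deriv W 0) at_infinity"
    by (rule model_RHP_of_row_sol[OF assms])
next
  fix y assume "\<exists>R. model_RHP M X T R \<and> ((\<lambda>z. 2 * \<i> * z * R z $ 1 $ 2) \<longlongrightarrow> y) at_infinity"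
  then obtain U' W' p' q' where "row_sol (\<lambda>z. exp (2 * \<i> * thetaR M X T z)) U' W' p' q'" "y = 2 * \<i> * deriv W' 0"
    using row_sol_of_model_RHP by blast
  then show "y = 2 * \<i> * deriv W 0" using row_sol_unique[OF assms] by simp
qed

section \<open>Partial fractions, the residue system and its unitarity\<close>

definition pfrac :: "complex \<Rightarrow> nat \<Rightarrow> (nat \<Rightarrow> complex) \<Rightarrow> (nat \<Rightarrow> complex) \<Rightarrow> complex \<Rightarrow> complex" where
  "pfrac e N a \<alpha> z = e + (\<Sum>k<N. \<alpha> k / (z - a k))"

lemma pfrac_holomorphic: "pfrac e N a \<alpha> holomorphic_on - (a ` {..<N})"
  unfolding pfrac_def by (intro holomorphic_intros) auto

lemma pfrac_isCont: "z \<notin> a ` {..<N} \<Longrightarrow> isCont (pfrac e N a \<alpha>) z"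
  using holomorphic_on_imp_continuous_on[OF pfrac_holomorphic[of e N a \<alpha>]]
  by (metis ComplI continuous_on_eq_continuous_at finite_imageI finite_imp_closed finite_lessThan open_Compl)

lemma pfrac_tendsto: "z \<notin> a ` {..<N} \<Longrightarrow> (pfrac e N a \<alpha> \<longlongrightarrow> pfrac e N a \<alpha> z) (at z)"
  using pfrac_isCont isCont_def by blast

lemma pfrac_cnj: "cnj (pfrac e N a \<alpha> (cnj z)) = pfrac (cnj e) N (\<lambda>k. cnj (a k)) (\<lambda>k. cnj (\<alpha> k)) z"
  by (simp add: pfrac_def)

lemma pfrac_residue:
  assumes "inj_on a {..<N}" "k < N"
  shows "((\<lambda>z. (z - a k) * pfrac e N a \<alpha> z) \<longlongrightarrow> \<alpha> k) (at (a k))"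
proof -
  have e: "(z - a k) * pfrac e N a \<alpha> z
     = (z - a k) * (e + (\<Sum>j\<in>{..<N} - {k}. \<alpha> j / (z - a j))) + \<alpha> k" if "z \<noteq> a k" for z
  proof -
    have "(\<Sum>j<N. \<alpha> j / (z - a j)) = \<alpha> k / (z - a k) + (\<Sum>j\<in>{..<N} - {k}. \<alpha> j / (z - a j))"
      using assms by (subst sum.remove[of _ k]) auto
    then show ?thesis using that by (simp add: pfrac_def field_simps)
  qed
  have "((\<lambda>z. (z - a k) * (e + (\<Sum>j\<in>{..<N} - {k}. \<alpha> j / (z - a j))) + \<alpha> k) \<longlongrightarrow>
      (a k - a k) * (e + (\<Sum>j\<in>{..<N} - {k}. \<alpha> j / (a k - a j))) + \<alpha> k) (at (a k))"
    using assms by (intro tendsto_intros) (auto dest: inj_onD)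
  then have "((\<lambda>z. (z - a k) * (e + (\<Sum>j\<in>{..<N} - {k}. \<alpha> j / (z - a j))) + \<alpha> k) \<longlongrightarrow> \<alpha> k) (at (a k))"
    by simp
  then show ?thesis
    by (rule Lim_transform_eventually)
      (auto simp: eventually_at e intro!: exI[of _ 1])
qed

lemma pfrac_at_infinity: "(pfrac e N a \<alpha> \<longlongrightarrow> e) at_infinity"
  and pfrac_moment: "((\<lambda>z. z * (pfrac e N a \<alpha> z - e)) \<longlongrightarrow> (\<Sum>k<N. \<alpha> k)) at_infinity"
proof -
  have i: "((\<lambda>z. \<alpha> k / (z - a k)) \<longlongrightarrow> 0) at_infinity" for k
  proof (rule tendsto_divide_0[OF tendsto_const])
    show "filterlim (\<lambda>z. z - a k) at_infinity at_infinity"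
      using tendsto_add_filterlim_at_infinity[OF tendsto_const[of "- a k"] filterlim_ident] by simp
  qed
  then have "((\<lambda>z. e + (\<Sum>k<N. \<alpha> k / (z - a k))) \<longlongrightarrow> e + (\<Sum>k<N. 0)) at_infinity"
    by (intro tendsto_intros)
  then show "(pfrac e N a \<alpha> \<longlongrightarrow> e) at_infinity"
    unfolding pfrac_def[abs_def] by simp
  have "((\<lambda>z. \<Sum>k<N. \<alpha> k + a k * (\<alpha> k / (z - a k))) \<longlongrightarrow> (\<Sum>k<N. \<alpha> k + a k * 0)) at_infinity"
    using i by (intro tendsto_intros)
  then have "((\<lambda>z. \<Sum>k<N. \<alpha> k + a k * (\<alpha> k / (z - a k))) \<longlongrightarrow> (\<Sum>k<N. \<alpha> k)) at_infinity" by simp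
  then show "((\<lambda>z. z * (pfrac e N a \<alpha> z - e)) \<longlongrightarrow> (\<Sum>k<N. \<alpha> k)) at_infinity"
  proof (rule Lim_transform_eventually)
    have "bounded (a ` {..<N})" by (simp add: finite_imp_bounded)
    then obtain B where B: "\<And>k. k < N \<Longrightarrow> cmod (a k) \<le> B" by (auto simp: bounded_iff)
    show "\<forall>\<^sub>F z in at_infinity. (\<Sum>k<N. \<alpha> k + a k * (\<alpha> k / (z - a k))) = z * (pfrac e N a \<alpha> z - e)"
      unfolding eventually_at_infinity
    proof (intro exI[of _ "B + 1"] allI impI)
      fix z assume z: "B + 1 \<le> cmod z"
      have "\<alpha> k + a k * (\<alpha> k / (z - a k)) = z * (\<alpha> k / (z - a k))" if "k < N" for k
      proof -
        have "z \<noteq> a k" using B[OF that] z by auto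
        then show ?thesis by (simp add: field_simps)
      qed
      then show "(\<Sum>k<N. \<alpha> k + a k * (\<alpha> k / (z - a k))) = z * (pfrac e N a \<alpha> z - e)"
        by (simp add: pfrac_def sum_distrib_left)
    qed
  qed
qed

text \<open>Residue conditions for a row \<open>(u, w)\<close> with the poles of \<open>u\<close> at
  \<open>\<i> y k\<close> and those of \<open>w\<close> at the conjugate points. The sign is such
  that \<open>u + g w\<close> is regular when \<open>r k\<close> is the residue of \<open>g\<close>;
  the discrete Riemann-Hilbert problem corresponds to \<open>r = - c\<close>. The value
  \<open>e\<close> of \<open>u\<close> at infinity is a parameter, so that \<open>e = 0\<close> is
  the homogeneous system.\<close>

definition pole_system :: "complex \<Rightarrow> nat \<Rightarrow> (nat \<Rightarrow> real) \<Rightarrow> (nat \<Rightarrow> complex) \<Rightarrow> (nat \<Rightarrow> complex) \<Rightarrow> (nat \<Rightarrow> complex) \<Rightarrow> bool"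
  where "pole_system e N y r \<alpha> \<gamma> \<longleftrightarrow> (\<forall>k<N.
      \<alpha> k = - r k * pfrac 0 N (\<lambda>j. - \<i> * y j) \<gamma> (\<i> * y k)
    \<and> \<gamma> k = cnj (r k) * pfrac e N (\<lambda>j. \<i> * y j) \<alpha> (- \<i> * y k))"

lemma tendsto_zero_mult_isCont:
  fixes f :: "complex \<Rightarrow> complex"
  assumes "(f \<longlongrightarrow> l) (at \<xi>)"
  shows "((\<lambda>z. (z - \<xi>) * f z) \<longlongrightarrow> 0) (at \<xi>)"
proof -
  have "((\<lambda>z. (z - \<xi>) * f z) \<longlongrightarrow> (\<xi> - \<xi>) * l) (at \<xi>)" by (intro tendsto_intros assms)
  then show ?thesis by simp
qed

text \<open>Let a star denote Schwarz reflection. In \<open>u u* + w w*\<close> the residues at each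
  pole cancel, one equation of the system against the conjugate of the other. The sum is therefore
  entire, hence constant by Liouville, and on the real line the stars are complex
  conjugates.\<close>

lemma pole_system_unitary:
  fixes y :: "nat \<Rightarrow> real"
  assumes inj: "inj_on y {..<N}" and pos: "\<And>k. k < N \<Longrightarrow> 0 < y k"
    and sys: "pole_system e N y r \<alpha> \<gamma>"
  shows "(cmod (pfrac e N (\<lambda>j. \<i> * y j) \<alpha> (of_real x)))\<^sup>2
       + (cmod (pfrac 0 N (\<lambda>j. - \<i> * y j) \<gamma> (of_real x)))\<^sup>2 = (cmod e)\<^sup>2"
proof -
  define a b where "a = (\<lambda>j. \<i> * complex_of_real (y j))" and "b = (\<lambda>j. - \<i> * complex_of_real (y j))"
  have cab: "cnj (a k) = b k" "cnj (b k) = a k" for k by (simp_all add: a_def b_def)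
  have ia: "inj_on a {..<N}" and ib: "inj_on b {..<N}"
    using inj by (auto simp: inj_on_def a_def b_def)
  have Im: "0 < Im (a k)" "Im (b k) < 0" if "k < N" for k
    using pos that by (simp_all add: a_def b_def)
  have ab: "a k \<notin> b ` {..<N}" "b k \<notin> a ` {..<N}" if "k < N" for k
    using Im(1)[OF that] Im(2)[OF that] Im by fastforce+
  define u us where "u = pfrac e N a \<alpha>" and "us = pfrac (cnj e) N b (\<lambda>k. cnj (\<alpha> k))"
  define w ws where "w = pfrac 0 N b \<gamma>" and "ws = pfrac 0 N a (\<lambda>k. cnj (\<gamma> k))"
  have us: "us z = cnj (u (cnj z))" and ws: "ws z = cnj (w (cnj z))" for z
    by (simp_all add: u_def us_def w_def ws_def pfrac_cnj cab)
  define S where "S = a ` {..<N} \<union> b ` {..<N}"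
  define F where "F = (\<lambda>z. u z * us z + w z * ws z)"
  have \<alpha>: "\<alpha> k = - r k * w (a k)" and \<gamma>: "\<gamma> k = cnj (r k) * u (b k)" if "k < N" for k
    using sys that by (auto simp: pole_system_def u_def w_def a_def b_def)
  have sing: "((\<lambda>z. (z - \<xi>) * F z) \<longlongrightarrow> 0) (at \<xi>)" if "\<xi> \<in> S" for \<xi>
  proof -
    from that consider k where "k < N" "\<xi> = a k" | k where "k < N" "\<xi> = b k" by (auto simp: S_def)
    then show ?thesis
    proof cases
      case 1
      have "((\<lambda>z. ((z - \<xi>) * u z) * us z + w z * ((z - \<xi>) * ws z)) \<longlongrightarrow> \<alpha> k * us \<xi> + w \<xi> * cnj (\<gamma> k)) (at \<xi>)"
        unfolding 1 u_def us_def w_def ws_def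
        by (intro tendsto_add tendsto_mult pfrac_residue pfrac_tendsto ia 1 ab)
      moreover have "\<alpha> k * us \<xi> + w \<xi> * cnj (\<gamma> k) = 0"
        using 1 by (simp add: \<alpha> \<gamma> us cab algebra_simps)
      ultimately show ?thesis by (simp add: F_def algebra_simps)
    next
      case 2
      have "((\<lambda>z. u z * ((z - \<xi>) * us z) + ((z - \<xi>) * w z) * ws z) \<longlongrightarrow> u \<xi> * cnj (\<alpha> k) + \<gamma> k * ws \<xi>) (at \<xi>)"
        unfolding 2 u_def us_def w_def ws_def
        by (intro tendsto_add tendsto_mult pfrac_residue pfrac_tendsto ib 2 ab)
      moreover have "u \<xi> * cnj (\<alpha> k) + \<gamma> k * ws \<xi> = 0"
        using 2 by (simp add: \<alpha> \<gamma> ws cab algebra_simps)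
      ultimately show ?thesis by (simp add: F_def algebra_simps)
    qed
  qed
  have "F holomorphic_on - S"
    unfolding F_def u_def us_def w_def ws_def S_def
    by (intro holomorphic_intros holomorphic_on_subset[OF pfrac_holomorphic]) auto
  then obtain h where h: "h holomorphic_on UNIV" "\<And>z. z \<notin> S \<Longrightarrow> h z = F z"
    by (rule removable_finite_singularities[rotated]) (auto simp: S_def sing)
  have "(F \<longlongrightarrow> e * cnj e + 0 * 0) at_infinity"
    unfolding F_def u_def us_def w_def ws_def by (intro tendsto_intros pfrac_at_infinity)
  moreover have "\<forall>\<^sub>F z in at_infinity. F z = h z"
  proof -
    have "bounded S" by (simp add: finite_imp_bounded S_def)
    then obtain B where "\<And>z. z \<in> S \<Longrightarrow> cmod z \<le> B" by (auto simp: bounded_iff)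
    then have "\<forall>z. B + 1 \<le> cmod z \<longrightarrow> F z = h z" using h(2) by (smt (verit))
    then show ?thesis unfolding eventually_at_infinity by blast
  qed
  ultimately have "(h \<longlongrightarrow> e * cnj e) at_infinity" by (auto intro: Lim_transform_eventually)
  with h(1) have "h x = e * cnj e" by (rule Liouville_weak)
  moreover have "of_real x \<notin> S"
    using Im by (fastforce simp: S_def complex_eq_iff)
  ultimately have "F x = e * cnj e" using h(2) by simp
  then have "complex_of_real ((cmod (u x))\<^sup>2 + (cmod (w x))\<^sup>2) = complex_of_real ((cmod e)\<^sup>2)"
    by (simp only: of_real_add complex_norm_square) (simp add: F_def us ws)
  then show ?thesis unfolding of_real_eq_iff by (simp add: u_def w_def a_def b_def)
qed

text \<open>Vanishing on the real line spreads to the connected complement of the poles, and there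
  the residues can be read off.\<close>

lemma pfrac_zero_on_reals:
  assumes inj: "inj_on a {..<N}" and nr: "\<And>k. k < N \<Longrightarrow> Im (a k) \<noteq> 0"
    and z: "\<And>x. pfrac e N a \<alpha> (of_real x) = 0" and k: "k < N"
  shows "\<alpha> k = 0"
proof -
  let ?S = "- (a ` {..<N})"
  have op: "open ?S" by (simp add: finite_imp_closed open_Compl)
  have "connected (UNIV - a ` {..<N})" by (intro connected_open_delete_finite) auto
  then have cn: "connected ?S" by (simp add: Compl_eq_Diff_UNIV)
  have "pfrac e N a \<alpha> w = 0" if "w \<in> ?S" for w
  proof (rule analytic_continuation[OF pfrac_holomorphic op cn, of "range complex_of_real" 0])
    have "complex_of_real x \<notin> a ` {..<N}" for x
    proof
      assume "complex_of_real x \<in> a ` {..<N}"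
      then obtain k where "k < N" "complex_of_real x = a k" by blast
      with nr[of k] show False by (metis Im_complex_of_real)
    qed
    then have "complex_of_real x \<in> ?S" for x by simp
    then show "range complex_of_real \<subseteq> ?S" by (rule image_subsetI)
    then show "0 \<in> ?S" using of_real_0[where 'a = complex] by (metis rangeI subsetD)
    show "0 islimpt range complex_of_real"
      unfolding islimpt_approachable
    proof (intro allI impI)
      fix d :: real assume "0 < d"
      then show "\<exists>x'\<in>range complex_of_real. x' \<noteq> 0 \<and> dist x' 0 < d"
        by (intro bexI[of _ "complex_of_real (d / 2)"] rangeI) auto
    qed
  qed (use z that in auto)
  then have "\<forall>\<^sub>F z in at (a k). (z - a k) * pfrac e N a \<alpha> z = 0"
  proof -
    have "open (- (a ` ({..<N} - {k})))" by (intro open_Compl finite_imp_closed) auto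
    then have "\<forall>\<^sub>F z in at (a k). z \<in> - (a ` ({..<N} - {k}))"
      using inj k by (intro eventually_at_in_open') (auto dest: inj_onD)
    moreover have "\<forall>\<^sub>F z in at (a k). z \<noteq> a k" by (rule eventually_neq_at_within)
    ultimately show ?thesis
      by eventually_elim (use \<open>\<And>w. w \<in> ?S \<Longrightarrow> pfrac e N a \<alpha> w = 0\<close> in force)
  qed
  from tendsto_eventually[OF this] pfrac_residue[OF inj k, of e \<alpha>] show ?thesis
    using tendsto_unique[OF at_neq_bot] by blast
qed

text \<open>Eliminating \<open>\<alpha>\<close> through \<open>al\<close> leaves \<open>N\<close>
  equations for the \<open>N\<close> unknowns \<open>\<gamma>\<close>, with matrix \<open>A\<close>.
  A kernel vector solves the system with \<open>e = 0\<close>; unitarity makes its \<open>w\<close>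
  vanish on the real line, so all its residues are 0.\<close>

lemma pole_system_exists:
  fixes y :: "nat \<Rightarrow> real"
  assumes inj: "inj_on y {..<N}" and pos: "\<And>k. k < N \<Longrightarrow> 0 < y k"
  shows "\<exists>\<alpha> \<gamma>. pole_system 1 N y r \<alpha> \<gamma>"
proof -
  define a b where "a = (\<lambda>j. \<i> * complex_of_real (y j))" and "b = (\<lambda>j. - \<i> * complex_of_real (y j))"
  define al where "al = (\<lambda>\<gamma> k. - r k * pfrac 0 N b \<gamma> (a k))"
  define A where "A = (\<lambda>k l. (if k = l then 1 else 0) + cnj (r k) * (\<Sum>j<N. r j / ((b k - a j) * (a j - b l))))"
  have sys: "pole_system e N y r (al \<gamma>) \<gamma>" if "\<forall>k\<in>{..<N}. (\<Sum>l\<in>{..<N}. A k l * \<gamma> l) = cnj (r k) * e" for e \<gamma>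
  proof -
    have "\<gamma> k = cnj (r k) * pfrac e N a (al \<gamma>) (b k)" if k: "k < N" for k
    proof -
      have "A k l * \<gamma> l = (if k = l then \<gamma> l else 0)
          + cnj (r k) * (\<Sum>j<N. r j / ((b k - a j) * (a j - b l)) * \<gamma> l)" for l
        unfolding A_def sum_distrib_right[symmetric] by (simp add: distrib_right)
      then have "(\<Sum>l<N. A k l * \<gamma> l) = \<gamma> k + cnj (r k) * (\<Sum>l<N. \<Sum>j<N. r j / ((b k - a j) * (a j - b l)) * \<gamma> l)"
        using k by (simp add: sum.distrib sum_distrib_left)
      also have "(\<Sum>l<N. \<Sum>j<N. r j / ((b k - a j) * (a j - b l)) * \<gamma> l)
           = (\<Sum>j<N. \<Sum>l<N. r j / ((b k - a j) * (a j - b l)) * \<gamma> l)" by (rule sum.swap)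
      also have "\<dots> = (\<Sum>j<N. - al \<gamma> j / (b k - a j))"
        by (intro sum.cong)
          (simp_all add: al_def pfrac_def sum_negf sum_distrib_left sum_divide_distrib mult_ac)
      finally show ?thesis using that k \<open>\<forall>k\<in>{..<N}. _\<close>
        by (simp add: pfrac_def sum_negf algebra_simps)
    qed
    then show ?thesis by (auto simp: pole_system_def al_def a_def b_def)
  qed
  have "\<exists>\<gamma>. \<forall>k\<in>{..<N}. (\<Sum>l\<in>{..<N}. A k l * \<gamma> l) = cnj (r k) * 1"
  proof (rule square_system_solvable)
    fix \<gamma> assume "\<forall>k\<in>{..<N}. (\<Sum>l\<in>{..<N}. A k l * \<gamma> l) = 0"
    then have "pole_system 0 N y r (al \<gamma>) \<gamma>" using sys[of \<gamma> 0] by simp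
    from pole_system_unitary[OF inj pos this]
    have "pfrac 0 N b \<gamma> (of_real x) = 0" for x
      by (simp add: b_def)
    moreover have "inj_on b {..<N}" using inj by (auto simp: inj_on_def b_def)
    moreover have "Im (b k) \<noteq> 0" if "k < N" for k using pos[OF that] by (simp add: b_def)
    ultimately show "\<forall>k\<in>{..<N}. \<gamma> k = 0" using pfrac_zero_on_reals[of b N 0 \<gamma>] by auto
  qed auto
  then show ?thesis using sys by blast
qed

section \<open>Maximum principle in the half plane and an exterior Cauchy estimate\<close>

lemma half_plane_maximum_modulus:
  assumes hol: "f holomorphic_on {z. 0 < Im z}" and cont: "continuous_on {z. 0 \<le> Im z} f"
    and re: "\<And>x. cmod (f (of_real x)) \<le> B" and inf: "\<forall>\<^sub>F z in at_infinity. cmod (f z) \<le> B"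
    and z: "0 \<le> Im z"
  shows "cmod (f z) \<le> B"
proof -
  obtain b where b: "\<And>z. b \<le> cmod z \<Longrightarrow> cmod (f z) \<le> B" using inf by (auto simp: eventually_at_infinity)
  define R where "R = max b (cmod z) + 1"
  define S where "S = {z. 0 \<le> Im z} \<inter> cball 0 R"
  have clS: "closed S" unfolding S_def by (intro closed_Int closed_halfspace_Im_ge closed_cball)
  have "open ({z. 0 < Im z} \<inter> ball 0 R)" by (intro open_Int open_halfspace_Im_gt open_ball)
  then have iS: "{z. 0 < Im z} \<inter> ball 0 R \<subseteq> interior S" by (rule interior_maximal[rotated]) (auto simp: S_def)
  have iS': "interior S \<subseteq> {z. 0 < Im z}"
  proof -
    have "0 < Im z" if zi: "z \<in> interior S" for z
    proof -
      obtain e where e: "0 < e" "cball z e \<subseteq> S" using zi mem_interior_cball[of z S] by blast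
      have "z - \<i> * e \<in> cball z e" using e(1) by (simp add: dist_norm norm_mult)
      with e(2) have "z - \<i> * e \<in> S" by blast
      then have "0 \<le> Im (z - \<i> * e)" unfolding S_def by blast
      then show ?thesis using e(1) by simp
    qed
    then show ?thesis by blast
  qed
  show ?thesis
  proof (rule maximum_modulus_frontier[of f S])
    show "f holomorphic_on interior S" using hol iS' by (rule holomorphic_on_subset)
    show "continuous_on (closure S) f" using cont clS by (auto simp: S_def intro: continuous_on_subset)
    show "bounded S" unfolding S_def by (rule bounded_subset[OF bounded_cball]) auto
    show "z \<in> S" using z by (auto simp: S_def R_def)
    fix w assume "w \<in> frontier S"
    then have w: "w \<in> S" "w \<notin> interior S" using clS by (auto simp: frontier_def)
    then have "w \<notin> {z. 0 < Im z} \<inter> ball 0 R" using iS by blast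
    then consider "Im w = 0" | "R \<le> cmod w" using w by (auto simp: S_def)
    then show "cmod (f w) \<le> B"
    proof cases
      case 1
      then have "w = of_real (Re w)" by (simp add: complex_eq_iff)
      then show ?thesis using re by metis
    next
      case 2
      then show ?thesis by (intro b) (auto simp: R_def)
    qed
  qed
qed

text \<open>Both \<open>w\<close> and the reflection of \<open>u\<close> have all their poles in the
  lower half plane, so the bounds on the real line extend upwards. The bound for \<open>u\<close> is
  2 and not 1 because \<open>hb\<close> asks for a bound strictly above the modulus of the value at
  infinity.\<close>

lemma pole_system_half_plane_bounds:
  fixes y :: "nat \<Rightarrow> real"
  assumes inj: "inj_on y {..<N}" and pos: "\<And>k. k < N \<Longrightarrow> 0 < y k"
    and sys: "pole_system 1 N y r \<alpha> \<gamma>" and z: "0 \<le> Im z"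
  shows "cmod (pfrac 0 N (\<lambda>j. - \<i> * y j) \<gamma> z) \<le> 1"
    and "cmod (pfrac 1 N (\<lambda>j. \<i> * y j) \<alpha> (cnj z)) \<le> 2"
proof -
  have sub: "{z. 0 \<le> Im z} \<subseteq> - ((\<lambda>j. - \<i> * complex_of_real (y j)) ` {..<N})" using pos by force
  have hb: "cmod (pfrac e N (\<lambda>j. - \<i> * y j) \<beta> z) \<le> B"
    if "\<And>x. cmod (pfrac e N (\<lambda>j. - \<i> * y j) \<beta> (of_real x)) \<le> B" "cmod e < B" for e \<beta> B
  proof (rule half_plane_maximum_modulus[where f = "pfrac e N (\<lambda>j. - \<i> * y j) \<beta>" and z = z])
    show "\<And>x. cmod (pfrac e N (\<lambda>j. - \<i> * y j) \<beta> (of_real x)) \<le> B" by (fact that(1))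
    show "0 \<le> Im z" by (fact z)
    have 1: "pfrac e N (\<lambda>j. - \<i> * y j) \<beta> holomorphic_on {z. 0 \<le> Im z}"
      by (rule holomorphic_on_subset[OF pfrac_holomorphic sub])
    then show "continuous_on {z. 0 \<le> Im z} (pfrac e N (\<lambda>j. - \<i> * y j) \<beta>)"
      by (rule holomorphic_on_imp_continuous_on)
    show "pfrac e N (\<lambda>j. - \<i> * y j) \<beta> holomorphic_on {z. 0 < Im z}"
      by (rule holomorphic_on_subset[OF 1]) auto
    have "\<forall>\<^sub>F z in at_infinity. cmod (pfrac e N (\<lambda>j. - \<i> * y j) \<beta> z) < B"
      using tendsto_norm[OF pfrac_at_infinity] that(2) by (rule order_tendstoD)
    then show "\<forall>\<^sub>F z in at_infinity. cmod (pfrac e N (\<lambda>j. - \<i> * y j) \<beta> z) \<le> B"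
      by eventually_elim simp
  qed
  have le1: "cmod (pfrac 1 N (\<lambda>j. \<i> * y j) \<alpha> (of_real x)) \<le> 1"
       "cmod (pfrac 0 N (\<lambda>j. - \<i> * y j) \<gamma> (of_real x)) \<le> 1" for x
    using pole_system_unitary[OF inj pos sys, of x] abs_square_le_1[of "cmod _"]
      zero_le_power2[of "cmod (pfrac 1 N (\<lambda>j. \<i> * y j) \<alpha> (of_real x))"]
      zero_le_power2[of "cmod (pfrac 0 N (\<lambda>j. - \<i> * y j) \<gamma> (of_real x))"]
    by (smt (verit) norm_ge_zero norm_one one_power2)+
  show "cmod (pfrac 0 N (\<lambda>j. - \<i> * y j) \<gamma> z) \<le> 1"
    by (rule hb) (use le1 in auto)
  have c: "cnj (pfrac 1 N (\<lambda>j. \<i> * y j) \<alpha> (cnj x)) = pfrac 1 N (\<lambda>j. - \<i> * y j) (\<lambda>k. cnj (\<alpha> k)) x" for x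
    by (simp add: pfrac_cnj)
  have "cmod (pfrac 1 N (\<lambda>j. - \<i> * y j) (\<lambda>k. cnj (\<alpha> k)) z) \<le> 2"
  proof (rule hb)
    fix x :: real
    show "cmod (pfrac 1 N (\<lambda>j. - \<i> * y j) (\<lambda>k. cnj (\<alpha> k)) x) \<le> 2"
      using le1(1)[of x] c[of "of_real x"] by (metis complex_cnj_complex_of_real complex_mod_cnj order_trans one_le_numeral)
  qed simp
  then show "cmod (pfrac 1 N (\<lambda>j. \<i> * y j) \<alpha> (cnj z)) \<le> 2"
    using c[of z] by (metis complex_mod_cnj)
qed

text \<open>For \<open>\<zeta>\<close> outside the circle, Cauchy's formula recovers
  \<open>pfrac - e\<close> from values on the circle, while an entire \<open>p\<close> integrates to
  0 against \<open>1 / (z - \<zeta>)\<close>. It is thus enough to bound the partial fraction modulo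
  an entire function, however large that function may be.\<close>

lemma pfrac_cauchy_bound:
  assumes a: "\<And>k. k < N \<Longrightarrow> cmod (a k - c) < \<rho>" and \<rho>: "0 < \<rho>"
    and p: "p holomorphic_on UNIV" and H: "\<And>z. cmod (z - c) = \<rho> \<Longrightarrow> cmod (pfrac e N a \<alpha> z - p z) \<le> H"
    and \<delta>: "0 < \<delta>" "\<rho> + \<delta> \<le> cmod (\<zeta> - c)"
  shows "cmod (pfrac e N a \<alpha> \<zeta> - e) \<le> H * \<rho> / \<delta>"
proof -
  have far: "\<delta> \<le> cmod (z - \<zeta>)" if "cmod (z - c) \<le> \<rho>" for z
    using norm_triangle_ineq2[of "\<zeta> - c" "z - c"] that \<delta> by (simp add: norm_minus_commute)
  then have ne: "z \<noteq> \<zeta>" if "z \<in> cball c \<rho>" for z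
    using that \<delta> by (force simp: dist_norm norm_minus_commute)
  have zero: "((\<lambda>z. f z / (z - \<zeta>)) has_contour_integral 0) (circlepath c \<rho>)" if "f holomorphic_on UNIV" for f
  proof (rule Cauchy_theorem_convex_simple[of _ "cball c \<rho>"])
    show "(\<lambda>z. f z / (z - \<zeta>)) holomorphic_on cball c \<rho>"
      using ne by (intro holomorphic_intros holomorphic_on_subset[OF that]) auto
  qed (use \<rho> in auto)
  have "((\<lambda>z. \<alpha> k * ((1 / (z - \<zeta>)) / (z - a k))) has_contour_integral \<alpha> k * (2 * pi * \<i> * (1 / (a k - \<zeta>)))) (circlepath c \<rho>)"
    if "k < N" for k
  proof (rule has_contour_integral_lmul)
    have "(\<lambda>z. 1 / (z - \<zeta>)) holomorphic_on cball c \<rho>" using ne by (intro holomorphic_intros) auto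
    from Cauchy_integral_circlepath_simple[OF this a[OF that]]
    show "((\<lambda>z. (1 / (z - \<zeta>)) / (z - a k)) has_contour_integral 2 * pi * \<i> * (1 / (a k - \<zeta>))) (circlepath c \<rho>)" by simp
  qed
  then have "((\<lambda>z. \<Sum>k<N. \<alpha> k * ((1 / (z - \<zeta>)) / (z - a k))) has_contour_integral
      (\<Sum>k<N. \<alpha> k * (2 * pi * \<i> * (1 / (a k - \<zeta>))))) (circlepath c \<rho>)"
    by (intro has_contour_integral_sum) auto
  from has_contour_integral_add[OF this has_contour_integral_diff[OF zero[of "\<lambda>_. e"] zero[OF p]]]
  have "((\<lambda>z. (\<Sum>k<N. \<alpha> k * ((1 / (z - \<zeta>)) / (z - a k))) + (e / (z - \<zeta>) - p z / (z - \<zeta>)))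
      has_contour_integral (\<Sum>k<N. \<alpha> k * (2 * pi * \<i> * (1 / (a k - \<zeta>))))) (circlepath c \<rho>)" by simp
  moreover have "(\<Sum>k<N. \<alpha> k * ((1 / (z - \<zeta>)) / (z - a k))) + (e / (z - \<zeta>) - p z / (z - \<zeta>))
      = (pfrac e N a \<alpha> z - p z) / (z - \<zeta>)" for z
  proof -
    have "(\<Sum>k<N. \<alpha> k * ((1 / (z - \<zeta>)) / (z - a k))) = (\<Sum>k<N. \<alpha> k / (z - a k)) / (z - \<zeta>)"
      unfolding sum_divide_distrib by (intro sum.cong) (simp_all add: mult.commute)
    then show ?thesis by (simp add: pfrac_def add_divide_distrib diff_divide_distrib)
  qed
  ultimately have I: "((\<lambda>z. (pfrac e N a \<alpha> z - p z) / (z - \<zeta>))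
      has_contour_integral (\<Sum>k<N. \<alpha> k * (2 * pi * \<i> * (1 / (a k - \<zeta>))))) (circlepath c \<rho>)" by simp
  have H0: "0 \<le> H" using H[of "c + \<rho>"] \<rho> by (simp add: order_trans[OF norm_ge_zero])
  have "cmod (\<Sum>k<N. \<alpha> k * (2 * pi * \<i> * (1 / (a k - \<zeta>)))) \<le> (H / \<delta>) * (2 * pi * \<rho>)"
  proof (rule has_contour_integral_bound_circlepath[OF I])
    fix z assume "cmod (z - c) = \<rho>"
    then show "cmod ((pfrac e N a \<alpha> z - p z) / (z - \<zeta>)) \<le> H / \<delta>"
      using H[of z] far[of z] \<delta> H0 unfolding norm_divide by (intro frac_le) auto
  qed (use H0 \<delta> \<rho> in auto)
  also have "(\<Sum>k<N. \<alpha> k * (2 * pi * \<i> * (1 / (a k - \<zeta>)))) = - (2 * pi * \<i>) * (pfrac e N a \<alpha> \<zeta> - e)"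
  proof -
    have "\<alpha> k * (2 * pi * \<i> * (1 / (a k - \<zeta>))) = - (2 * pi * \<i>) * (\<alpha> k / (\<zeta> - a k))" for k
      by (metis (no_types, lifting) minus_diff_eq minus_divide_right mult.commute mult_minus_left mult_minus_right times_divide_eq_right mult_1 mult.assoc)
    then show ?thesis unfolding pfrac_def by (simp add: sum_distrib_left)
  qed
  also have "cmod (- (2 * pi * \<i>) * (pfrac e N a \<alpha> \<zeta> - e)) = 2 * pi * cmod (pfrac e N a \<alpha> \<zeta> - e)"
    by (simp only: norm_mult norm_minus_cancel) simp
  finally have "2 * pi * cmod (pfrac e N a \<alpha> \<zeta> - e) \<le> 2 * pi * (H * \<rho> / \<delta>)"
    by (simp add: mult_ac)
  then show ?thesis by (rule mult_left_le_imp_le) simp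
qed

section \<open>The interpolating function \<open>g\<close> and bounds uniform in the number of
  poles\<close>

text \<open>One function interpolates all residue coefficients. Each zero of the product is the
  reflection of a pole; this gives the symmetry of \<open>g\<close> and lets \<open>g\<close> absorb
  the poles of \<open>w\<close>.\<close>

definition gfun :: "(complex \<Rightarrow> complex) \<Rightarrow> nat \<Rightarrow> (nat \<Rightarrow> real) \<Rightarrow> complex \<Rightarrow> complex" where
  "gfun \<phi> N y z = exp (2 * \<i> * \<phi> z) * (\<Prod>j<N. (z + \<i> * y j) / (z - \<i> * y j))"

definition gres :: "(complex \<Rightarrow> complex) \<Rightarrow> nat \<Rightarrow> (nat \<Rightarrow> real) \<Rightarrow> nat \<Rightarrow> complex" where
  "gres \<phi> N y k = exp (2 * \<i> * \<phi> (\<i> * y k)) * (\<Prod>j<N. \<i> * y k + \<i> * y j)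
     / (\<Prod>j\<in>{..<N} - {k}. \<i> * y k - \<i> * y j)"

lemma gfun_holomorphic:
  assumes "\<phi> holomorphic_on UNIV"
  shows "gfun \<phi> N y holomorphic_on - ((\<lambda>j. \<i> * complex_of_real (y j)) ` {..<N})"
  unfolding gfun_def[abs_def]
  by (intro holomorphic_intros holomorphic_on_subset[OF assms]) auto

lemma gfun_residue:
  assumes \<phi>: "\<phi> holomorphic_on UNIV" and inj: "inj_on y {..<N}" and k: "k < N"
  shows "((\<lambda>z. (z - \<i> * y k) * gfun \<phi> N y z) \<longlongrightarrow> gres \<phi> N y k) (at (\<i> * y k))"
proof -
  define G where "G = (\<lambda>z. exp (2 * \<i> * \<phi> z) * ((\<Prod>j<N. z + \<i> * y j) / (\<Prod>j\<in>{..<N} - {k}. z - \<i> * y j)))"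
  have \<phi>c: "(\<phi> \<longlongrightarrow> \<phi> z) (at z)" for z
    using holomorphic_on_imp_continuous_on[OF \<phi>] by (simp add: continuous_on_def)
  have "(G \<longlongrightarrow> G (\<i> * y k)) (at (\<i> * y k))"
    unfolding G_def by (intro tendsto_intros \<phi>c) (use inj k in \<open>auto dest: inj_onD\<close>)
  then have "(G \<longlongrightarrow> gres \<phi> N y k) (at (\<i> * y k))"
    by (simp add: G_def gres_def)
  moreover have "\<forall>\<^sub>F z in at (\<i> * y k). G z = (z - \<i> * y k) * gfun \<phi> N y z"
  proof -
    have "G z = (z - \<i> * y k) * gfun \<phi> N y z" if "z \<noteq> \<i> * y k" for z
    proof -
      have "(\<Prod>j<N. z - \<i> * y j) = (z - \<i> * y k) * (\<Prod>j\<in>{..<N} - {k}. z - \<i> * y j)"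
        using k by (intro prod.remove) auto
      then show ?thesis using that by (simp add: G_def gfun_def prod_dividef)
    qed
    then show ?thesis by (auto simp: eventually_at intro!: exI[of _ 1])
  qed
  ultimately show ?thesis by (rule Lim_transform_eventually)
qed

text \<open>No point has to be excluded: at the zeros and poles of the product both sides are 0,
  because division by zero returns 0.\<close>

lemma gfun_cnj:
  assumes "\<And>z. cnj (\<phi> (cnj z)) = \<phi> z"
  shows "cnj (gfun \<phi> N y (cnj z)) = 1 / gfun \<phi> N y z"
proof -
  have 1: "cnj (exp (2 * \<i> * \<phi> (cnj z))) = 1 / exp (2 * \<i> * \<phi> z)"
    by (simp add: exp_cnj assms exp_minus inverse_eq_divide)
  have 2: "cnj (\<Prod>j<N. (cnj z + \<i> * y j) / (cnj z - \<i> * y j)) = 1 / (\<Prod>j<N. (z + \<i> * y j) / (z - \<i> * y j))"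
    by (simp add: prod_dividef)
  show ?thesis unfolding gfun_def complex_cnj_mult 1 2 by simp
qed

text \<open>Poles are traded for a jump. At \<open>a k\<close> the simple poles of \<open>u\<close>
  and \<open>g w\<close> cancel by the residue condition; at \<open>b k\<close> the zero of
  \<open>g\<close> absorbs the pole of \<open>w\<close>. For \<open>w - u / g\<close> the two kinds
  of points exchange their roles.\<close>

lemma pole_system_interior:
  assumes \<phi>: "\<phi> holomorphic_on UNIV" and \<phi>c: "\<And>z. cnj (\<phi> (cnj z)) = \<phi> z"
    and inj: "inj_on y {..<N}" and pos: "\<And>k. k < N \<Longrightarrow> 0 < y k"
    and sys: "pole_system 1 N y (gres \<phi> N y) \<alpha> \<gamma>"
  defines "u \<equiv> pfrac 1 N (\<lambda>j. \<i> * y j) \<alpha>" and "w \<equiv> pfrac 0 N (\<lambda>j. - \<i> * y j) \<gamma>"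
    and "S \<equiv> (\<lambda>j. \<i> * complex_of_real (y j)) ` {..<N} \<union> (\<lambda>j. - \<i> * complex_of_real (y j)) ` {..<N}"
  obtains p q where "p holomorphic_on UNIV" "q holomorphic_on UNIV"
    "\<And>z. z \<notin> S \<Longrightarrow> p z = u z + gfun \<phi> N y z * w z"
    "\<And>z. z \<notin> S \<Longrightarrow> q z = w z - u z / gfun \<phi> N y z"
proof -
  define a b where "a = (\<lambda>j. \<i> * complex_of_real (y j))" and "b = (\<lambda>j. - \<i> * complex_of_real (y j))"
  let ?g = "gfun \<phi> N y"
  have S: "S = a ` {..<N} \<union> b ` {..<N}" by (simp add: S_def a_def b_def)
  have cab: "cnj (a k) = b k" "cnj (b k) = a k" for k by (simp_all add: a_def b_def)
  have ia: "inj_on a {..<N}" and ib: "inj_on b {..<N}"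
    using inj by (auto simp: inj_on_def a_def b_def)
  have Im: "0 < Im (a k)" "Im (b k) < 0" if "k < N" for k
    using pos that by (simp_all add: a_def b_def)
  have ab: "a k \<notin> b ` {..<N}" "b k \<notin> a ` {..<N}" if "k < N" for k
    using Im(1)[OF that] Im(2)[OF that] Im by fastforce+
  have u: "u = pfrac 1 N a \<alpha>" and w: "w = pfrac 0 N b \<gamma>" by (simp_all add: u_def w_def a_def b_def)
  have \<alpha>: "\<alpha> k = - gres \<phi> N y k * w (a k)" and \<gamma>: "\<gamma> k = cnj (gres \<phi> N y k) * u (b k)" if "k < N" for k
    using sys that by (auto simp: pole_system_def u_def w_def a_def b_def)
  have gh: "?g holomorphic_on - (a ` {..<N})" using gfun_holomorphic[OF \<phi>] by (simp add: a_def)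
  have gt: "(?g \<longlongrightarrow> ?g z) (at z)" if "z \<notin> a ` {..<N}" for z
    using holomorphic_on_imp_continuous_on[OF gh] that
    by (metis ComplI at_within_open continuous_on_def finite_imageI finite_imp_closed finite_lessThan open_Compl)
  have gi: "1 / ?g z = cnj (?g (cnj z))" for z using gfun_cnj[of \<phi>, OF \<phi>c] by simp
  have gi_h: "(\<lambda>z. 1 / ?g z) holomorphic_on - (b ` {..<N})"
  proof -
    have "cnj z \<in> b ` {..<N} \<longleftrightarrow> z \<in> a ` {..<N}" for z
      unfolding image_iff
      by (rule bex_cong) (simp_all add: cab(1)[symmetric])
    moreover have "z \<in> cnj ` X \<longleftrightarrow> cnj z \<in> X" for z X
      by (auto intro: rev_image_eqI[of "cnj z"])
    ultimately have "cnj ` (- (b ` {..<N})) = - (a ` {..<N})"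
      by (intro set_eqI) simp
    moreover have "open (- (b ` {..<N}))" by (simp add: finite_imp_closed open_Compl)
    ultimately show ?thesis
      using holomorphic_on_compose_cnj_cnj[of ?g "- (b ` {..<N})"] gh by (simp add: gi o_def)
  qed
  have git: "((\<lambda>z. 1 / ?g z) \<longlongrightarrow> 1 / ?g z) (at z)" if "z \<notin> b ` {..<N}" for z
    using holomorphic_on_imp_continuous_on[OF gi_h] that
    by (metis (no_types, lifting) ComplI at_within_open continuous_on_def finite_imageI finite_imp_closed finite_lessThan open_Compl)
  have g0: "?g (b k) = 0" if "k < N" for k
    using that by (auto simp: gfun_def b_def intro!: prod_zero)
  \<comment> \<open>The value 0 returned by division by zero is also the analytic value of
    \<open>1 / g\<close> at a pole of \<open>g\<close>.\<close>
  have gi0: "1 / ?g (a k) = 0" if "k < N" for k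
    using that g0[OF that] by (simp add: gi cab)
  have gr: "((\<lambda>z. (z - a k) * ?g z) \<longlongrightarrow> gres \<phi> N y k) (at (a k))" if "k < N" for k
    using gfun_residue[OF \<phi> inj that] by (simp add: a_def)
  have gir: "((\<lambda>z. (z - b k) * (1 / ?g z)) \<longlongrightarrow> cnj (gres \<phi> N y k)) (at (b k))" if "k < N" for k
  proof -
    have "((\<lambda>z. cnj ((cnj z - a k) * ?g (cnj z))) \<longlongrightarrow> cnj (gres \<phi> N y k)) (at (b k))"
      by (rule tendsto_cnj_within) (use gr[OF that] in \<open>simp_all add: cab\<close>)
    then show ?thesis by (simp add: gi cab)
  qed
  define P where "P = (\<lambda>z. u z + ?g z * w z)"
  define Q where "Q = (\<lambda>z. w z - u z * (1 / ?g z))"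
  have hu: "u holomorphic_on - S" and hw: "w holomorphic_on - S"
    unfolding u w S by (intro holomorphic_on_subset[OF pfrac_holomorphic]; auto)+
  have hg: "?g holomorphic_on - S" and hgi: "(\<lambda>z. 1 / ?g z) holomorphic_on - S"
    unfolding S by (intro holomorphic_on_subset[OF gh] holomorphic_on_subset[OF gi_h]; auto)+
  have fin: "finite S" by (simp add: S)
  have ut: "(u \<longlongrightarrow> u z) (at z)" if "z \<notin> a ` {..<N}" for z unfolding u by (rule pfrac_tendsto[OF that])
  have wt: "(w \<longlongrightarrow> w z) (at z)" if "z \<notin> b ` {..<N}" for z unfolding w by (rule pfrac_tendsto[OF that])
  have ur: "((\<lambda>z. (z - a k) * u z) \<longlongrightarrow> \<alpha> k) (at (a k))" if "k < N" for k unfolding u by (rule pfrac_residue[OF ia that])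
  have wr: "((\<lambda>z. (z - b k) * w z) \<longlongrightarrow> \<gamma> k) (at (b k))" if "k < N" for k unfolding w by (rule pfrac_residue[OF ib that])
  have sP: "((\<lambda>z. (z - \<xi>) * P z) \<longlongrightarrow> 0) (at \<xi>)" and sQ: "((\<lambda>z. (z - \<xi>) * Q z) \<longlongrightarrow> 0) (at \<xi>)"
    if "\<xi> \<in> S" for \<xi>
  proof -
    from that consider k where "k < N" "\<xi> = a k" | k where "k < N" "\<xi> = b k" by (auto simp: S)
    then show "((\<lambda>z. (z - \<xi>) * P z) \<longlongrightarrow> 0) (at \<xi>)"
    proof cases
      case 1
      have "((\<lambda>z. (z - \<xi>) * u z + ((z - \<xi>) * ?g z) * w z) \<longlongrightarrow> \<alpha> k + gres \<phi> N y k * w \<xi>) (at \<xi>)"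
        unfolding 1 by (intro tendsto_add tendsto_mult ur gr wt ab 1)
      then show ?thesis using \<alpha>[OF 1(1)] by (simp add: P_def 1 algebra_simps)
    next
      case 2
      have "((\<lambda>z. (z - \<xi>) * u z + ?g z * ((z - \<xi>) * w z)) \<longlongrightarrow> 0 + ?g \<xi> * \<gamma> k) (at \<xi>)"
        unfolding 2 by (intro tendsto_add tendsto_mult tendsto_zero_mult_isCont[OF ut] wr gt ab 2)
      then show ?thesis using g0[OF 2(1)] by (simp add: P_def 2 algebra_simps)
    qed
    from that consider k where "k < N" "\<xi> = a k" | k where "k < N" "\<xi> = b k" by (auto simp: S)
    then show "((\<lambda>z. (z - \<xi>) * Q z) \<longlongrightarrow> 0) (at \<xi>)"
    proof cases
      case 1
      have "((\<lambda>z. (z - \<xi>) * w z - ((z - \<xi>) * u z) * (1 / ?g z)) \<longlongrightarrow> 0 - \<alpha> k * (1 / ?g \<xi>)) (at \<xi>)"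
        unfolding 1 by (intro tendsto_diff tendsto_mult tendsto_zero_mult_isCont[OF wt] ur git ab 1)
      then show ?thesis using gi0[OF 1(1)] unfolding Q_def 1 by (simp add: algebra_simps add_divide_distrib diff_divide_distrib del: divide_eq_0_iff)
    next
      case 2
      have "((\<lambda>z. (z - \<xi>) * w z - u z * ((z - \<xi>) * (1 / ?g z))) \<longlongrightarrow> \<gamma> k - u \<xi> * cnj (gres \<phi> N y k)) (at \<xi>)"
        unfolding 2 by (intro tendsto_diff tendsto_mult wr gir ut ab 2)
      then show ?thesis using \<gamma>[OF 2(1)] by (simp add: Q_def 2 algebra_simps add_divide_distrib diff_divide_distrib)
    qed
  qed
  have "P holomorphic_on - S" unfolding P_def by (intro holomorphic_intros hu hw hg)
  then obtain p where p: "p holomorphic_on UNIV" "\<And>z. z \<notin> S \<Longrightarrow> p z = P z"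
    using removable_finite_singularities[OF fin _ sP] by metis
  have "Q holomorphic_on - S" unfolding Q_def by (intro holomorphic_on_diff holomorphic_on_mult hu hw hgi)
  then obtain q where q: "q holomorphic_on UNIV" "\<And>z. z \<notin> S \<Longrightarrow> q z = Q z"
    using removable_finite_singularities[OF fin _ sQ] by metis
  from p q show ?thesis by (intro that[of p q]) (auto simp: P_def Q_def)
qed

text \<open>Each factor costs \<open>exp (c * y j)\<close>, so only the sum of the
  \<open>y j\<close> enters and the bound does not depend on \<open>N\<close>.\<close>

lemma gfun_bound:
  assumes r: "\<And>j. j < N \<Longrightarrow> cmod ((z + \<i> * y j) / (z - \<i> * y j)) \<le> exp (c * y j)"
    and y: "(\<Sum>j<N. y j) \<le> 3" and L: "cmod (\<phi> z) \<le> L" and c: "0 \<le> c"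
  shows "cmod (gfun \<phi> N y z) \<le> exp (2 * L + 3 * c)"
proof -
  have "cmod (exp (2 * \<i> * \<phi> z)) \<le> exp (cmod (2 * \<i> * \<phi> z))" by (rule norm_exp)
  also have "\<dots> \<le> exp (2 * L)" using L by (simp add: norm_mult)
  finally have 1: "cmod (exp (2 * \<i> * \<phi> z)) \<le> exp (2 * L)" .
  have "cmod (\<Prod>j<N. (z + \<i> * y j) / (z - \<i> * y j)) \<le> (\<Prod>j<N. exp (c * y j))"
    unfolding prod_norm[symmetric] by (intro prod_mono) (use r in auto)
  also have "\<dots> = exp (c * (\<Sum>j<N. y j))" by (simp add: exp_sum sum_distrib_left)
  also have "\<dots> \<le> exp (c * 3)" using y c by (simp add: mult_left_mono)
  finally have "cmod (\<Prod>j<N. (z + \<i> * y j) / (z - \<i> * y j)) \<le> exp (c * 3)" .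
  with 1 have "cmod (gfun \<phi> N y z) \<le> exp (2 * L) * exp (c * 3)"
    unfolding gfun_def norm_mult by (intro mult_mono) auto
  then show ?thesis by (simp add: exp_add mult.commute)
qed

text \<open>The circle is tangent to the real axis at the accumulation point of the poles, so the
  Blaschke factors stay bounded on it although the poles approach it.\<close>

lemma blaschke_factor_tangent_circle:
  fixes y :: real
  assumes z: "cmod (z - \<i> / 8) = 1 / 8" and y: "0 < y" "y \<le> 1 / 16"
  shows "0 \<le> Im z" "cmod ((z + \<i> * y) / (z - \<i> * y)) \<le> exp (16 * y)"
proof -
  define s t where "s = Re z" and "t = Im z"
  have "(cmod (z - \<i> / 8))\<^sup>2 = (1 / 8)\<^sup>2" using z by simp
  then have eq: "s\<^sup>2 + t\<^sup>2 = t / 4"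
    unfolding cmod_power2 by (simp add: s_def t_def power2_eq_square algebra_simps)
  then have t: "0 \<le> t" by (smt (verit) zero_le_power2 divide_neg_pos)
  then show "0 \<le> Im z" by (simp add: t_def)
  have m: "(cmod (z - \<i> * y))\<^sup>2 = t / 4 - 2 * t * y + y\<^sup>2" and p: "(cmod (z + \<i> * y))\<^sup>2 = (cmod (z - \<i> * y))\<^sup>2 + 4 * t * y"
    using eq unfolding cmod_power2 by (simp_all add: s_def t_def power2_eq_square algebra_simps)
  \<comment> \<open>For \<open>y \<le> 1 / 16\<close> the squared denominator keeps at least half of
    \<open>t / 4\<close>, so the excess \<open>4 * t * y\<close> of the squared numerator is at most
    \<open>32 * y\<close> times it. Taking roots halves 32 to 16.\<close>
  have "t * y \<le> t * (1 / 16)" using t y by (intro mult_left_mono) auto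
  then have "t / 8 \<le> (cmod (z - \<i> * y))\<^sup>2" unfolding m using zero_le_power2[of y] by linarith
  then have "(32 * y) * (t / 8) \<le> (32 * y) * (cmod (z - \<i> * y))\<^sup>2" using y by (intro mult_left_mono) auto
  then have "(cmod (z + \<i> * y))\<^sup>2 \<le> (1 + 32 * y) * (cmod (z - \<i> * y))\<^sup>2"
    unfolding p by (simp add: algebra_simps)
  also have "\<dots> \<le> exp (32 * y) * (cmod (z - \<i> * y))\<^sup>2"
    by (intro mult_right_mono exp_ge_add_one_self) auto
  also have "\<dots> = (exp (16 * y) * cmod (z - \<i> * y))\<^sup>2"
    by (simp add: power_mult_distrib flip: exp_double)
  finally have "cmod (z + \<i> * y) \<le> exp (16 * y) * cmod (z - \<i> * y)"
    by (rule power2_le_imp_le) simp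
  then show "cmod ((z + \<i> * y) / (z - \<i> * y)) \<le> exp (16 * y)"
    by (cases "z = \<i> * y") (auto simp: norm_divide divide_le_eq)
qed

lemma blaschke_factor_away:
  fixes y :: real
  assumes z: "1 / 2 \<le> cmod z" and y: "0 < y" "y \<le> 1 / 16"
  shows "cmod ((z + \<i> * y) / (z - \<i> * y)) \<le> exp (5 * y)"
proof -
  have m: "7 / 16 \<le> cmod (z - \<i> * y)"
    using norm_triangle_ineq2[of z "\<i> * y"] z y by (simp add: norm_mult)
  have "z + \<i> * y = (z - \<i> * y) + 2 * \<i> * y" by simp
  then have "cmod (z + \<i> * y) \<le> cmod (z - \<i> * y) + cmod (2 * \<i> * y)" by (metis norm_triangle_ineq)
  also have "cmod (2 * \<i> * y) = 2 * y" using y by (simp add: norm_mult)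
  \<comment> \<open>The constant 5 suffices because \<open>5 * 7 / 16 > 2\<close>.\<close>
  also have "2 * y \<le> 5 * y * cmod (z - \<i> * y)" using mult_left_mono[OF m, of "5 * y"] y by simp
  finally have "cmod (z + \<i> * y) \<le> (1 + 5 * y) * cmod (z - \<i> * y)" by (simp add: algebra_simps)
  also have "\<dots> \<le> exp (5 * y) * cmod (z - \<i> * y)"
    by (intro mult_right_mono exp_ge_add_one_self) auto
  finally show ?thesis using m by (auto simp: norm_divide divide_le_eq)
qed

text \<open>Uniform bound for all four functions of a discrete row. \<open>48 = 3 * 16\<close> comes
  from \<open>g\<close> on the tangent circle and \<open>15 = 3 * 5\<close> from \<open>g\<close> on
  \<open>|z| = 2\<close>, where 3 bounds the sum of the \<open>y k\<close>.\<close>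

definition rowb :: "real \<Rightarrow> real" where
  "rowb L = (1 + exp (2 * L + 48)) * (1 + exp (2 * L + 15))"

lemma gfun_annulus_bound:
  assumes \<phi>c: "\<And>z. cnj (\<phi> (cnj z)) = \<phi> z" and L: "\<And>z. cmod z \<le> 2 \<Longrightarrow> cmod (\<phi> z) \<le> L"
    and pos: "\<And>k. k < N \<Longrightarrow> 0 < y k" "\<And>k. k < N \<Longrightarrow> y k \<le> 1 / 16" and sum: "(\<Sum>k<N. y k) \<le> 3"
    and z: "1 / 2 \<le> cmod z" "cmod z \<le> 2"
  shows "cmod (gfun \<phi> N y z) \<le> exp (2 * L + 15)" "cmod (1 / gfun \<phi> N y z) \<le> exp (2 * L + 15)"
proof -
  have g: "cmod (gfun \<phi> N y z) \<le> exp (2 * L + 3 * 5)" if "1 / 2 \<le> cmod z" "cmod z \<le> 2" for z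
    by (intro gfun_bound blaschke_factor_away) (use pos sum L that in auto)
  show "cmod (gfun \<phi> N y z) \<le> exp (2 * L + 15)" using g[OF z] by simp
  have "cmod (gfun \<phi> N y (cnj z)) \<le> exp (2 * L + 3 * 5)" using g[of "cnj z"] z by simp
  moreover have "cmod (1 / gfun \<phi> N y z) = cmod (gfun \<phi> N y (cnj z))"
    using gfun_cnj[of \<phi>, OF \<phi>c] by (metis complex_mod_cnj)
  ultimately show "cmod (1 / gfun \<phi> N y z) \<le> exp (2 * L + 15)" by simp
qed

text \<open>A partial fraction in the coordinate \<open>w = 1 / z\<close>, written so that the point
  \<open>w = 0\<close> needs no separate treatment.\<close>

definition pinv :: "complex \<Rightarrow> nat \<Rightarrow> (nat \<Rightarrow> complex) \<Rightarrow> (nat \<Rightarrow> complex) \<Rightarrow> complex \<Rightarrow> complex" where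
  "pinv e N a \<alpha> w = e + (\<Sum>k<N. \<alpha> k * w / (1 - a k * w))"

lemma pinv_eq: "w \<noteq> 0 \<Longrightarrow> pinv e N a \<alpha> w = pfrac e N a \<alpha> (1 / w)"
  unfolding pinv_def pfrac_def by (intro arg_cong2[of _ _ _ _ "(+)"] sum.cong refl) (simp add: divide_simps)

lemma pinv_holomorphic:
  assumes "\<And>k. k < N \<Longrightarrow> cmod (a k) < 1 / 2"
  shows "pinv e N a \<alpha> holomorphic_on ball 0 2"
  unfolding pinv_def[abs_def]
proof (intro holomorphic_intros)
  fix k w assume "k \<in> {..<N}" "w \<in> ball (0::complex) 2"
  then have "cmod (a k * w) < (1 / 2) * 2" using assms[of k]
    unfolding norm_mult by (intro mult_strict_mono') auto
  then show "1 - a k * w \<noteq> 0" by auto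
qed

lemma pinv_deriv: "deriv (pinv e N a \<alpha>) 0 = (\<Sum>k<N. \<alpha> k)"
proof -
  have "((\<lambda>w. \<alpha> k * w / (1 - a k * w)) has_field_derivative \<alpha> k) (at 0)" for k
    by (auto intro!: derivative_eq_intros)
  then have "(pinv e N a \<alpha> has_field_derivative 0 + (\<Sum>k<N. \<alpha> k)) (at 0)"
    unfolding pinv_def[abs_def] by (intro DERIV_add DERIV_sum) auto
  then show ?thesis by (simp add: DERIV_imp_deriv)
qed

text \<open>On the tangent circle the half-plane bounds control \<open>w\<close> and the reflected
  \<open>u\<close>, and \<open>g\<close> is bounded there as well. As \<open>u + g w\<close> is
  entire, \<open>u\<close> differs from an entire function by a bounded term on that circle, and the
  exterior Cauchy estimate controls \<open>u\<close> away from the poles. The radius 2 leaves room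
  around the unit circle for passing to limits.\<close>

lemma discrete_row_sol:
  assumes \<phi>: "\<phi> holomorphic_on UNIV" and \<phi>c: "\<And>z. cnj (\<phi> (cnj z)) = \<phi> z"
    and L: "\<And>z. cmod z \<le> 2 \<Longrightarrow> cmod (\<phi> z) \<le> L"
    and inj: "inj_on y {..<N}" and pos: "\<And>k. k < N \<Longrightarrow> 0 < y k" "\<And>k. k < N \<Longrightarrow> y k \<le> 1 / 16"
    and sum: "(\<Sum>k<N. y k) \<le> 3"
    and sys: "pole_system 1 N y (gres \<phi> N y) \<alpha> \<gamma>"
  obtains U W p q where "row_sol (gfun \<phi> N y) U W p q" "deriv W 0 = (\<Sum>k<N. \<gamma> k)"
    "\<And>f. f \<in> {U, W, p, q} \<Longrightarrow> f holomorphic_on ball 0 2"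
    "\<And>f z. f \<in> {U, W, p, q} \<Longrightarrow> cmod z < 2 \<Longrightarrow> cmod (f z) \<le> rowb L"
proof -
  define a b where "a = (\<lambda>j. \<i> * complex_of_real (y j))" and "b = (\<lambda>j. - \<i> * complex_of_real (y j))"
  define u w where "u = pfrac 1 N a \<alpha>" and "w = pfrac 0 N b \<gamma>"
  define S where "S = a ` {..<N} \<union> b ` {..<N}"
  define g where "g = gfun \<phi> N y"
  define G where "G = exp (2 * L + 48)"
  define G' where "G' = exp (2 * L + 15)"
  have cab: "cnj (a k) = b k" "cnj (b k) = a k" for k by (simp_all add: a_def b_def)
  have na: "cmod (a k) \<le> 1 / 16" "cmod (b k) \<le> 1 / 16" if "k < N" for k
    using pos[OF that] by (simp_all add: a_def b_def norm_mult)
  obtain p q where p: "p holomorphic_on UNIV" "\<And>z. z \<notin> S \<Longrightarrow> p z = u z + g z * w z"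
    and q: "q holomorphic_on UNIV" "\<And>z. z \<notin> S \<Longrightarrow> q z = w z - u z / g z"
    using pole_system_interior[OF \<phi> _ inj pos(1) sys, OF \<phi>c]
    unfolding u_def w_def S_def a_def b_def g_def by metis
  have S16: "z \<notin> S" if "1 / 2 \<le> cmod z" for z using that na by (force simp: S_def)
  have gc: "cnj (g (cnj z)) = 1 / g z" for z using gfun_cnj[of \<phi>, OF \<phi>c] by (simp add: g_def)
  have tang: "0 \<le> Im z" "cmod (g z) \<le> G" if "cmod (z - \<i> / 8) = 1 / 8" for z
  proof -
    show im: "0 \<le> Im z" using blaschke_factor_tangent_circle(1)[OF that, of "1 / 16"] by simp
    have "cmod z \<le> 1 / 4" using norm_triangle_ineq[of "z - \<i> / 8" "\<i> / 8"] that by (simp add: norm_divide)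
    then have "cmod (g z) \<le> exp (2 * L + 3 * 16)"
      unfolding g_def by (intro gfun_bound blaschke_factor_tangent_circle(2)[OF that]) (use pos sum L in auto)
    then show "cmod (g z) \<le> G" by (simp add: G_def)
  qed
  have tangS: "z \<notin> S" if "cmod (z - \<i> / 8) = 1 / 8" for z
  proof
    assume "z \<in> S"
    then consider k where "k < N" "z = a k" | k where "k < N" "z = b k" by (auto simp: S_def)
    then show False
    proof cases
      case 1
      have "z - \<i> / 8 = \<i> * complex_of_real (y k - 1 / 8)" by (simp add: 1 a_def algebra_simps)
      then have "cmod (z - \<i> / 8) = \<bar>y k - 1 / 8\<bar>" by (simp only: norm_mult norm_of_real) simp
      then show False using that pos[OF 1(1)] by simp
    next
      case 2
      then show False using tang(1)[OF that] pos[OF 2(1)] by (simp add: b_def)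
    qed
  qed
  have ain: "cmod (a k - \<i> / 8) < 1 / 8" if "k < N" for k
  proof -
    have "a k - \<i> / 8 = \<i> * complex_of_real (y k - 1 / 8)" by (simp add: a_def algebra_simps)
    then have "cmod (a k - \<i> / 8) = \<bar>y k - 1 / 8\<bar>" by (simp only: norm_mult norm_of_real) simp
    then show ?thesis using pos[OF that] by simp
  qed
  have half: "cmod (w z) \<le> 1" "cmod (u (cnj z)) \<le> 2" if "0 \<le> Im z" for z
    using pole_system_half_plane_bounds[OF inj pos(1) sys that] by (simp_all add: u_def w_def a_def b_def)
  have G0: "0 < G" "0 < G'" by (simp_all add: G_def G'_def)
  \<comment> \<open>A margin of \<open>1 / 4\<close> beyond the radius \<open>1 / 8\<close>, so
    \<open>pfrac_cauchy_bound\<close> contributes the factor one half.\<close>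
  have dist: "1 / 8 + 1 / 4 \<le> cmod (z - \<i> / 8)" if "1 / 2 \<le> cmod z" for z
    using norm_triangle_ineq2[of z "\<i> / 8"] that by (simp add: norm_divide)
  have ub: "cmod (u z) \<le> 1 + G" if z: "1 / 2 \<le> cmod z" for z
  proof -
    have "cmod (u z - 1) \<le> G * (1 / 8) / (1 / 4)"
      unfolding u_def
    proof (rule pfrac_cauchy_bound[OF ain _ p(1) _ _ dist[OF z]])
      fix x assume x: "cmod (x - \<i> / 8) = 1 / 8"
      have "pfrac 1 N a \<alpha> x - p x = - (g x * w x)" using p(2)[OF tangS[OF x]] by (simp add: u_def)
      moreover have "cmod (g x) * cmod (w x) \<le> G * 1"
        using tang[OF x] half(1)[of x] G0 by (intro mult_mono) auto
      ultimately show "cmod (pfrac 1 N a \<alpha> x - p x) \<le> G" by (simp add: norm_mult)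
    qed auto
    then show ?thesis using norm_triangle_ineq[of "u z - 1" 1] G0 by simp
  qed
  \<comment> \<open>The poles of \<open>w\<close> lie below the real axis, so the estimate is made
    for its reflection \<open>ws\<close>, whose poles are the \<open>a k\<close>; the reflected
    \<open>q\<close> is the entire function to be subtracted.\<close>
  have wb: "cmod (w z) \<le> G" if z: "1 / 2 \<le> cmod z" for z
  proof -
    define ws where "ws = pfrac 0 N a (\<lambda>k. cnj (\<gamma> k))"
    have ws: "cnj (w (cnj x)) = ws x" for x by (simp add: w_def ws_def pfrac_cnj cab)
    have qh: "(\<lambda>x. cnj (q (cnj x))) holomorphic_on UNIV" using q(1) by (intro cnj_holomorphic_on) auto
    have z': "1 / 2 \<le> cmod (cnj z)" using z by simp
    have "cmod (ws (cnj z) - 0) \<le> (2 * G) * (1 / 8) / (1 / 4)"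
      unfolding ws_def
    proof (rule pfrac_cauchy_bound[OF ain _ qh _ _ dist[OF z']])
      fix x assume x: "cmod (x - \<i> / 8) = 1 / 8"
      have "cnj x \<notin> S"
      proof
        assume "cnj x \<in> S"
        then obtain k where k: "k < N" "cnj x = a k \<or> cnj x = b k" by (auto simp: S_def)
        then have "x = b k \<or> x = a k" using cab by (metis complex_cnj_cnj)
        then show False using tangS[OF x] k(1) by (auto simp: S_def)
      qed
      then have "cnj (q (cnj x)) = ws x - cnj (u (cnj x)) / cnj (g (cnj x))"
        by (simp add: q(2) ws)
      then have "ws x - cnj (q (cnj x)) = cnj (u (cnj x)) * g x" by (simp add: gc)
      moreover have "cmod (u (cnj x)) * cmod (g x) \<le> 2 * G"
        using tang[OF x] half(2)[of x] G0 by (intro mult_mono) auto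
      ultimately show "cmod (pfrac 0 N a (\<lambda>k. cnj (\<gamma> k)) x - cnj (q (cnj x))) \<le> 2 * G"
        by (simp add: norm_mult ws_def)
    qed auto
    then have "cmod (ws (cnj z)) \<le> G" by simp
    then show ?thesis using ws[of "cnj z"] by (metis complex_cnj_cnj complex_mod_cnj)
  qed
  have rb: "rowb L = (1 + G) * (1 + G')" by (simp add: rowb_def G_def G'_def)
  have rb1: "1 + G \<le> rowb L" unfolding rb using G0 by simp
  have g0: "g z \<noteq> 0" if "1 / 2 \<le> cmod z" for z
  proof -
    have "z - a j \<noteq> 0" "z - b j \<noteq> 0" if "j < N" for j
      using S16[OF \<open>1 / 2 \<le> cmod z\<close>] that by (auto simp: S_def)
    then show ?thesis by (simp add: g_def gfun_def a_def b_def)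
  qed
  have gb: "cmod (g z) \<le> G'" "cmod (1 / g z) \<le> G'" if "cmod z = 2" for z
    unfolding g_def G'_def
    by (rule gfun_annulus_bound[OF _ _ pos sum]; use \<phi>c L that in auto)+
  \<comment> \<open>Both are entire, so their size on \<open>|z| = 2\<close>, well away from the
    poles, controls them near the poles too.\<close>
  have pqb: "cmod (f z) \<le> rowb L" if f: "f \<in> {p, q}" and z: "cmod z < 2" for f z
  proof (rule maximum_modulus_frontier[of f "ball 0 2"])
    have fh: "f holomorphic_on UNIV" using f p q by auto
    then show "f holomorphic_on interior (ball 0 2)" by (rule holomorphic_on_subset) auto
    show "continuous_on (closure (ball 0 2)) f"
      using holomorphic_on_imp_continuous_on[OF fh] by (rule continuous_on_subset) auto
    fix x :: complex assume "x \<in> frontier (ball 0 2)"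
    then have x: "cmod x = 2" by (simp add: frontier_def)
    then have xS: "x \<notin> S" using S16 by simp
    have b: "cmod (u x) \<le> 1 + G" "cmod (w x) \<le> 1 + G" using ub[of x] wb[of x] x by auto
    have "cmod (g x * w x) \<le> G' * (1 + G)" "cmod (u x / g x) \<le> (1 + G) * G'"
      using mult_mono[OF gb(1)[OF x] b(2)] mult_mono[OF b(1) gb(2)[OF x]] G0
      by (simp_all add: norm_mult norm_divide)
    then have "cmod (u x + g x * w x) \<le> (1 + G) + G' * (1 + G)" "cmod (w x - u x / g x) \<le> (1 + G) + (1 + G) * G'"
      using b norm_triangle_ineq[of "u x" "g x * w x"] norm_triangle_ineq4[of "w x" "u x / g x"] by linarith+
    moreover have "(1 + G) + G' * (1 + G) = rowb L" "(1 + G) + (1 + G) * G' = rowb L"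
      unfolding rb by (simp_all add: algebra_simps)
    ultimately have "cmod (p x) \<le> rowb L" "cmod (q x) \<le> rowb L"
      unfolding p(2)[OF xS] q(2)[OF xS] by simp_all
    then show "cmod (f x) \<le> rowb L" using f by auto
  qed (use z in auto)
  define U W where "U = pinv 1 N a \<alpha>" and "W = pinv 0 N b \<gamma>"
  have Uu: "U x = u (1 / x)" "W x = w (1 / x)" if "x \<noteq> 0" for x
    using that by (simp_all add: U_def W_def u_def w_def pinv_eq)
  have UW0: "U 0 = 1" "W 0 = 0" by (simp_all add: U_def W_def pinv_def)
  have hUW: "U holomorphic_on ball 0 2" "W holomorphic_on ball 0 2"
    unfolding U_def W_def using na by (intro pinv_holomorphic; force)+
  have UWb: "cmod (U x) \<le> rowb L" "cmod (W x) \<le> rowb L" if "cmod x < 2" for x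
  proof -
    have 1: "1 / 2 \<le> cmod (1 / x)" if "x \<noteq> 0" using that \<open>cmod x < 2\<close> by (simp add: norm_divide divide_simps)
    show "cmod (U x) \<le> rowb L"
      using ub[OF 1] rb1 G0 by (cases "x = 0") (simp_all add: UW0 Uu)
    show "cmod (W x) \<le> rowb L"
      using wb[OF 1] rb1 G0 by (cases "x = 0") (simp_all add: UW0 Uu)
  qed
  have hol: "f holomorphic_on ball 0 2" if "f \<in> {U, W, p, q}" for f
    using that hUW p(1) q(1) by (auto intro: holomorphic_on_subset)
  have "row_sol g U W p q"
    unfolding row_sol_def
  proof (intro conjI ballI allI impI UW0)
    fix f assume f: "f \<in> {U, W, p, q}"
    show "f holomorphic_on ball 0 1" using hol[OF f] by (rule holomorphic_on_subset) auto
    show "continuous_on (cball 0 1) f" using holomorphic_on_imp_continuous_on[OF hol[OF f]] by (rule continuous_on_subset) auto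
  next
    fix z :: complex assume z: "cmod z = 1"
    then have z': "1 / 2 \<le> cmod z" "z \<noteq> 0" by auto
    show "g z \<noteq> 0" by (rule g0[OF z'(1)])
    show "p z = U (1 / z) + g z * W (1 / z)" "q z = W (1 / z) - U (1 / z) / g z"
      using p(2) q(2) S16[OF z'(1)] z'(2) by (simp_all add: Uu)
  qed
  then show ?thesis unfolding g_def
  proof (rule that)
    show "deriv W 0 = (\<Sum>k<N. \<gamma> k)" by (simp add: W_def pinv_deriv)
    fix f assume "f \<in> {U, W, p, q}"
    then show "f holomorphic_on ball 0 2" by (rule hol)
    fix z :: complex assume "cmod z < 2"
    then show "cmod (f z) \<le> rowb L" using UWb pqb \<open>f \<in> {U, W, p, q}\<close> by auto
  qed
qed

section \<open>Many small poles: convergence of \<open>g\<close> and of the rows\<close>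

lemma norm_exp_minus_one_le: "cmod (exp z - 1) \<le> cmod z * exp (cmod z)"
proof -
  have "cmod (exp z - 1) \<le> exp \<bar>Re z\<bar> * cmod z" using Taylor_exp[of z 0] by simp
  also have "\<dots> \<le> exp (cmod z) * cmod z" by (intro mult_right_mono) (auto simp: abs_Re_le_cmod)
  finally show ?thesis by (simp add: mult.commute)
qed

text \<open>To be used with \<open>x = \<i> y / z\<close>. A quadratic error is enough, because the
  sum of the \<open>(y k)^2\<close> will be bounded to the same order as the error of the sum of the
  \<open>y k\<close>. The constant is \<open>48 = 3 * (12 + 4)\<close>: 12 from the exponential, 4
  from the fraction, and 3 bounding \<open>exp (- 2 * x)\<close>.\<close>

lemma blaschke_factor_expansion:
  assumes x: "cmod x \<le> 1 / 16"
  shows "cmod ((1 + x) / (1 - x) * exp (- 2 * x) - 1) \<le> 48 * (cmod x)\<^sup>2"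
proof -
  have e3: "exp (1 / 8 :: real) \<le> 3" using exp_le order_trans[of "exp (1 / 8 :: real)" "exp 1" 3] by simp
  have d: "15 / 16 \<le> cmod (1 - x)" using norm_triangle_ineq2[of 1 x] x by simp
  then have x1: "1 - x \<noteq> 0" by auto
  have ex: "cmod (2 * x) \<le> 1 / 8" using x by (simp add: norm_mult)
  have "cmod (exp (2 * x) - (\<Sum>k\<le>1. (2 * x) ^ k / fact k)) \<le> exp \<bar>Re (2 * x)\<bar> * cmod (2 * x) ^ Suc 1 / fact 1"
    by (rule Taylor_exp)
  then have "cmod (exp (2 * x) - (1 + 2 * x)) \<le> exp \<bar>Re (2 * x)\<bar> * (cmod (2 * x))\<^sup>2"
    by (simp add: power2_eq_square)
  also have "\<dots> \<le> 3 * (4 * (cmod x)\<^sup>2)"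
  proof (intro mult_mono)
    have "exp \<bar>Re (2 * x)\<bar> \<le> exp (1 / 8)" using abs_Re_le_cmod[of "2 * x"] ex by simp
    then show "exp \<bar>Re (2 * x)\<bar> \<le> 3" using e3 by (rule order_trans)
  qed (auto simp: norm_mult power_mult_distrib)
  finally have 1: "cmod (exp (2 * x) - (1 + 2 * x)) \<le> 12 * (cmod x)\<^sup>2" by simp
  have "(1 + x) / (1 - x) - (1 + 2 * x) = 2 * x\<^sup>2 / (1 - x)"
    using x1 by (simp add: field_simps power2_eq_square)
  then have "cmod ((1 + x) / (1 - x) - (1 + 2 * x)) = 2 * (cmod x)\<^sup>2 / cmod (1 - x)"
    by (simp add: norm_divide norm_mult norm_power)
  also have "\<dots> \<le> 2 * (cmod x)\<^sup>2 / (15 / 16)" using d by (intro divide_left_mono) auto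
  also have "\<dots> \<le> 4 * (cmod x)\<^sup>2" by simp
  finally have "cmod ((1 + x) / (1 - x) - exp (2 * x)) \<le> 16 * (cmod x)\<^sup>2"
    using 1 norm_triangle_ineq4[of "(1 + x) / (1 - x) - (1 + 2 * x)" "exp (2 * x) - (1 + 2 * x)"] by simp
  moreover have "(1 + x) / (1 - x) * exp (- 2 * x) - 1 = exp (- 2 * x) * ((1 + x) / (1 - x) - exp (2 * x))"
    by (simp add: right_diff_distrib mult.commute flip: exp_add)
  moreover have "cmod (exp (- 2 * x)) \<le> 3"
  proof -
    have "exp (cmod (- 2 * x)) \<le> exp (1 / 8)" using ex by (simp add: norm_mult)
    then show ?thesis using e3 norm_exp[of "- 2 * x"] by linarith
  qed
  ultimately have "cmod ((1 + x) / (1 - x) * exp (- 2 * x) - 1) \<le> 3 * (16 * (cmod x)\<^sup>2)"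
    unfolding norm_mult by (simp only: norm_mult) (intro mult_mono, auto)
  then show ?thesis by simp
qed

text \<open>Writing each factor as \<open>exp (2 * x k)\<close> times a correction separates two
  errors: the exponentials multiply to \<open>exp (2 * \<i> * s / z)\<close>, which is off by
  \<open>s - 2\<close>, and the corrections multiply to 1 up to the sum of squares.
  \<open>48 * exp 16\<close> dominates both resulting constants.\<close>

lemma gfun_limit_bound:
  fixes y :: "nat \<Rightarrow> real"
  assumes z: "cmod z = 1" and L: "cmod (\<phi> z) \<le> L"
    and y: "\<And>k. k < N \<Longrightarrow> 0 < y k" "\<And>k. k < N \<Longrightarrow> y k \<le> 1 / 16" and sum: "\<bar>(\<Sum>k<N. y k) - 2\<bar> \<le> 1"
  shows "cmod (gfun \<phi> N y z - exp (2 * \<i> * \<phi> z) * exp (4 * \<i> / z))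
     \<le> exp (2 * L) * (48 * exp 16) * (\<bar>(\<Sum>k<N. y k) - 2\<bar> + (\<Sum>k<N. (y k)\<^sup>2))"
proof -
  define s s2 where "s = (\<Sum>k<N. y k)" and "s2 = (\<Sum>k<N. (y k)\<^sup>2)"
  have z0: "z \<noteq> 0" using z by auto
  define x where "x = (\<lambda>k. \<i> * y k / z)"
  have nx: "cmod (x k) = y k" if "k < N" for k using y(1)[OF that] z by (simp add: x_def norm_mult norm_divide)
  define f where "f = (\<lambda>k. (1 + x k) / (1 - x k) * exp (- 2 * x k))"
  have s: "s \<le> 3" "1 \<le> s" using sum by (auto simp: s_def)
  have s2: "0 \<le> s2" "s2 \<le> 3 / 16"
  proof -
    show "0 \<le> s2" by (simp add: s2_def sum_nonneg)
    have "s2 \<le> (\<Sum>k<N. (1 / 16) * y k)" unfolding s2_def power2_eq_square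
      by (intro sum_mono mult_right_mono) (use y in \<open>auto intro: less_imp_le\<close>)
    then show "s2 \<le> 3 / 16" using s by (simp add: s_def flip: sum_divide_distrib)
  qed
  have "cmod ((\<Prod>k<N. 1 + (f k - 1)) - 1) \<le> (\<Prod>k<N. 1 + cmod (f k - 1)) - 1"
    by (rule norm_prod_minus1_le_prod_minus1)
  also have "(\<Prod>k<N. 1 + cmod (f k - 1)) \<le> (\<Prod>k<N. exp (48 * (y k)\<^sup>2))"
  proof (intro prod_mono conjI)
    fix k assume k: "k \<in> {..<N}"
    have "cmod (f k - 1) \<le> 48 * (cmod (x k))\<^sup>2"
      unfolding f_def by (rule blaschke_factor_expansion) (use k nx y in simp)
    then show "1 + cmod (f k - 1) \<le> exp (48 * (y k)\<^sup>2)"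
      using nx k by (intro order_trans[OF _ exp_ge_add_one_self]) simp
  qed simp
  also have "\<dots> = exp (48 * s2)" by (simp add: exp_sum s2_def sum_distrib_left)
  also have "exp (48 * s2) - 1 \<le> 48 * s2 * exp (48 * s2)"
  proof -
    have "1 - 48 * s2 \<le> exp (- (48 * s2))" using exp_ge_add_one_self[of "- (48 * s2)"] by simp
    then have "(1 - 48 * s2) * exp (48 * s2) \<le> exp (- (48 * s2)) * exp (48 * s2)" by (intro mult_right_mono) auto
    also have "\<dots> = 1" by (simp flip: exp_add)
    finally show ?thesis by (simp add: algebra_simps)
  qed
  \<comment> \<open>\<open>9 = 48 * (3 / 16)\<close>, from the bound on \<open>s2\<close>.\<close>
  also have "\<dots> \<le> 48 * s2 * exp 9" using s2 by (intro mult_left_mono) auto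
  finally have pf: "cmod ((\<Prod>k<N. f k) - 1) \<le> 48 * s2 * exp 9" by simp
  have "(\<Prod>k<N. (z + \<i> * y k) / (z - \<i> * y k)) = (\<Prod>k<N. exp (2 * x k) * f k)"
  proof (rule prod.cong)
    fix k assume k: "k \<in> {..<N}"
    have "1 - x k \<noteq> 0"
    proof
      assume "1 - x k = 0"
      then have "x k = 1" by simp
      then show False using nx[of k] y(2)[of k] k by simp
    qed
    then have "(z + \<i> * y k) / (z - \<i> * y k) = (1 + x k) / (1 - x k)"
      using z0 by (simp add: x_def divide_simps)
    also have "\<dots> = exp (2 * x k) * f k"
      by (simp add: f_def mult_ac flip: exp_add)
    finally show "(z + \<i> * y k) / (z - \<i> * y k) = exp (2 * x k) * f k" .
  qed simp
  also have "\<dots> = exp (2 * \<i> * s / z) * (\<Prod>k<N. f k)"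
    by (simp add: prod.distrib exp_sum[symmetric] x_def s_def sum_distrib_left sum_divide_distrib mult_ac)
  finally have P: "(\<Prod>k<N. (z + \<i> * y k) / (z - \<i> * y k)) = exp (2 * \<i> * s / z) * (\<Prod>k<N. f k)" .
  have E1: "cmod (exp (2 * \<i> * s / z)) \<le> exp 6"
  proof -
    have "cmod (2 * \<i> * s / z) \<le> 6" using s z by (simp add: norm_divide norm_mult)
    then show ?thesis by (intro order_trans[OF norm_exp]) simp
  qed
  have E2: "cmod (exp (2 * \<i> * s / z) - exp (4 * \<i> / z)) \<le> 2 * exp 6 * \<bar>s - 2\<bar>"
  proof -
    have "exp (2 * \<i> * s / z) - exp (4 * \<i> / z) = exp (4 * \<i> / z) * (exp (2 * \<i> * (s - 2) / z) - 1)"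
      by (simp add: right_diff_distrib diff_divide_distrib flip: exp_add)
    moreover have "cmod (exp (4 * \<i> / z)) \<le> exp 4"
      using norm_exp[of "4 * \<i> / z"] z by (simp add: norm_divide norm_mult)
    moreover have "cmod (exp (2 * \<i> * (s - 2) / z) - 1) \<le> 2 * \<bar>s - 2\<bar> * exp 2"
    proof -
      have n: "cmod (2 * \<i> * (s - 2) / z) = 2 * \<bar>s - 2\<bar>" using z
        by (simp only: norm_divide norm_mult norm_of_real norm_ii norm_numeral)
      have "2 * \<bar>s - 2\<bar> * exp (2 * \<bar>s - 2\<bar>) \<le> 2 * \<bar>s - 2\<bar> * exp 2"
        using sum by (intro mult_left_mono) (auto simp: s_def)
      then show ?thesis using norm_exp_minus_one_le[of "2 * \<i> * (s - 2) / z"] unfolding n by linarith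
    qed
    ultimately have "cmod (exp (2 * \<i> * s / z) - exp (4 * \<i> / z)) \<le> exp 4 * (2 * \<bar>s - 2\<bar> * exp 2)"
      by (simp only: norm_mult) (intro mult_mono, auto)
    also have "\<dots> = 2 * exp 6 * \<bar>s - 2\<bar>" by (simp add: mult_ac flip: exp_add)
    finally show ?thesis .
  qed
  have "cmod (exp (2 * \<i> * s / z) * ((\<Prod>k<N. f k) - 1)) \<le> exp 6 * (48 * s2 * exp 9)"
    unfolding norm_mult by (intro mult_mono E1 pf) auto
  also have "\<dots> = 48 * exp 15 * s2" by (simp add: mult_ac flip: exp_add)
  finally have "cmod (exp (2 * \<i> * s / z) * (\<Prod>k<N. f k) - exp (4 * \<i> / z)) \<le> 48 * exp 15 * s2 + 2 * exp 6 * \<bar>s - 2\<bar>"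
    using E2 norm_triangle_ineq[of "exp (2 * \<i> * s / z) * ((\<Prod>k<N. f k) - 1)" "exp (2 * \<i> * s / z) - exp (4 * \<i> / z)"]
    by (simp add: algebra_simps)
  also have "\<dots> \<le> 48 * exp 16 * s2 + 48 * exp 16 * \<bar>s - 2\<bar>"
    using s2 by (intro add_mono mult_right_mono mult_mono) auto
  finally have D: "cmod (exp (2 * \<i> * s / z) * (\<Prod>k<N. f k) - exp (4 * \<i> / z)) \<le> (48 * exp 16) * (\<bar>s - 2\<bar> + s2)"
    by (simp add: algebra_simps)
  have e: "cmod (exp (2 * \<i> * \<phi> z)) \<le> exp (2 * L)"
    using L by (intro order_trans[OF norm_exp]) (simp add: norm_mult)
  have "cmod (gfun \<phi> N y z - exp (2 * \<i> * \<phi> z) * exp (4 * \<i> / z))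
     = cmod (exp (2 * \<i> * \<phi> z)) * cmod (exp (2 * \<i> * s / z) * (\<Prod>k<N. f k) - exp (4 * \<i> / z))"
    unfolding gfun_def P by (simp only: norm_mult right_diff_distrib[symmetric])
  also have "\<dots> \<le> exp (2 * L) * ((48 * exp 16) * (\<bar>s - 2\<bar> + s2))"
    by (intro mult_mono e D) auto
  finally show ?thesis by (simp add: s_def s2_def mult.assoc)
qed

lemma montel_bounded_disc:
  assumes hol: "\<And>n. F n holomorphic_on ball 0 r" and bd: "\<And>n z. cmod z < r \<Longrightarrow> cmod (F n z) \<le> B"
  obtains g k where "g holomorphic_on ball 0 r" "strict_mono (k :: nat \<Rightarrow> nat)"
    "\<And>z. cmod z < r \<Longrightarrow> (\<lambda>n. F (k n) z) \<longlonglongrightarrow> g z" "\<And>z. cmod z < r \<Longrightarrow> cmod (g z) \<le> B"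
proof -
  obtain g k where g: "g holomorphic_on ball 0 r" "strict_mono (k :: nat \<Rightarrow> nat)"
    "\<And>z. z \<in> ball 0 r \<Longrightarrow> (\<lambda>n. F (k n) z) \<longlonglongrightarrow> g z"
  proof (rule Montel[of "ball 0 r" "range F" F])
    show "\<exists>B. \<forall>h\<in>range F. \<forall>z\<in>K. cmod (h z) \<le> B" if "K \<subseteq> ball 0 r" for K
      using bd that by (intro exI[of _ B]) auto
  qed (use hol in auto)
  show ?thesis
  proof (rule that[OF g(1,2)])
    fix z assume z: "cmod z < r"
    then show l: "(\<lambda>n. F (k n) z) \<longlonglongrightarrow> g z" using g(3) by simp
    show "cmod (g z) \<le> B"
      by (rule tendsto_upperbound[OF tendsto_norm[OF l]]) (use bd z in auto)
  qed
qed

text \<open>Existence by approximation: any pole sets whose sum is 2 and whose largest element tends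
  to 0 will do, so explicit ones are used and no spectral data enter. The bounds on the disc of
  radius 2 give convergence on the unit circle itself, so the jump relations pass to the
  limit.\<close>

lemma limit_row_sol:
  assumes \<phi>: "\<phi> holomorphic_on UNIV" and \<phi>c: "\<And>z. cnj (\<phi> (cnj z)) = \<phi> z"
    and L: "\<And>z. cmod z \<le> 2 \<Longrightarrow> cmod (\<phi> z) \<le> L"
  obtains U W p q where "row_sol (\<lambda>z. exp (2 * \<i> * \<phi> z) * exp (4 * \<i> / z)) U W p q"
    "\<And>f z. f \<in> {U, W} \<Longrightarrow> cmod z = 1 \<Longrightarrow> cmod (f z) \<le> rowb L"
proof -
  \<comment> \<open>The offset 63 ensures \<open>4 / (N + 1) \<le> 1 / 16\<close>, the size allowed
    in the pole estimates.\<close>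
  define N where "N = (\<lambda>n::nat. n + 63)"
  \<comment> \<open>Distinct points, of sum exactly 2 by the formula for triangular numbers and none
    larger than \<open>4 / (N + 1)\<close>.\<close>
  define y where "y = (\<lambda>n k. 4 * (real k + 1) / (real (N n) * (real (N n) + 1)))"
  have N: "real (N n) \<ge> 63" "0 < N n" for n by (simp_all add: N_def)
  have ypos: "0 < y n k" for n k using N(2)[of n] by (simp add: y_def)
  have yle: "y n k \<le> 4 / (real (N n) + 1)" if "k < N n" for n k
  proof -
    have "y n k \<le> 4 * real (N n) / (real (N n) * (real (N n) + 1))"
      unfolding y_def using that N(2)[of n] by (intro divide_right_mono) auto
    then show ?thesis using N(2)[of n] by simp
  qed
  have y16: "y n k \<le> 1 / 16" if "k < N n" for n k
  proof -
    have "4 / (real (N n) + 1) \<le> 1 / 16" using N(1)[of n] by (simp add: divide_simps)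
    then show ?thesis by (rule order_trans[OF yle[OF that]])
  qed
  have ysum: "(\<Sum>k<N n. y n k) = 2" for n
  proof -
    have "(\<Sum>k<m. real k + 1) = real m * (real m + 1) / 2" for m by (induction m) (auto simp: field_simps)
    note gauss = this
    have "(\<Sum>k<N n. 4 * (real k + 1)) = 2 * (real (N n) * (real (N n) + 1))"
      unfolding sum_distrib_left[symmetric] gauss by simp
    moreover have "real (N n) * (real (N n) + 1) \<noteq> 0" using N(2)[of n] by simp
    ultimately show ?thesis unfolding y_def by (simp flip: sum_divide_distrib)
  qed
  have inj: "inj_on (y n) {..<N n}" for n
    using N(2)[of n] by (auto simp: inj_on_def y_def)
  have ysq: "(\<Sum>k<N n. (y n k)\<^sup>2) \<le> 8 / (real (N n) + 1)" for n
  proof -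
    have "(\<Sum>k<N n. (y n k)\<^sup>2) \<le> (\<Sum>k<N n. 4 / (real (N n) + 1) * y n k)"
      unfolding power2_eq_square by (intro sum_mono mult_right_mono) (use yle ypos in \<open>auto intro: less_imp_le\<close>)
    also have "\<dots> = 4 / (real (N n) + 1) * 2" by (simp only: sum_distrib_left[symmetric] ysum)
    finally show ?thesis by simp
  qed
  have ysum3: "(\<Sum>k<N n. y n k) \<le> 3" for n using ysum by simp
  define R where "R = (\<lambda>n U W p q. row_sol (gfun \<phi> (N n) (y n)) U W p q
     \<and> (\<forall>f\<in>{U, W, p, q}. f holomorphic_on ball 0 2 \<and> (\<forall>z. cmod z < 2 \<longrightarrow> cmod (f z) \<le> rowb L)))"
  have "\<exists>U W p q. R n U W p q" for n
  proof -
    obtain \<alpha> \<gamma> where sys: "pole_system 1 (N n) (y n) (gres \<phi> (N n) (y n)) \<alpha> \<gamma>"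
      using pole_system_exists[OF inj ypos] by blast
    obtain U W p q where "row_sol (gfun \<phi> (N n) (y n)) U W p q"
      "\<And>f. f \<in> {U, W, p, q} \<Longrightarrow> f holomorphic_on ball 0 2"
      "\<And>f z. f \<in> {U, W, p, q} \<Longrightarrow> cmod z < 2 \<Longrightarrow> cmod (f z) \<le> rowb L"
      by (rule discrete_row_sol[OF \<phi> _ _ inj ypos y16 ysum3 sys]) (use \<phi>c L in auto)
    then have "R n U W p q" unfolding R_def by blast
    then show ?thesis by blast
  qed
  then have "\<forall>n. \<exists>T. R n (fst T) (fst (snd T)) (fst (snd (snd T))) (snd (snd (snd T)))" by simp
  from choice[OF this] obtain T where T: "\<And>n. R n (fst (T n)) (fst (snd (T n))) (fst (snd (snd (T n)))) (snd (snd (snd (T n))))" by blast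
  define Us Ws ps qs where "Us = (\<lambda>n. fst (T n))" and "Ws = (\<lambda>n. fst (snd (T n)))"
    and "ps = (\<lambda>n. fst (snd (snd (T n))))" and "qs = (\<lambda>n. snd (snd (snd (T n))))"
  have rs: "row_sol (gfun \<phi> (N n) (y n)) (Us n) (Ws n) (ps n) (qs n)" for n
    using T[of n] by (simp add: R_def Us_def Ws_def ps_def qs_def)
  have fh: "Us n holomorphic_on ball 0 2" "Ws n holomorphic_on ball 0 2" "ps n holomorphic_on ball 0 2" "qs n holomorphic_on ball 0 2"
    and fb: "\<And>z. cmod z < 2 \<Longrightarrow> cmod (Us n z) \<le> rowb L" "\<And>z. cmod z < 2 \<Longrightarrow> cmod (Ws n z) \<le> rowb L"
      "\<And>z. cmod z < 2 \<Longrightarrow> cmod (ps n z) \<le> rowb L" "\<And>z. cmod z < 2 \<Longrightarrow> cmod (qs n z) \<le> rowb L" for n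
    using T[of n] by (simp_all add: R_def Us_def Ws_def ps_def qs_def)
  \<comment> \<open>Four successive extractions, one for each function. Later extractions preserve
    earlier limits, so the composite \<open>k\<close> serves all four.\<close>
  obtain U k1 where U: "U holomorphic_on ball 0 2" "strict_mono (k1 :: nat \<Rightarrow> nat)"
    "\<And>z. cmod z < 2 \<Longrightarrow> (\<lambda>n. Us (k1 n) z) \<longlonglongrightarrow> U z" "\<And>z. cmod z < 2 \<Longrightarrow> cmod (U z) \<le> rowb L"
    by (rule montel_bounded_disc[of Us 2 "rowb L"]) (use fh fb in auto)
  obtain W k2 where W: "W holomorphic_on ball 0 2" "strict_mono (k2 :: nat \<Rightarrow> nat)"
    "\<And>z. cmod z < 2 \<Longrightarrow> (\<lambda>n. Ws (k1 (k2 n)) z) \<longlonglongrightarrow> W z" "\<And>z. cmod z < 2 \<Longrightarrow> cmod (W z) \<le> rowb L"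
    by (rule montel_bounded_disc[of "\<lambda>n. Ws (k1 n)" 2 "rowb L"]) (use fh fb in auto)
  obtain p k3 where p: "p holomorphic_on ball 0 2" "strict_mono (k3 :: nat \<Rightarrow> nat)"
    "\<And>z. cmod z < 2 \<Longrightarrow> (\<lambda>n. ps (k1 (k2 (k3 n))) z) \<longlonglongrightarrow> p z"
    by (rule montel_bounded_disc[of "\<lambda>n. ps (k1 (k2 n))" 2 "rowb L"]) (use fh fb in auto)
  obtain q k4 where q: "q holomorphic_on ball 0 2" "strict_mono (k4 :: nat \<Rightarrow> nat)"
    "\<And>z. cmod z < 2 \<Longrightarrow> (\<lambda>n. qs (k1 (k2 (k3 (k4 n)))) z) \<longlonglongrightarrow> q z"
    by (rule montel_bounded_disc[of "\<lambda>n. qs (k1 (k2 (k3 n)))" 2 "rowb L"]) (use fh fb in auto)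
  define k where "k = (\<lambda>n. k1 (k2 (k3 (k4 n))))"
  have k: "strict_mono k" using U(2) W(2) p(2) q(2) by (auto simp: k_def strict_mono_def)
  have lU: "(\<lambda>n. Us (k n) z) \<longlonglongrightarrow> U z" if "cmod z < 2" for z
    using LIMSEQ_subseq_LIMSEQ[OF U(3)[OF that], of "\<lambda>n. k2 (k3 (k4 n))"] W(2) p(2) q(2)
    by (simp add: k_def o_def strict_mono_def)
  have lW: "(\<lambda>n. Ws (k n) z) \<longlonglongrightarrow> W z" if "cmod z < 2" for z
    using LIMSEQ_subseq_LIMSEQ[OF W(3)[OF that], of "\<lambda>n. k3 (k4 n)"] p(2) q(2)
    by (simp add: k_def o_def strict_mono_def)
  have lp: "(\<lambda>n. ps (k n) z) \<longlonglongrightarrow> p z" if "cmod z < 2" for z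
    using LIMSEQ_subseq_LIMSEQ[OF p(3)[OF that] q(2)] by (simp add: k_def o_def)
  have lq: "(\<lambda>n. qs (k n) z) \<longlonglongrightarrow> q z" if "cmod z < 2" for z
    using q(3)[OF that] by (simp add: k_def)
  let ?g = "\<lambda>z. exp (2 * \<i> * \<phi> z) * exp (4 * \<i> / z)"
  have lg: "(\<lambda>n. gfun \<phi> (N (k n)) (y (k n)) z) \<longlonglongrightarrow> ?g z" if z: "cmod z = 1" for z
  proof -
    define D where "D = exp (2 * L) * (48 * exp 16)"
    have "cmod (gfun \<phi> (N n) (y n) z - ?g z) \<le> D * (8 / (real (N n) + 1))" for n
    proof -
      have "cmod (gfun \<phi> (N n) (y n) z - ?g z) \<le> D * (\<bar>(\<Sum>k<N n. y n k) - 2\<bar> + (\<Sum>k<N n. (y n k)\<^sup>2))"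
        unfolding D_def by (rule gfun_limit_bound[OF z L ypos y16]) (use z ysum in auto)
      also have "\<dots> \<le> D * (8 / (real (N n) + 1))" using ysq[of n] by (intro mult_left_mono) (auto simp: ysum D_def)
      finally show ?thesis .
    qed
    moreover have "(\<lambda>n. D * (8 / (real (N n) + 1))) \<longlonglongrightarrow> 0"
      unfolding N_def by real_asymp
    ultimately have "(\<lambda>n. gfun \<phi> (N n) (y n) z - ?g z) \<longlonglongrightarrow> 0"
      by (rule Lim_null_comparison[OF always_eventually[OF allI]])
    then have "(\<lambda>n. gfun \<phi> (N n) (y n) z) \<longlonglongrightarrow> ?g z" by (simp add: LIM_zero_iff)
    from LIMSEQ_subseq_LIMSEQ[OF this k] show ?thesis by (simp add: o_def)
  qed
  have "row_sol ?g U W p q"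
    unfolding row_sol_def
  proof (intro conjI ballI allI impI)
    fix f assume "f \<in> {U, W, p, q}"
    then have f: "f holomorphic_on ball 0 2" using U(1) W(1) p(1) q(1) by auto
    show "f holomorphic_on ball 0 1" using f by (rule holomorphic_on_subset) auto
    show "continuous_on (cball 0 1) f" using holomorphic_on_imp_continuous_on[OF f] by (rule continuous_on_subset) auto
  next
    have "(\<lambda>n. Us (k n) 0) = (\<lambda>n. 1)" "(\<lambda>n. Ws (k n) 0) = (\<lambda>n. 0)" using rs by (auto simp: row_sol_def)
    then show "U 0 = 1" "W 0 = 0" using lU[of 0] lW[of 0] by (simp_all add: LIMSEQ_const_iff)
  next
    fix z :: complex assume z: "cmod z = 1"
    then have z2: "cmod z < 2" "cmod (1 / z) < 2" by (simp_all add: norm_divide)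
    show "?g z \<noteq> 0" by simp
    have "(\<lambda>n. Us (k n) (1 / z) + gfun \<phi> (N (k n)) (y (k n)) z * Ws (k n) (1 / z)) \<longlonglongrightarrow> U (1 / z) + ?g z * W (1 / z)"
      by (intro tendsto_intros lU lW lg z z2)
    moreover have "(\<lambda>n. Us (k n) (1 / z) + gfun \<phi> (N (k n)) (y (k n)) z * Ws (k n) (1 / z)) = (\<lambda>n. ps (k n) z)"
      using rs z by (auto simp: row_sol_def)
    ultimately show "p z = U (1 / z) + ?g z * W (1 / z)" using lp[OF z2(1)] LIMSEQ_unique by metis
    have "(\<lambda>n. Ws (k n) (1 / z) - Us (k n) (1 / z) / gfun \<phi> (N (k n)) (y (k n)) z) \<longlonglongrightarrow> W (1 / z) - U (1 / z) / ?g z"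
      by (intro tendsto_intros lU lW lg z z2) simp
    moreover have "(\<lambda>n. Ws (k n) (1 / z) - Us (k n) (1 / z) / gfun \<phi> (N (k n)) (y (k n)) z) = (\<lambda>n. qs (k n) z)"
      using rs z by (auto simp: row_sol_def)
    ultimately show "q z = W (1 / z) - U (1 / z) / ?g z" using lq[OF z2(1)] LIMSEQ_unique by metis
  qed
  then show ?thesis by (rule that) (use U(4) W(4) in auto)
qed

text \<open>The first two factors are those of \<open>row_sol_compare\<close> with
  \<open>C = rowb L\<close> and \<open>G = exp (2 * L + 15)\<close>; the last is the constant of
  \<open>gfun_limit_bound\<close>.\<close>

definition asyb :: "real \<Rightarrow> real" where
  "asyb L = (rowb L)\<^sup>2 * (1 + exp (2 * L + 15))\<^sup>2 * (exp (2 * L) * (48 * exp 16))"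

text \<open>The limit row is fixed before \<open>N\<close> and the pole data are chosen, so a single
  solution of the model problem is compared with all discrete ones, with a constant depending only
  on \<open>L\<close>.\<close>

lemma limit_row_sol_asymptotics:
  assumes \<phi>: "\<phi> holomorphic_on UNIV" and \<phi>c: "\<And>z. cnj (\<phi> (cnj z)) = \<phi> z"
    and L: "\<And>z. cmod z \<le> 2 \<Longrightarrow> cmod (\<phi> z) \<le> L"
  obtains U W p q where "row_sol (\<lambda>z. exp (2 * \<i> * \<phi> z) * exp (4 * \<i> / z)) U W p q"
    "\<And>N y \<alpha> \<gamma>. inj_on y {..<N} \<Longrightarrow> (\<And>k. k < N \<Longrightarrow> 0 < y k) \<Longrightarrow> (\<And>k. k < N \<Longrightarrow> y k \<le> 1 / 16)
       \<Longrightarrow> \<bar>(\<Sum>k<N. y k) - 2\<bar> \<le> 1 \<Longrightarrow> pole_system 1 N y (gres \<phi> N y) \<alpha> \<gamma>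
       \<Longrightarrow> cmod ((\<Sum>k<N. \<gamma> k) - deriv W 0) \<le> asyb L * (\<bar>(\<Sum>k<N. y k) - 2\<bar> + (\<Sum>k<N. (y k)\<^sup>2))"
proof -
  let ?g = "\<lambda>z. exp (2 * \<i> * \<phi> z) * exp (4 * \<i> / z)"
  obtain U W p q where rs: "row_sol ?g U W p q"
    and bd: "\<And>f z. f \<in> {U, W} \<Longrightarrow> cmod z = 1 \<Longrightarrow> cmod (f z) \<le> rowb L"
    by (rule limit_row_sol[OF \<phi> _ L]) (use \<phi>c in auto)
  show ?thesis
  proof (rule that[OF rs])
    fix N y \<alpha> \<gamma>
    assume inj: "inj_on y {..<N}" and pos: "\<And>k. k < N \<Longrightarrow> 0 < y k" "\<And>k. k < N \<Longrightarrow> y k \<le> 1 / 16"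
      and sum: "\<bar>(\<Sum>k<N. y k) - 2\<bar> \<le> 1" and sys: "pole_system 1 N y (gres \<phi> N y) \<alpha> \<gamma>"
    have sum3: "(\<Sum>k<N. y k) \<le> 3" using sum by linarith
    obtain U' W' p' q' where rs': "row_sol (gfun \<phi> N y) U' W' p' q'" and d: "deriv W' 0 = (\<Sum>k<N. \<gamma> k)"
      and bd': "\<And>f z. f \<in> {U', W', p', q'} \<Longrightarrow> cmod z < 2 \<Longrightarrow> cmod (f z) \<le> rowb L"
      by (rule discrete_row_sol[OF \<phi> _ L inj pos sum3 sys]) (use \<phi>c in auto)
    have "cmod (deriv W' 0 - deriv W 0) \<le> (rowb L)\<^sup>2 * (1 + exp (2 * L + 15))\<^sup>2
       * (exp (2 * L) * (48 * exp 16) * (\<bar>(\<Sum>k<N. y k) - 2\<bar> + (\<Sum>k<N. (y k)\<^sup>2)))"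
    proof (rule row_sol_compare[OF rs' rs])
      fix w :: complex and f assume "cmod w = 1" "f \<in> {U', W', U, W}"
      then show "cmod (f w) \<le> rowb L" using bd[of f w] bd'[of f w] by auto
    next
      fix z :: complex assume z: "cmod z = 1"
      show "cmod (gfun \<phi> N y z - ?g z) \<le> exp (2 * L) * (48 * exp 16) * (\<bar>(\<Sum>k<N. y k) - 2\<bar> + (\<Sum>k<N. (y k)\<^sup>2))"
        by (rule gfun_limit_bound[OF z L pos sum]) (use z in auto)
      have 1: "cmod (1 / gfun \<phi> N y z) \<le> exp (2 * L + 15)"
        by (rule gfun_annulus_bound(2)[OF _ L pos sum3]) (use z \<phi>c in auto)
      have "1 / ?g z = exp (- (2 * \<i> * \<phi> z) + - (4 * \<i> / z))"
        unfolding exp_add exp_minus by (simp add: inverse_eq_divide)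
      moreover have "cmod (- (2 * \<i> * \<phi> z) + - (4 * \<i> / z)) \<le> 2 * L + 4"
      proof -
        have "cmod (2 * \<i> * \<phi> z) \<le> 2 * L" "cmod (4 * \<i> / z) = 4" using L[of z] z by (simp_all add: norm_mult norm_divide)
        then show ?thesis using norm_triangle_ineq[of "- (2 * \<i> * \<phi> z)" "- (4 * \<i> / z)"] by simp
      qed
      ultimately have "cmod (1 / ?g z) \<le> exp (2 * L + 4)" using norm_exp by (metis exp_le_cancel_iff order_trans)
      also have "\<dots> \<le> exp (2 * L + 15)" by simp
      finally show "cmod (1 / gfun \<phi> N y z) \<le> exp (2 * L + 15) \<and> cmod (1 / ?g z) \<le> exp (2 * L + 15)" using 1 by simp
    qed
    then show "cmod ((\<Sum>k<N. \<gamma> k) - deriv W 0) \<le> asyb L * (\<bar>(\<Sum>k<N. y k) - 2\<bar> + (\<Sum>k<N. (y k)\<^sup>2))"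
      by (simp add: asyb_def d mult.assoc)
  qed
qed

section \<open>From the residue system back to the discrete Riemann-Hilbert problem\<close>

text \<open>Substituting \<open>z = \<kappa> \<lambda>\<close> in a partial fraction divides its
  residues by \<open>\<kappa>\<close> and leaves the value at infinity unchanged.\<close>

lemma pole_system_scale:
  assumes "pole_system e N (\<lambda>k. \<kappa> * y k) r \<alpha> \<gamma>" and \<kappa>: "0 < \<kappa>"
  shows "pole_system e N y (\<lambda>k. r k / \<kappa>) (\<lambda>k. \<alpha> k / \<kappa>) (\<lambda>k. \<gamma> k / \<kappa>)"
proof -
  have "pfrac e N (\<lambda>j. \<i> * (\<kappa> * y j)) \<alpha> (- (\<i> * (\<kappa> * y k))) = pfrac e N (\<lambda>j. \<i> * y j) (\<lambda>k. \<alpha> k / \<kappa>) (- \<i> * y k)" for k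
  proof -
    have "- (\<i> * (\<kappa> * y k)) - \<i> * (\<kappa> * y j) = \<kappa> * (- \<i> * y k - \<i> * y j)" for j
      by (simp add: algebra_simps)
    then show ?thesis by (simp add: pfrac_def)
  qed
  moreover have "pfrac 0 N (\<lambda>j. - \<i> * (\<kappa> * y j)) \<gamma> (\<i> * (\<kappa> * y k)) = pfrac 0 N (\<lambda>j. - \<i> * y j) (\<lambda>k. \<gamma> k / \<kappa>) (\<i> * y k)" for k
  proof -
    have "\<i> * (\<kappa> * y k) - - \<i> * (\<kappa> * y j) = \<kappa> * (\<i> * y k - - \<i> * y j)" for j
      by (simp add: algebra_simps)
    then show ?thesis by (simp add: pfrac_def)
  qed
  ultimately show ?thesis using assms by (simp add: pole_system_def)
qed

text \<open>A common phase of the residue coefficients can be moved into \<open>w\<close> alone, so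
  the constant \<open>\<tau>\<close> leaves the potential as a factor.\<close>

lemma pole_system_rotate:
  assumes "pole_system e N y r \<alpha> \<gamma>" and \<tau>: "\<tau> * cnj \<tau> = 1"
  shows "pole_system e N y (\<lambda>k. r k / \<tau>) \<alpha> (\<lambda>k. \<tau> * \<gamma> k)"
proof -
  have t0: "\<tau> \<noteq> 0" using \<tau> by auto
  then have "cnj \<tau> \<noteq> 0" by simp
  then have t1: "1 / cnj \<tau> = \<tau>" using \<tau> by (simp add: nonzero_divide_eq_eq)
  have "pfrac 0 N b (\<lambda>k. \<tau> * \<gamma> k) z = \<tau> * pfrac 0 N b \<gamma> z" for b z
    by (simp add: pfrac_def sum_distrib_left)
  moreover have "cnj (r k / \<tau>) = \<tau> * cnj (r k)" for k
    unfolding complex_cnj_divide by (metis t1 mult.commute times_divide_eq_right mult_1_right)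
  ultimately show ?thesis using assms t0 by (simp add: pole_system_def)
qed

text \<open>The determinant argument again, now with poles: for an arbitrary solution with first row
  \<open>(U, V)\<close> the residue conditions remove every singularity of \<open>V u - U v\<close>,
  which vanishes at infinity and hence everywhere.\<close>

lemma discrete_RHP_moment_unique:
  fixes s :: "nat \<Rightarrow> real"
  assumes inj: "inj_on s {..<N}" and pos: "\<And>k. k < N \<Longrightarrow> 0 < s k"
    and c0: "\<And>k. k < N \<Longrightarrow> c k \<noteq> 0"
    and sys: "pole_system 1 N s (\<lambda>k. - c k) \<alpha> \<gamma>"
    and M: "discrete_RHP N s c Mt" and y: "((\<lambda>z. 2 * \<i> * z * Mt z $ 1 $ 2) \<longlongrightarrow> y) at_infinity"
  shows "y = 2 * \<i> * (\<Sum>k<N. \<gamma> k)"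
proof -
  define a b where "a = (\<lambda>j. \<i> * complex_of_real (s j))" and "b = (\<lambda>j. - \<i> * complex_of_real (s j))"
  define u v where "u = pfrac 1 N a \<alpha>" and "v = pfrac 0 N b \<gamma>"
  define U V where "U = (\<lambda>z. Mt z $ 1 $ 1)" and "V = (\<lambda>z. Mt z $ 1 $ 2)"
  define S where "S = a ` {..<N} \<union> b ` {..<N}"
  have ia: "inj_on a {..<N}" and ib: "inj_on b {..<N}"
    using inj by (auto simp: inj_on_def a_def b_def)
  have Im: "0 < Im (a k)" "Im (b k) < 0" if "k < N" for k
    using pos that by (simp_all add: a_def b_def)
  have ab: "a k \<notin> b ` {..<N}" "b k \<notin> a ` {..<N}" if "k < N" for k
    using Im(1)[OF that] Im(2)[OF that] Im by fastforce+
  have fin: "finite S" by (simp add: S_def)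
  have \<alpha>: "\<alpha> k = c k * v (a k)" and \<gamma>: "\<gamma> k = - cnj (c k) * u (b k)" if "k < N" for k
    using sys that by (auto simp: pole_system_def u_def v_def a_def b_def)
  have hol: "U holomorphic_on - S" "V holomorphic_on - S"
    using M by (auto simp: discrete_RHP_def mholo_def U_def V_def S_def a_def b_def)
  have inf: "(U \<longlongrightarrow> 1) at_infinity" "(V \<longlongrightarrow> 0) at_infinity"
  proof -
    have "(Mt \<longlongrightarrow> mat 1) at_infinity" using M by (simp add: discrete_RHP_def)
    from tendsto_vec_nth[OF tendsto_vec_nth[OF this]]
    have l: "((\<lambda>z. Mt z $ i $ j) \<longlongrightarrow> (mat 1 :: complex^2^2) $ i $ j) at_infinity" for i j .
    show "(U \<longlongrightarrow> 1) at_infinity" "(V \<longlongrightarrow> 0) at_infinity"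
      using l[of 1 1] l[of 1 2] by (simp_all add: U_def V_def mat_def)
  qed
  define F where "F = (\<lambda>z. V z * u z - U z * v z)"
  have sing: "((\<lambda>z. (z - \<xi>) * F z) \<longlongrightarrow> 0) (at \<xi>)" if "\<xi> \<in> S" for \<xi>
  proof -
    from that consider k where "k < N" "\<xi> = a k" | k where "k < N" "\<xi> = b k" by (auto simp: S_def)
    then show ?thesis
    proof cases
      case 1
      obtain L where L: "((\<lambda>w. Mt w ** mat2 0 0 (c k) 0) \<longlongrightarrow> L) (at \<xi>)" "((\<lambda>w. cscale (w - \<xi>) (Mt w)) \<longlongrightarrow> L) (at \<xi>)"
        using M 1 by (auto simp: discrete_RHP_def a_def)
      have l: "((\<lambda>w. V w * c k) \<longlongrightarrow> L $ 1 $ 1) (at \<xi>)" "((\<lambda>w. (w - \<xi>) * U w) \<longlongrightarrow> L $ 1 $ 1) (at \<xi>)"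
        using tendsto_vec_nth[OF tendsto_vec_nth[OF L(1)], of 1 1] tendsto_vec_nth[OF tendsto_vec_nth[OF L(2)], of 1 1]
        by (simp_all add: matrix_mult_2_nth cscale_def U_def V_def)
      \<comment> \<open>The residue condition asserts convergence of \<open>V * c k\<close>;
        dividing by the nonzero \<open>c k\<close> gives a limit of \<open>V\<close> itself at the
        pole of \<open>U\<close>.\<close>
      have "((\<lambda>w. V w * c k / c k) \<longlongrightarrow> L $ 1 $ 1 / c k) (at \<xi>)"
        using c0[OF 1(1)] by (intro tendsto_intros l) auto
      then have lV: "(V \<longlongrightarrow> L $ 1 $ 1 / c k) (at \<xi>)" using c0[OF 1(1)] by simp
      have lu: "((\<lambda>z. (z - \<xi>) * u z) \<longlongrightarrow> \<alpha> k) (at \<xi>)" unfolding u_def 1 by (rule pfrac_residue[OF ia 1(1)])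
      have lv: "(v \<longlongrightarrow> v \<xi>) (at \<xi>)" unfolding v_def 1 by (rule pfrac_tendsto[OF ab(1)[OF 1(1)]])
      have "((\<lambda>z. V z * ((z - \<xi>) * u z) - ((z - \<xi>) * U z) * v z) \<longlongrightarrow> L $ 1 $ 1 / c k * \<alpha> k - L $ 1 $ 1 * v \<xi>) (at \<xi>)"
        by (intro tendsto_intros lV lu lv l)
      moreover have "L $ 1 $ 1 / c k * \<alpha> k - L $ 1 $ 1 * v \<xi> = 0"
        using \<alpha>[OF 1(1)] c0[OF 1(1)] by (simp add: 1)
      ultimately show ?thesis by (simp add: F_def algebra_simps)
    next
      case 2
      obtain L where L: "((\<lambda>w. Mt w ** mat2 0 (- cnj (c k)) 0 0) \<longlongrightarrow> L) (at \<xi>)" "((\<lambda>w. cscale (w - \<xi>) (Mt w)) \<longlongrightarrow> L) (at \<xi>)"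
        using M 2 by (auto simp: discrete_RHP_def b_def)
      have l: "((\<lambda>w. U w * - cnj (c k)) \<longlongrightarrow> L $ 1 $ 2) (at \<xi>)" "((\<lambda>w. (w - \<xi>) * V w) \<longlongrightarrow> L $ 1 $ 2) (at \<xi>)"
        using tendsto_vec_nth[OF tendsto_vec_nth[OF L(1)], of 1 2] tendsto_vec_nth[OF tendsto_vec_nth[OF L(2)], of 1 2]
        by (simp_all add: matrix_mult_2_nth cscale_def U_def V_def)
      have "((\<lambda>w. U w * - cnj (c k) / (- cnj (c k))) \<longlongrightarrow> L $ 1 $ 2 / (- cnj (c k))) (at \<xi>)"
        using c0[OF 2(1)] by (intro tendsto_divide l tendsto_const) auto
      then have lU: "(U \<longlongrightarrow> L $ 1 $ 2 / (- cnj (c k))) (at \<xi>)" using c0[OF 2(1)] by simp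
      have lu: "(u \<longlongrightarrow> u \<xi>) (at \<xi>)" unfolding u_def 2 by (rule pfrac_tendsto[OF ab(2)[OF 2(1)]])
      have lv: "((\<lambda>z. (z - \<xi>) * v z) \<longlongrightarrow> \<gamma> k) (at \<xi>)" unfolding v_def 2 by (rule pfrac_residue[OF ib 2(1)])
      have "((\<lambda>z. ((z - \<xi>) * V z) * u z - U z * ((z - \<xi>) * v z)) \<longlongrightarrow> L $ 1 $ 2 * u \<xi> - L $ 1 $ 2 / (- cnj (c k)) * \<gamma> k) (at \<xi>)"
        by (intro tendsto_diff tendsto_mult lU lu lv l)
      moreover have "L $ 1 $ 2 * u \<xi> - L $ 1 $ 2 / (- cnj (c k)) * \<gamma> k = 0"
        using \<gamma>[OF 2(1)] c0[OF 2(1)] by (simp add: 2)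
      ultimately show ?thesis by (simp add: F_def algebra_simps)
    qed
  qed
  have "F holomorphic_on - S"
    unfolding F_def u_def v_def S_def
    by (intro holomorphic_on_diff holomorphic_on_mult hol[unfolded S_def] holomorphic_on_subset[OF pfrac_holomorphic]) auto
  then obtain h where h: "h holomorphic_on UNIV" "\<And>z. z \<notin> S \<Longrightarrow> h z = F z"
    using removable_finite_singularities[OF fin _ sing] by metis
  have ui: "(u \<longlongrightarrow> 1) at_infinity" and vi: "(v \<longlongrightarrow> 0) at_infinity"
    unfolding u_def v_def by (rule pfrac_at_infinity)+
  have "(F \<longlongrightarrow> 0 * 1 - 1 * 0) at_infinity" unfolding F_def by (intro tendsto_intros inf ui vi)
  moreover have ev: "\<forall>\<^sub>F z in at_infinity. F z = h z"
  proof -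
    obtain B where "\<And>z. z \<in> S \<Longrightarrow> cmod z \<le> B" using finite_imp_bounded[OF fin] by (auto simp: bounded_iff)
    then have "\<forall>z. B + 1 \<le> cmod z \<longrightarrow> F z = h z" using h(2) by (smt (verit))
    then show ?thesis unfolding eventually_at_infinity by blast
  qed
  ultimately have "(h \<longlongrightarrow> 0) at_infinity" by (auto intro: Lim_transform_eventually)
  with h(1) have h0: "h z = 0" for z by (rule Liouville_weak)
  \<comment> \<open>This combination equals \<open>2 * \<i> * z * F z\<close>, which is eventually
    0, and it tends to the difference of the two moments.\<close>
  have "((\<lambda>z. (2 * \<i> * z * V z) * u z - U z * (2 * \<i> * (z * (v z - 0)))) \<longlongrightarrow> y * 1 - 1 * (2 * \<i> * (\<Sum>k<N. \<gamma> k))) at_infinity"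
    unfolding v_def using y by (intro tendsto_intros inf ui pfrac_moment) (simp add: V_def)
  moreover have "\<forall>\<^sub>F z in at_infinity. (2 * \<i> * z * V z) * u z - U z * (2 * \<i> * (z * (v z - 0))) = 0"
    using ev
  proof eventually_elim
    case (elim z)
    have "(2 * \<i> * z * V z) * u z - U z * (2 * \<i> * (z * (v z - 0))) = 2 * \<i> * z * F z"
      by (simp add: F_def algebra_simps)
    then show ?case using elim h0 by simp
  qed
  ultimately have "y * 1 - 1 * (2 * \<i> * (\<Sum>k<N. \<gamma> k)) = 0"
    by (rule tendsto_unique[OF trivial_limit_at_infinity _ tendsto_eventually])
  then show ?thesis by simp
qed

lemma discrete_RHP_exists:
  fixes s :: "nat \<Rightarrow> real"
  assumes inj: "inj_on s {..<N}" and pos: "\<And>k. k < N \<Longrightarrow> 0 < s k"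
    and sys: "pole_system 1 N s (\<lambda>k. - c k) \<alpha> \<gamma>"
  shows "\<exists>Mt. discrete_RHP N s c Mt \<and> ((\<lambda>z. 2 * \<i> * z * Mt z $ 1 $ 2) \<longlongrightarrow> 2 * \<i> * (\<Sum>k<N. \<gamma> k)) at_infinity"
proof -
  define a b where "a = (\<lambda>j. \<i> * complex_of_real (s j))" and "b = (\<lambda>j. - \<i> * complex_of_real (s j))"
  define u v where "u = pfrac 1 N a \<alpha>" and "v = pfrac 0 N b \<gamma>"
  define us vs where "us = pfrac 1 N b (\<lambda>k. cnj (\<alpha> k))" and "vs = pfrac 0 N a (\<lambda>k. cnj (\<gamma> k))"
  define Mt where "Mt = (\<lambda>z. mat2 (u z) (v z) (- vs z) (us z))"
  have cab: "cnj (a k) = b k" "cnj (b k) = a k" for k by (simp_all add: a_def b_def)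
  have us: "us z = cnj (u (cnj z))" and vs: "vs z = cnj (v (cnj z))" for z
    by (simp_all add: u_def us_def v_def vs_def pfrac_cnj cab)
  have ia: "inj_on a {..<N}" and ib: "inj_on b {..<N}"
    using inj by (auto simp: inj_on_def a_def b_def)
  have Im: "0 < Im (a k)" "Im (b k) < 0" if "k < N" for k
    using pos that by (simp_all add: a_def b_def)
  have ab: "a k \<notin> b ` {..<N}" "b k \<notin> a ` {..<N}" if "k < N" for k
    using Im(1)[OF that] Im(2)[OF that] Im by fastforce+
  have \<alpha>: "\<alpha> k = c k * v (a k)" and \<gamma>: "\<gamma> k = - cnj (c k) * u (b k)" if "k < N" for k
    using sys that by (auto simp: pole_system_def u_def v_def a_def b_def)
  have entries: "(f \<longlongrightarrow> mat2 A B C D) G"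
    if "((\<lambda>z. f z $ 1 $ 1) \<longlongrightarrow> A) G" "((\<lambda>z. f z $ 1 $ 2) \<longlongrightarrow> B) G" "((\<lambda>z. f z $ 2 $ 1) \<longlongrightarrow> C) G" "((\<lambda>z. f z $ 2 $ 2) \<longlongrightarrow> D) G"
    for f :: "complex \<Rightarrow> complex^2^2" and A B C D G
  proof (rule vec_tendstoI, rule vec_tendstoI)
    fix i j :: 2
    show "((\<lambda>x. f x $ i $ j) \<longlongrightarrow> mat2 A B C D $ i $ j) G"
      using that exhaust_2[of i] exhaust_2[of j] by auto
  qed
  have "discrete_RHP N s c Mt"
    unfolding discrete_RHP_def
  proof (intro conjI allI impI)
    have sub: "- ((\<lambda>k. \<i> * complex_of_real (s k)) ` {..<N} \<union> (\<lambda>k. - \<i> * complex_of_real (s k)) ` {..<N}) \<subseteq> - (a ` {..<N})"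
       "- ((\<lambda>k. \<i> * complex_of_real (s k)) ` {..<N} \<union> (\<lambda>k. - \<i> * complex_of_real (s k)) ` {..<N}) \<subseteq> - (b ` {..<N})"
      by (auto simp: a_def b_def)
    show "mholo Mt (- ((\<lambda>k. \<i> * complex_of_real (s k)) ` {..<N} \<union> (\<lambda>k. - \<i> * complex_of_real (s k)) ` {..<N}))"
      unfolding mholo_def
    proof (intro allI)
      fix i j :: 2
      show "(\<lambda>z. Mt z $ i $ j) holomorphic_on - ((\<lambda>k. \<i> * complex_of_real (s k)) ` {..<N} \<union> (\<lambda>k. - \<i> * complex_of_real (s k)) ` {..<N})"
        using exhaust_2[of i] exhaust_2[of j]
          holomorphic_on_subset[OF pfrac_holomorphic sub(1), of 1 \<alpha>] holomorphic_on_subset[OF pfrac_holomorphic sub(2), of 0 \<gamma>]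
          holomorphic_on_minus[OF holomorphic_on_subset[OF pfrac_holomorphic sub(1), of 0 "\<lambda>k. cnj (\<gamma> k)"]]
          holomorphic_on_subset[OF pfrac_holomorphic sub(2), of 1 "\<lambda>k. cnj (\<alpha> k)"]
        by (auto simp: Mt_def u_def v_def us_def vs_def)
    qed
  next
    fix k assume k: "k < N"
    have ak: "\<i> * complex_of_real (s k) = a k" and bk: "- \<i> * complex_of_real (s k) = b k" by (simp_all add: a_def b_def)
    have bk': "w + \<i> * complex_of_real (s k) = w - b k" for w by (simp add: b_def)
    have t: "(v \<longlongrightarrow> v (a k)) (at (a k))" "(us \<longlongrightarrow> us (a k)) (at (a k))" "(u \<longlongrightarrow> u (b k)) (at (b k))" "(vs \<longlongrightarrow> vs (b k)) (at (b k))"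
      unfolding u_def v_def us_def vs_def by (intro pfrac_tendsto ab k)+
    have r: "((\<lambda>z. (z - a k) * u z) \<longlongrightarrow> \<alpha> k) (at (a k))" "((\<lambda>z. (z - a k) * vs z) \<longlongrightarrow> cnj (\<gamma> k)) (at (a k))"
      "((\<lambda>z. (z - b k) * v z) \<longlongrightarrow> \<gamma> k) (at (b k))" "((\<lambda>z. (z - b k) * us z) \<longlongrightarrow> cnj (\<alpha> k)) (at (b k))"
      unfolding u_def v_def us_def vs_def by (intro pfrac_residue ia ib k)+
    have us_a: "us (a k) = cnj (u (b k))" and vs_b: "vs (b k) = cnj (v (a k))" by (simp_all add: us vs cab)
    show "\<exists>L. ((\<lambda>w. Mt w ** mat2 0 0 (c k) 0) \<longlongrightarrow> L) (at (\<i> * complex_of_real (s k)))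
       \<and> ((\<lambda>w. cscale (w - \<i> * complex_of_real (s k)) (Mt w)) \<longlongrightarrow> L) (at (\<i> * complex_of_real (s k)))"
      unfolding ak
    proof (intro exI conjI)
      show "((\<lambda>w. Mt w ** mat2 0 0 (c k) 0) \<longlongrightarrow> mat2 (\<alpha> k) 0 (- cnj (\<gamma> k)) 0) (at (a k))"
        using tendsto_mult_right[OF t(1), of "c k"] tendsto_mult_right[OF t(2), of "c k"]
        by (intro entries) (simp_all add: matrix_mult_2_nth Mt_def \<alpha>[OF k] \<gamma>[OF k] us_a mult.commute)
      show "((\<lambda>w. cscale (w - a k) (Mt w)) \<longlongrightarrow> mat2 (\<alpha> k) 0 (- cnj (\<gamma> k)) 0) (at (a k))"
        using r(1) tendsto_minus[OF r(2)] tendsto_zero_mult_isCont[OF t(1)] tendsto_zero_mult_isCont[OF t(2)]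
        by (intro entries) (simp_all add: cscale_def Mt_def)
    qed
    show "\<exists>L. ((\<lambda>w. Mt w ** mat2 0 (- cnj (c k)) 0 0) \<longlongrightarrow> L) (at (- \<i> * complex_of_real (s k)))
       \<and> ((\<lambda>w. cscale (w + \<i> * complex_of_real (s k)) (Mt w)) \<longlongrightarrow> L) (at (- \<i> * complex_of_real (s k)))"
      unfolding bk bk'
    proof (intro exI conjI)
      show "((\<lambda>w. Mt w ** mat2 0 (- cnj (c k)) 0 0) \<longlongrightarrow> mat2 0 (\<gamma> k) 0 (cnj (\<alpha> k))) (at (b k))"
        using tendsto_mult_right[OF t(3), of "- cnj (c k)"] tendsto_mult_right[OF t(4), of "cnj (c k)"]
        by (intro entries) (simp_all add: matrix_mult_2_nth Mt_def \<alpha>[OF k] \<gamma>[OF k] vs_b mult.commute)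
      show "((\<lambda>w. cscale (w - b k) (Mt w)) \<longlongrightarrow> mat2 0 (\<gamma> k) 0 (cnj (\<alpha> k))) (at (b k))"
        using r(3,4) tendsto_zero_mult_isCont[OF t(3)] tendsto_minus[OF tendsto_zero_mult_isCont[OF t(4)]]
        by (intro entries) (simp_all add: cscale_def Mt_def)
    qed
  next
    have "(Mt \<longlongrightarrow> mat2 1 0 (- 0) 1) at_infinity"
      using pfrac_at_infinity[of 1 N a \<alpha>] pfrac_at_infinity[of 0 N b \<gamma>] tendsto_minus[OF pfrac_at_infinity[of 0 N a "\<lambda>k. cnj (\<gamma> k)"]]
        pfrac_at_infinity[of 1 N b "\<lambda>k. cnj (\<alpha> k)"]
      by (intro entries) (simp_all add: Mt_def u_def v_def us_def vs_def)
    moreover have "mat2 1 0 (- 0) 1 = mat 1" by (simp add: mat2_cong mat_def)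
    ultimately show "(Mt \<longlongrightarrow> mat 1) at_infinity" by simp
  qed
  moreover have "((\<lambda>z. 2 * \<i> * z * Mt z $ 1 $ 2) \<longlongrightarrow> 2 * \<i> * (\<Sum>k<N. \<gamma> k)) at_infinity"
    using tendsto_mult_left[OF pfrac_moment[where e = 0 and N = N and a = b and \<alpha> = \<gamma>], of "2 * \<i>"] by (simp add: Mt_def v_def mult.assoc)
  ultimately show ?thesis by blast
qed

lemma psitil_eq:
  fixes A :: "real \<Rightarrow> real"
  assumes "inj_on (stil A x0 N) {..<N}" and "\<And>k. k < N \<Longrightarrow> 0 < stil A x0 N k"
    and "\<And>k. k < N \<Longrightarrow> ccoef A x0 N M x t k \<noteq> 0"
    and "pole_system 1 N (stil A x0 N) (\<lambda>k. - ccoef A x0 N M x t k) \<alpha> \<gamma>"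
  shows "psitil A x0 N M x t = 2 * \<i> * (\<Sum>k<N. \<gamma> k)"
  unfolding psitil_def
proof (rule the_equality)
  show "\<exists>Mt. discrete_RHP N (stil A x0 N) (ccoef A x0 N M x t) Mt
      \<and> ((\<lambda>z. 2 * \<i> * z * Mt z $ 1 $ 2) \<longlongrightarrow> 2 * \<i> * (\<Sum>k<N. \<gamma> k)) at_infinity"
    by (rule discrete_RHP_exists[OF assms(1,2,4)])
qed (use discrete_RHP_moment_unique[OF assms] in blast)

section \<open>The phase integral and the sum of its quantized levels\<close>

text \<open>A fixed interval with the integrand cut off at zero avoids the moving turning points.
  The dependence on \<open>s\<close> is continuous on the closed range, including
  \<open>s = 0\<close>, where the turning points in \<open>PhiR\<close> are not unique.\<close>

definition trunc_phase :: "(real \<Rightarrow> real) \<Rightarrow> real \<Rightarrow> real \<Rightarrow> real \<Rightarrow> real" where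
  "trunc_phase A Xm Xp s = integral {Xm..Xp} (\<lambda>x. sqrt (max 0 ((A x)\<^sup>2 - s\<^sup>2)))"

text \<open>Smoothness is assumed only away from the two edges, where the square root has infinite
  slope; continuity up to the edges comes from the factored form.\<close>

lemma semicircular_KS_continuous:
  assumes "semicircular_KS A Xm Xp x0"
  shows "continuous_on {Xm..Xp} A"
proof -
  obtain u S U where u: "\<forall>x\<in>{Xm..Xp}. A x = u x * sqrt ((Xp - x) * (x - Xm))"
    and S: "complex_of_real ` {Xm..Xp} \<subseteq> S" "U holomorphic_on S"
    and U: "\<forall>x\<in>{Xm..Xp}. U (complex_of_real x) = complex_of_real (u x)"
  proof -
    have "\<exists>u c. c > 0 \<and> (\<forall>x\<in>{Xm..Xp}. A x = u x * sqrt ((Xp - x) * (x - Xm)) \<and> c \<le> u x)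
        \<and> (\<exists>S U. open S \<and> complex_of_real ` {Xm..Xp} \<subseteq> S \<and> U holomorphic_on S
               \<and> (\<forall>x\<in>{Xm..Xp}. U (complex_of_real x) = complex_of_real (u x)))"
      using assms unfolding semicircular_KS_def by (elim conjE) assumption
    then show ?thesis by (elim exE conjE) (rule that; simp)
  qed
  have "continuous_on {Xm..Xp} (\<lambda>x. U (complex_of_real x))"
    by (rule continuous_on_compose2[OF holomorphic_on_imp_continuous_on[OF S(2)]])
      (use S(1) in \<open>auto intro!: continuous_intros\<close>)
  then have "continuous_on {Xm..Xp} (\<lambda>x. Re (U (complex_of_real x)))" by (rule continuous_on_Re)
  also have "?this \<longleftrightarrow> continuous_on {Xm..Xp} u" by (rule continuous_on_cong) (use U in auto)
  finally have "continuous_on {Xm..Xp} (\<lambda>x. u x * sqrt ((Xp - x) * (x - Xm)))"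
    by (intro continuous_intros)
  also have "?this \<longleftrightarrow> continuous_on {Xm..Xp} A" by (rule continuous_on_cong) (use u in auto)
  finally show ?thesis .
qed

text \<open>\<open>A\<close> rises strictly up to \<open>x0\<close> and falls strictly after it, so
  a level in between is attained once on either side, and the superlevel set is the interval bounded
  by these two points.\<close>

lemma semicircular_KS_turning_points:
  assumes KS: "semicircular_KS A Xm Xp x0" and s: "0 < s" "s < A x0"
  shows "Xm \<le> xminus A x0 s" "xplus A x0 s \<le> Xp"
    "\<And>x. x \<in> {xminus A x0 s..xplus A x0 s} \<longleftrightarrow> s \<le> A x"
proof -
  have cont: "continuous_on {Xm..Xp} A" by (rule semicircular_KS_continuous[OF KS])
  have x0: "Xm < x0" "x0 < Xp" using KS by (auto simp: semicircular_KS_def)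
  have ends: "A Xm = 0" "A Xp = 0" and out: "\<And>x. x < Xm \<or> Xp < x \<Longrightarrow> A x = 0"
    using KS by (auto simp: semicircular_KS_def)
  have C2: "C2_on (- {Xm, Xp}) A" using KS by (simp add: semicircular_KS_def)
  have der: "(A has_real_derivative deriv A x) (at x)" if "x \<in> {Xm<..<Xp}" for x
    using C2 that by (auto simp: C2_on_def intro!: DERIV_deriv_iff_real_differentiable[THEN iffD2])
  have inc: "A x < A y" if "Xm \<le> x" "x < y" "y \<le> x0" for x y
  proof (rule DERIV_pos_imp_increasing_open[OF that(2)])
    show "continuous_on {x..y} A" using cont by (rule continuous_on_subset) (use that x0 in auto)
    fix z assume "x < z" "z < y"
    then show "\<exists>d. (A has_real_derivative d) (at z) \<and> 0 < d"
      using der[of z] KS that x0 by (intro exI[of _ "deriv A z"]) (auto simp: semicircular_KS_def)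
  qed
  have dec: "A y < A x" if "x0 \<le> x" "x < y" "y \<le> Xp" for x y
  proof (rule DERIV_neg_imp_decreasing_open[OF that(2)])
    show "continuous_on {x..y} A" using cont by (rule continuous_on_subset) (use that x0 in auto)
    fix z assume "x < z" "z < y"
    then show "\<exists>d. (A has_real_derivative d) (at z) \<and> d < 0"
      using der[of z] KS that x0 by (intro exI[of _ "deriv A z"]) (auto simp: semicircular_KS_def)
  qed
  have "\<exists>x. Xm \<le> x \<and> x \<le> x0 \<and> A x = s"
    by (rule IVT') (use s x0 ends in \<open>auto intro: continuous_on_subset[OF cont]\<close>)
  then obtain xm where xm: "Xm \<le> xm" "xm \<le> x0" "A xm = s" by blast
  have "\<exists>x. x0 \<le> x \<and> x \<le> Xp \<and> A x = s"
    by (rule IVT2') (use s x0 ends in \<open>auto intro: continuous_on_subset[OF cont]\<close>)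
  then obtain xp where xp: "x0 \<le> xp" "xp \<le> Xp" "A xp = s" by blast
  have zl: "A x = 0" if "x \<le> Xm" for x using that ends out[of x] by (cases "x = Xm") auto
  have zr: "A x = 0" if "Xp \<le> x" for x using that ends out[of x] by (cases "x = Xp") auto
  have l: "A x < s" if "x < xm" for x
    using zl[of x] inc[of x xm] that xm s by (cases "x \<le> Xm") auto
  have l': "s < A x" if "xm < x" "x \<le> x0" for x using inc[of xm x] that xm by auto
  have r: "A x < s" if "xp < x" for x
    using zr[of x] dec[of xp x] that xp s by (cases "Xp \<le> x") auto
  have r': "s < A x" if "x < xp" "x0 \<le> x" for x using dec[of x xp] that xp by auto
  have "xminus A x0 s = xm" unfolding xminus_def
  proof (rule the_equality)
    show "x = xm" if "x \<le> x0 \<and> A x = s" for x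
      using l[of x] l'[of x] that by (cases x xm rule: linorder_cases) auto
  qed (use xm in auto)
  moreover have "xplus A x0 s = xp" unfolding xplus_def
  proof (rule the_equality)
    show "x = xp" if "x0 \<le> x \<and> A x = s" for x
      using r[of x] r'[of x] that by (cases x xp rule: linorder_cases) auto
  qed (use xp in auto)
  moreover have "x \<in> {xm..xp} \<longleftrightarrow> s \<le> A x" for x
  proof
    assume "x \<in> {xm..xp}"
    then consider "x = xm" | "x = xp" | "xm < x" "x < xp" by fastforce
    then show "s \<le> A x"
    proof cases
      case 3
      then show ?thesis using l'[of x] r'[of x] by (cases "x \<le> x0") auto
    qed (use xm xp in auto)
  next
    assume "s \<le> A x"
    then have "\<not> x < xm" "\<not> xp < x" using l[of x] r[of x] by auto
    then show "x \<in> {xm..xp}" by simp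
  qed
  ultimately show "Xm \<le> xminus A x0 s" "xplus A x0 s \<le> Xp"
    "\<And>x. x \<in> {xminus A x0 s..xplus A x0 s} \<longleftrightarrow> s \<le> A x" using xm xp by auto
qed

lemma PhiR_eq_trunc_phase:
  assumes KS: "semicircular_KS A Xm Xp x0" and s: "0 < s" "s < A x0"
  shows "PhiR A x0 s = trunc_phase A Xm Xp s"
proof -
  note tp = semicircular_KS_turning_points[OF KS s]
  let ?I = "{xminus A x0 s..xplus A x0 s}"
  have nn: "0 \<le> A x" for x using KS by (simp add: semicircular_KS_def)
  have "trunc_phase A Xm Xp s = integral {Xm..Xp} (\<lambda>x. if x \<in> ?I then sqrt ((A x)\<^sup>2 - s\<^sup>2) else 0)"
    unfolding trunc_phase_def
  proof (rule integral_cong)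
    fix x
    have "s \<le> A x \<longleftrightarrow> s\<^sup>2 \<le> (A x)\<^sup>2" using nn[of x] s by (simp add: power_mono_iff)
    then show "sqrt (max 0 ((A x)\<^sup>2 - s\<^sup>2)) = (if x \<in> ?I then sqrt ((A x)\<^sup>2 - s\<^sup>2) else 0)"
      unfolding tp(3) by (auto simp: max_def)
  qed
  also have "\<dots> = integral (?I \<inter> {Xm..Xp}) (\<lambda>x. sqrt ((A x)\<^sup>2 - s\<^sup>2))" by (rule integral_restrict_Int)
  also have "?I \<inter> {Xm..Xp} = ?I" using tp(1,2) by auto
  finally show ?thesis by (simp add: PhiR_def)
qed

lemma trunc_phase_properties:
  assumes KS: "semicircular_KS A Xm Xp x0"
  shows "0 < A x0" "continuous_on {0..A x0} (trunc_phase A Xm Xp)"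
    "\<And>s s'. 0 \<le> s \<Longrightarrow> s < s' \<Longrightarrow> s' \<le> A x0 \<Longrightarrow> trunc_phase A Xm Xp s' < trunc_phase A Xm Xp s"
    "trunc_phase A Xm Xp 0 = integral UNIV A" "trunc_phase A Xm Xp (A x0) = 0"
proof -
  have contA: "continuous_on {Xm..Xp} A" by (rule semicircular_KS_continuous[OF KS])
  have x0: "Xm < x0" "x0 < Xp" using KS by (auto simp: semicircular_KS_def)
  have nn: "0 \<le> A x" for x using KS by (simp add: semicircular_KS_def)
  have le: "A x \<le> A x0" for x using KS by (cases "x = x0") (auto simp: semicircular_KS_def less_imp_le)
  show "0 < A x0" using KS nn[of Xm] x0 by (force simp: semicircular_KS_def)
  let ?f = "\<lambda>s x. sqrt (max 0 ((A x)\<^sup>2 - s\<^sup>2))"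
  have fc: "continuous_on {Xm..Xp} (?f s)" for s
    by (intro continuous_intros contA)
  show "continuous_on {0..A x0} (trunc_phase A Xm Xp)"
    unfolding trunc_phase_def[abs_def]
  proof (rule integral_continuous_on_param[where a = Xm and b = Xp, unfolded cbox_interval])
    have "continuous_on ({0..A x0} \<times> {Xm..Xp}) (\<lambda>z. A (snd z))"
      by (rule continuous_on_compose2[OF contA]) (auto intro!: continuous_intros)
    then show "continuous_on ({0..A x0} \<times> {Xm..Xp}) (\<lambda>(s, x). ?f s x)"
      unfolding case_prod_beta by (intro continuous_intros)
  qed
  show "trunc_phase A Xm Xp s' < trunc_phase A Xm Xp s" if s: "0 \<le> s" "s < s'" "s' \<le> A x0" for s s'
  proof -
    let ?d = "\<lambda>x. ?f s x - ?f s' x"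
    have sq: "s\<^sup>2 < s'\<^sup>2" using s by (intro power_strict_mono) auto
    have d0: "0 \<le> ?d x" for x using sq by simp
    have di: "(?d has_integral (trunc_phase A Xm Xp s - trunc_phase A Xm Xp s')) {Xm..Xp}"
      unfolding trunc_phase_def
      by (intro has_integral_diff integrable_integral integrable_continuous_interval fc)
    then have "0 \<le> trunc_phase A Xm Xp s - trunc_phase A Xm Xp s'" by (rule has_integral_nonneg) (use d0 in auto)
    moreover have "trunc_phase A Xm Xp s - trunc_phase A Xm Xp s' \<noteq> 0"
    proof
      assume "trunc_phase A Xm Xp s - trunc_phase A Xm Xp s' = 0"
      with di have i0: "(?d has_integral 0) (cbox Xm Xp)" by (simp add: cbox_interval)
      \<comment> \<open>A continuous nonnegative function with zero integral vanishes identically,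
        but this difference is positive at the maximizer.\<close>
      have "?d x0 = 0"
      proof (rule has_integral_0_cbox_imp_0[OF _ _ i0])
        show "continuous_on (cbox Xm Xp) ?d" unfolding cbox_interval by (intro continuous_on_diff fc)
        show "box Xm Xp \<noteq> {}" "x0 \<in> cbox Xm Xp" using x0 by (auto simp: box_real)
      qed (use d0 in auto)
      moreover have "s'\<^sup>2 \<le> (A x0)\<^sup>2" using s by (intro power_mono) auto
      ultimately show False using sq by simp
    qed
    ultimately show ?thesis by simp
  qed
  have "integral UNIV A = integral UNIV (\<lambda>x. if x \<in> {Xm..Xp} then A x else 0)"
    by (rule integral_cong) (use KS in \<open>auto simp: semicircular_KS_def\<close>)
  also have "\<dots> = integral {Xm..Xp} A" by (rule integral_restrict_UNIV)
  also have "\<dots> = trunc_phase A Xm Xp 0"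
    unfolding trunc_phase_def by (rule integral_cong) (simp add: nn)
  finally show "trunc_phase A Xm Xp 0 = integral UNIV A" by simp
  have "(A x)\<^sup>2 \<le> (A x0)\<^sup>2" for x using le nn by (intro power_mono) auto
  then have "max 0 ((A x)\<^sup>2 - (A x0)\<^sup>2) = 0" for x by (simp add: max.absorb1)
  then show "trunc_phase A Xm Xp (A x0) = 0" by (simp add: trunc_phase_def)
qed

text \<open>The count is \<open>r\<close> rounded to a nearest integer.\<close>

lemma card_half_integers_below:
  fixes r :: real
  assumes r: "0 \<le> r" "r \<le> real N"
  shows "\<bar>real (card {k. k < N \<and> real k + 1 / 2 \<le> r}) - r\<bar> \<le> 1"
proof -
  define m where "m = nat \<lfloor>r + 1 / 2\<rfloor>"
  have fl: "real m \<le> r + 1 / 2" "r + 1 / 2 < real m + 1"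
    using r by (simp_all add: m_def)
  have "{k. k < N \<and> real k + 1 / 2 \<le> r} = {..<m}"
  proof (intro set_eqI iffI)
    fix k assume "k \<in> {k. k < N \<and> real k + 1 / 2 \<le> r}"
    then have "real k + 1 \<le> r + 1 / 2" by simp
    then have "real k < real m" using fl(2) by linarith
    then show "k \<in> {..<m}" by simp
  next
    fix k assume "k \<in> {..<m}"
    then have "real k + 1 \<le> real m" by (simp add: Suc_le_eq[symmetric] flip: of_nat_Suc)
    then have "real k + 1 / 2 \<le> r" "real k + 1 / 2 \<le> real N" using fl(1) r by linarith+
    then show "k \<in> {k. k < N \<and> real k + 1 / 2 \<le> r}" by simp
  qed
  then show ?thesis using fl by simp
qed

text \<open>Layer cake: \<open>\<Sum>\<^sub>k s\<^sub>k\<close> is the integral over \<open>x\<close> of the number of \<open>k\<close> with \<open>x \<le> s\<^sub>k\<close>, which is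
  within 1 of \<open>F x / h\<close>.\<close>

lemma sum_quantized_values:
  fixes F :: "real \<Rightarrow> real" and s :: "nat \<Rightarrow> real"
  assumes a: "0 < a" and cont: "continuous_on {0..a} F"
    and dec: "\<And>x y. 0 \<le> x \<Longrightarrow> x < y \<Longrightarrow> y \<le> a \<Longrightarrow> F y < F x"
    and F0: "F 0 = real N * h" and Fa: "F a = 0" and h: "0 < h"
    and s: "\<And>k. k < N \<Longrightarrow> 0 < s k \<and> s k < a \<and> F (s k) = (real k + 1 / 2) * h"
  shows "\<bar>h * (\<Sum>k<N. s k) - integral {0..a} F\<bar> \<le> h * a"
proof -
  let ?c = "\<lambda>x. h * (\<Sum>k<N. if x \<in> {0..s k} then 1 else 0) - F x"
  have "((\<lambda>x. if x \<in> {0..s k} then 1 else (0::real)) has_integral s k) {0..a}" if "k < N" for k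
  proof -
    have "((\<lambda>x. 1::real) has_integral measure lborel {0..s k} *\<^sub>R 1) {0..s k}" by (rule has_integral_const_real)
    then show ?thesis using s[OF that] by (subst has_integral_restrict) auto
  qed
  then have "((\<lambda>x. \<Sum>k<N. if x \<in> {0..s k} then 1 else (0::real)) has_integral (\<Sum>k<N. s k)) {0..a}"
    by (intro has_integral_sum) auto
  then have I: "(?c has_integral (h * (\<Sum>k<N. s k) - integral {0..a} F)) {0..a}"
    by (intro has_integral_diff has_integral_mult_right integrable_integral integrable_continuous_interval cont)
  have "norm (h * (\<Sum>k<N. s k) - integral {0..a} F) \<le> h * measure lborel {0..a}"
  proof (rule has_integral_bound_real[OF _ _ I])
    fix x assume "x \<in> {0..a} - {}"
    then have x: "0 \<le> x" "x \<le> a" by auto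
    have Fx: "0 \<le> F x" "F x \<le> real N * h"
      using dec[of x a] dec[of 0 x] x F0 Fa by (cases "x = a"; cases "x = 0"; force)+
    \<comment> \<open>As \<open>F\<close> decreases, \<open>x\<close> lies below the level point
      \<open>s k\<close> exactly when \<open>F x\<close> lies above the level; the sum of indicators
      thus counts half-integers up to \<open>F x / h\<close>.\<close>
    have iff: "x \<le> s k \<longleftrightarrow> (real k + 1 / 2) \<le> F x / h" if "k < N" for k
    proof -
      have "x \<le> s k \<longleftrightarrow> F (s k) \<le> F x"
        using dec[of x "s k"] dec[of "s k" x] s[OF that] x by (cases "x < s k"; cases "x = s k") auto
      then show ?thesis using s[OF that] h by (simp add: le_divide_eq)
    qed
    have "(\<Sum>k<N. if x \<in> {0..s k} then 1 else (0::real)) = real (card {k. k < N \<and> real k + 1 / 2 \<le> F x / h})"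
    proof -
      have "(\<Sum>k<N. if x \<in> {0..s k} then 1 else (0::real)) = (\<Sum>k\<in>{..<N}. if real k + 1 / 2 \<le> F x / h then 1 else 0)"
        using x iff by (intro sum.cong) auto
      also have "\<dots> = real (card {k. k < N \<and> real k + 1 / 2 \<le> F x / h})"
        by (simp add: sum.If_cases Int_def)
      finally show ?thesis .
    qed
    moreover have "\<bar>real (card {k. k < N \<and> real k + 1 / 2 \<le> F x / h}) - F x / h\<bar> \<le> 1"
      using Fx h by (intro card_half_integers_below) (auto simp: divide_le_eq)
    ultimately have "h * \<bar>(\<Sum>k<N. if x \<in> {0..s k} then 1 else 0) - F x / h\<bar> \<le> h * 1"
      using h by (intro mult_left_mono) auto
    moreover have "?c x = h * ((\<Sum>k<N. if x \<in> {0..s k} then 1 else 0) - F x / h)"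
      using h by (simp only: right_diff_distrib) simp
    then have "\<bar>?c x\<bar> = h * \<bar>(\<Sum>k<N. if x \<in> {0..s k} then 1 else 0) - F x / h\<bar>"
      using h by (simp only: abs_mult)
    ultimately show "norm (?c x) \<le> h" by simp
  qed (use h in auto)
  then show ?thesis using a by simp
qed

text \<open>\<open>eps\<close> is normalized so that \<open>N * eps * pi\<close> is the phase at 0.
  The \<open>N\<close> half-integer levels therefore lie strictly between the end values, and strict
  monotonicity makes the definite description legitimate.\<close>

lemma stil_properties:
  assumes KS: "semicircular_KS A Xm Xp x0" and k: "k < N"
  shows "0 < stil A x0 N k" "stil A x0 N k < A x0"
    "PhiR A x0 (stil A x0 N k) = (real k + 1 / 2) * eps A N * pi"
proof -
  note tp = trunc_phase_properties[OF KS]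
  let ?v = "(real k + 1 / 2) * eps A N * pi"
  let ?F = "trunc_phase A Xm Xp"
  have F0: "0 < ?F 0" using tp(3)[of 0 "A x0"] tp(1,5) by simp
  have e: "real N * (eps A N * pi) = ?F 0" using k tp(4) by (simp add: eps_def)
  have ep: "0 < eps A N * pi" using e F0 k by (metis zero_less_mult_pos of_nat_0_less_iff less_nat_zero_code not_gr_zero)
  have "(real k + 1 / 2) * (eps A N * pi) < real N * (eps A N * pi)"
    by (rule mult_strict_right_mono[OF _ ep]) (use k in linarith)
  then have v: "0 < ?v" "?v < ?F 0" using ep e by (simp_all add: mult.assoc)
  have "\<exists>s. 0 \<le> s \<and> s \<le> A x0 \<and> ?F s = ?v"
    by (rule IVT2') (use tp v in auto)
  then obtain s where s: "0 \<le> s" "s \<le> A x0" "?F s = ?v" by blast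
  have s': "0 < s" "s < A x0" using s v tp(5) by (auto simp: less_le)
  have "stil A x0 N k = s" unfolding stil_def
  proof (rule the_equality)
    show "0 < s \<and> s < A x0 \<and> PhiR A x0 s = ?v" using s' s PhiR_eq_trunc_phase[OF KS s'] by simp
    fix r assume r: "0 < r \<and> r < A x0 \<and> PhiR A x0 r = ?v"
    then have "?F r = ?F s" using s PhiR_eq_trunc_phase[OF KS, of r] by simp
    then show "r = s" using tp(3)[of r s] tp(3)[of s r] r s' by (cases r s rule: linorder_cases) auto
  qed
  then show "0 < stil A x0 N k" "stil A x0 N k < A x0"
    "PhiR A x0 (stil A x0 N k) = ?v" using s' s PhiR_eq_trunc_phase[OF KS s'] by auto
qed

lemma integral_PhiR:
  assumes KS: "semicircular_KS A Xm Xp x0"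
  shows "integral {0..A x0} (PhiR A x0) = integral {0..A x0} (trunc_phase A Xm Xp)"
    "0 < integral {0..A x0} (PhiR A x0)"
proof -
  note tp = trunc_phase_properties[OF KS]
  let ?F = "trunc_phase A Xm Xp"
  \<comment> \<open>\<open>PhiR\<close> is identified only for \<open>0 < s < A x0\<close>; the two
    endpoints form a null set.\<close>
  show eq: "integral {0..A x0} (PhiR A x0) = integral {0..A x0} ?F"
    by (rule integral_spike[of "{0, A x0}"]) (auto simp: PhiR_eq_trunc_phase[OF KS])
  have nn: "0 \<le> ?F s" if "s \<in> {0..A x0}" for s
    using tp(3)[of s "A x0"] tp(5) that by (cases "s = A x0") auto
  have hi: "(?F has_integral integral {0..A x0} ?F) (cbox 0 (A x0))"
    using tp(2) by (simp add: integrable_continuous_interval integrable_integral)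
  have "0 \<le> integral {0..A x0} ?F" by (rule integral_nonneg) (use nn tp(2) in \<open>auto intro: integrable_continuous_interval\<close>)
  moreover have "integral {0..A x0} ?F \<noteq> 0"
  proof
    assume "integral {0..A x0} ?F = 0"
    with hi have i0: "(?F has_integral 0) (cbox 0 (A x0))" by simp
    have "?F 0 = 0"
      by (rule has_integral_0_cbox_imp_0[OF _ _ i0]) (use tp(1,2) nn in \<open>auto simp: box_real\<close>)
    then show False using tp(3)[of 0 "A x0"] tp(1,5) by simp
  qed
  ultimately show "0 < integral {0..A x0} (PhiR A x0)" using eq by simp
qed

section \<open>The connection coefficients at the base point\<close>

text \<open>The polynomial is only given for \<open>s > 0\<close>, so its constant term is taken as
  the right-hand limit of the continuous \<open>trunc_phase\<close>. It equals
  \<open>N * eps * pi\<close>, and this is how \<open>N\<close> enters the final sign.\<close>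

lemma Phi_poly_constant_term:
  assumes KS: "semicircular_KS A Xm Xp x0"
    and Phi: "\<forall>s\<in>{0<..<A x0}. complex_of_real (PhiR A x0 s)
                     = (\<Sum>p\<le>P. of_real (Phc p) * (\<i> * of_real s) ^ (2 * p))"
  shows "Phc 0 = integral UNIV A"
proof -
  note tp = trunc_phase_properties[OF KS]
  let ?S = "\<lambda>s::real. \<Sum>p\<le>P. complex_of_real (Phc p) * (\<i> * of_real s) ^ (2 * p)"
  have "((\<lambda>s. complex_of_real (trunc_phase A Xm Xp s)) \<longlongrightarrow> of_real (trunc_phase A Xm Xp 0)) (at 0 within {0..A x0})"
    using tp(1,2) by (intro tendsto_intros) (auto simp: continuous_on_def)
  then have l: "((\<lambda>s. complex_of_real (trunc_phase A Xm Xp s)) \<longlongrightarrow> of_real (integral UNIV A)) (at_right 0)"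
    using tp(1,4) by (simp add: at_within_Icc_at_right)
  have "isCont ?S 0" by (intro continuous_intros)
  then have "(?S \<longlongrightarrow> ?S 0) (at 0)" by (simp add: isCont_def)
  then have r: "(?S \<longlongrightarrow> ?S 0) (at_right 0)" by (rule tendsto_mono[OF at_le, rotated]) simp
  have "\<forall>\<^sub>F s in at_right 0. s \<in> {0<..<A x0}" using tp(1) by (rule eventually_at_right_real)
  then have "\<forall>\<^sub>F s in at_right 0. complex_of_real (trunc_phase A Xm Xp s) = ?S s"
    by eventually_elim (use Phi PhiR_eq_trunc_phase[OF KS] in auto)
  from Lim_transform_eventually[OF l this] r have "of_real (integral UNIV A) = ?S 0"
    by (rule tendsto_unique[OF trivial_limit_at_right_real])
  also have "?S 0 = (\<Sum>p\<le>P. if p = 0 then complex_of_real (Phc 0) else 0)"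
    by (rule sum.cong) auto
  also have "\<dots> = of_real (Phc 0)" by simp
  finally show ?thesis by simp
qed

text \<open>At the poles \<open>\<Phi> - \<Phi>\<^sub>0\<close> is quantized, and the \<open>\<Xi>\<close> term cancels the modulus of \<open>\<tau>\<^sub>k\<close>.\<close>

lemma Qfun_base_point:
  fixes Phc Xic :: "nat \<Rightarrow> real" and K :: int and P Q :: nat
  assumes Q: "1 \<le> Q"
  defines "tc \<equiv> \<lambda>m. if even m then - (2 * real_of_int K + 1) / 2 * (if m div 2 \<le> P then Phc (m div 2) else 0)
                   else - (if (m + 1) div 2 \<le> Q then Xic ((m + 1) div 2) else 0) / 2"
  shows "Qfun (max (2 * P) (2 * Q - 1)) (- Xic 1 / 2) tc z =
     - (2 * of_int K + 1) / 2 * ((\<Sum>p\<le>P. of_real (Phc p) * z ^ (2 * p)) - of_real (Phc 0))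
     - (\<Sum>q=1..Q. of_real (Xic q) * z ^ (2 * q - 1)) / 2"
proof -
  define M where "M = max (2 * P) (2 * Q - 1)"
  have M: "1 \<le> M" "2 * P \<le> M" "2 * Q - 1 \<le> M" using Q by (auto simp: M_def)
  let ?f = "\<lambda>m. z ^ m * complex_of_real (tc m)"
  let ?e = "(\<lambda>p. 2 * p) ` {1..P}" and ?o = "(\<lambda>q. 2 * q - 1) ` {1..Q}"
  \<comment> \<open>The coefficient formula at \<open>m = 1\<close> reproduces the base point in
    \<open>x\<close>, so the \<open>x\<close> term joins the sum over the times.\<close>
  have tc1: "tc 1 = - Xic 1 / 2" using Q by (simp add: tc_def)
  have "Qfun M (- Xic 1 / 2) tc z = ?f 1 + (\<Sum>m=2..M. ?f m)"
    unfolding Qfun_def tc1 by simp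
  also have "\<dots> = (\<Sum>m=1..M. ?f m)"
    using M(1) by (simp add: sum.atLeast_Suc_atMost numeral_2_eq_2)
  also have "\<dots> = sum ?f (?e \<union> ?o)"
  proof (rule sum.mono_neutral_right)
    show "?e \<union> ?o \<subseteq> {1..M}" using M by auto
    show "\<forall>m\<in>{1..M} - (?e \<union> ?o). ?f m = 0"
    proof
      fix m assume m: "m \<in> {1..M} - (?e \<union> ?o)"
      have "tc m = 0"
      proof (cases "even m")
        case True
        then obtain p where p: "m = 2 * p" by (elim evenE)
        then show ?thesis using m by (auto simp: tc_def)
      next
        case False
        then obtain q where q: "m = 2 * q + 1" by (elim oddE)
        have "\<not> Suc q \<le> Q"
        proof
          assume "Suc q \<le> Q"
          then have "m \<in> ?o" using q by (intro image_eqI[of _ _ "Suc q"]) auto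
          then show False using m by simp
        qed
        then show ?thesis using q by (simp add: tc_def)
      qed
      then show "?f m = 0" by simp
    qed
  qed auto
  also have "\<dots> = sum ?f ?e + sum ?f ?o"
  proof (rule sum.union_disjoint)
    show "?e \<inter> ?o = {}"
    proof -
      have "2 * p \<noteq> 2 * q - 1" if "1 \<le> q" for p q :: nat using that by presburger
      then show ?thesis by auto
    qed
  qed auto
  also have "sum ?f ?e = (\<Sum>p=1..P. ?f (2 * p))" by (subst sum.reindex) (auto simp: inj_on_def)
  also have "\<dots> = - (2 * of_int K + 1) / 2 * (\<Sum>p=1..P. of_real (Phc p) * z ^ (2 * p))"
    unfolding sum_distrib_left by (rule sum.cong) (auto simp: tc_def)
  also have "(\<Sum>p=1..P. of_real (Phc p) * z ^ (2 * p)) = (\<Sum>p\<le>P. of_real (Phc p) * z ^ (2 * p)) - of_real (Phc 0)"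
    by (simp add: atMost_atLeast0 sum.atLeast_Suc_atMost)
  also have "sum ?f ?o = (\<Sum>q=1..Q. ?f (2 * q - 1))" by (subst sum.reindex) (auto simp: inj_on_def)
  also have "\<dots> = - ((\<Sum>q=1..Q. of_real (Xic q) * z ^ (2 * q - 1)) / 2)"
    unfolding sum_divide_distrib sum_negf[symmetric] by (rule sum.cong) (auto simp: tc_def)
  finally show ?thesis by (simp add: M_def)
qed

text \<open>Because \<open>2 * K + 1\<close> is odd, the integer part \<open>m\<close> of the phase
  is \<open>N - k - K\<close> modulo 2, and the prefactor \<open>(-1) ^ (k + 1)\<close> removes the
  dependence on \<open>k\<close>. The remaining half gives the factor \<open>\<i>\<close>.\<close>

lemma exp_half_integer_phase:
  "(-1) ^ (k + 1) * exp (- (\<i> * (2 * of_int K + 1) * (of_nat k + 1 / 2 - of_nat N) * pi)) = \<i> * (-1) powi (K + int N)"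
proof -
  have 1: "exp (\<i> * pi * of_int m) = (-1) powi m" for m :: int
    using exp_power_int[of "\<i> * complex_of_real pi" m] by (simp add: mult.commute)
  have 2: "exp (- (\<i> * pi / 2)) = - \<i>"
    using cis_conv_exp[of "- (pi / 2)"] by (simp add: complex_eq_iff)
  define m where "m = (2 * K + 1) * (int N - int k) - K"
  have "- (\<i> * (2 * of_int K + 1) * (of_nat k + 1 / 2 - of_nat N) * pi) = \<i> * pi * of_int m + - (\<i> * pi / 2)"
    by (simp add: m_def algebra_simps)
  then have a: "exp (- (\<i> * (2 * of_int K + 1) * (of_nat k + 1 / 2 - of_nat N) * pi)) = (-1) powi m * - \<i>"
    by (simp only: exp_add 1 2)
  have b: "(-1) ^ (k + 1) = ((-1) powi (int k + 1) :: complex)"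
    by (metis of_nat_1 of_nat_add power_int_of_nat)
  have c: "(-1) powi (int k + 1) * (-1) powi m * - 1 = ((-1) powi (K + int N) :: complex)"
  proof -
    have "even (int k + 1 + m + 1 - (K + int N))" unfolding m_def by (simp, blast)
    then have "even (int k + 1 + m + 1) = even (K + int N)" by simp
    then have "(-1) powi (int k + 1 + m + 1) = ((-1) powi (K + int N) :: complex)"
      by (simp add: power_int_minus_left)
    then show ?thesis by (simp add: power_int_add)
  qed
  show ?thesis unfolding a b c[symmetric] by simp
qed

text \<open>Explains the scales of the theorem. With \<open>\<kappa> = eps / \<nu>\<close> the
  increments are \<open>eps * \<kappa> * X\<close> and \<open>eps * \<kappa> ^ n * T\<close>: the
  outer \<open>eps\<close> cancels the one dividing \<open>Q\<close>, and the powers of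
  \<open>\<kappa>\<close> rescale the spectral variable.\<close>

lemma Qfun_perturb:
  assumes "2 \<le> n" "n \<le> M"
  shows "Qfun M (x + e * \<kappa> * X) (\<lambda>m. t m + (if m = n then e * \<kappa> ^ n * T else 0)) z
    = Qfun M x t z + e * ((\<kappa> * z) * X + (\<kappa> * z) ^ n * T)"
proof -
  have "(\<Sum>m=2..M. z ^ m * complex_of_real (t m + (if m = n then e * \<kappa> ^ n * T else 0)))
    = (\<Sum>m=2..M. z ^ m * complex_of_real (t m) + (if m = n then z ^ n * complex_of_real (e * \<kappa> ^ n * T) else 0))"
    by (rule sum.cong) (auto simp: algebra_simps)
  also have "\<dots> = (\<Sum>m=2..M. z ^ m * complex_of_real (t m)) + z ^ n * complex_of_real (e * \<kappa> ^ n * T)"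
    using assms by (simp add: sum.distrib)
  finally show ?thesis by (simp add: Qfun_def algebra_simps power_mult_distrib)
qed

text \<open>There are \<open>N\<close> factors above and \<open>N - 1\<close> below, so exactly one
  power of \<open>\<kappa>\<close> survives.\<close>

lemma gres_scale:
  assumes "k < N" "\<kappa> \<noteq> 0"
  shows "gres \<phi> N (\<lambda>k. \<kappa> * s k) k = \<kappa> * (exp (2 * \<i> * \<phi> (\<i> * (\<kappa> * s k))) * (\<Prod>j<N. \<i> * s k + \<i> * s j)
     / (\<Prod>j\<in>{..<N} - {k}. \<i> * s k - \<i> * s j))"
proof -
  have "(\<Prod>j<N. \<i> * complex_of_real (\<kappa> * s k) + \<i> * complex_of_real (\<kappa> * s j)) = (\<Prod>j<N. \<kappa> * (\<i> * s k + \<i> * s j))"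
    by (rule prod.cong) (auto simp: algebra_simps)
  also have "\<dots> = \<kappa> ^ N * (\<Prod>j<N. \<i> * s k + \<i> * s j)" by (simp add: prod.distrib)
  finally have 1: "(\<Prod>j<N. \<i> * complex_of_real (\<kappa> * s k) + \<i> * complex_of_real (\<kappa> * s j)) = \<dots>" .
  have "(\<Prod>j\<in>{..<N} - {k}. \<i> * complex_of_real (\<kappa> * s k) - \<i> * complex_of_real (\<kappa> * s j)) = (\<Prod>j\<in>{..<N} - {k}. \<kappa> * (\<i> * s k - \<i> * s j))"
    by (rule prod.cong) (auto simp: algebra_simps)
  also have "\<dots> = \<kappa> ^ (N - 1) * (\<Prod>j\<in>{..<N} - {k}. \<i> * s k - \<i> * s j)" using assms by (simp add: prod.distrib)
  finally have 2: "(\<Prod>j\<in>{..<N} - {k}. \<i> * complex_of_real (\<kappa> * s k) - \<i> * complex_of_real (\<kappa> * s j)) = \<dots>" .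
  have "complex_of_real \<kappa> ^ N = \<kappa> * \<kappa> ^ (N - 1)" using assms by (cases N) auto
  then show ?thesis unfolding gres_def 1 2 using assms by (simp add: mult.assoc)
qed

lemma ccoef_eq_gres:
  fixes Phc Xic :: "nat \<Rightarrow> real" and K :: int and P Q :: nat
  assumes KS: "semicircular_KS A Xm Xp x0"
    and Phi: "\<forall>s\<in>{0<..<A x0}. complex_of_real (PhiR A x0 s)
                     = (\<Sum>p\<le>P. of_real (Phc p) * (\<i> * of_real s) ^ (2 * p))"
    and Xi: "\<forall>s\<in>{0<..<A x0}. complex_of_real (XiR A x0 s)
                     = \<i> * (\<Sum>q=1..Q. of_real (Xic q) * (\<i> * of_real s) ^ (2 * q - 1))"
    and Q: "1 \<le> Q" and M: "M = max (2 * P) (2 * Q - 1)" and n: "2 \<le> n" "n \<le> M"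
    and tc: "tc = (\<lambda>m. if even m then - (2 * real_of_int K + 1) / 2 * (if m div 2 \<le> P then Phc (m div 2) else 0)
                   else - (if (m + 1) div 2 \<le> Q then Xic ((m + 1) div 2) else 0) / 2)"
    and k: "k < N" and e: "0 < eps A N" and \<kappa>: "0 < \<kappa>"
  shows "ccoef A x0 N M (- Xic 1 / 2 + eps A N * \<kappa> * X) (\<lambda>m. tc m + (if m = n then eps A N * \<kappa> ^ n * T else 0)) k
    = \<i> * (-1) powi (K + int N) * (gres (\<lambda>z. z * X + z ^ n * T) N (\<lambda>k. \<kappa> * stil A x0 N k) k / \<kappa>)"
proof -
  define s where "s = stil A x0 N"
  note st = stil_properties[OF KS k, folded s_def]
  have sk: "s k \<in> {0<..<A x0}" using st by simp
  let ?z = "\<i> * complex_of_real (s k)" and ?e = "complex_of_real (eps A N)"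
  have Phi0: "complex_of_real (Phc 0) = of_nat N * ?e * pi"
  proof -
    have "Phc 0 = real N * eps A N * pi" using Phi_poly_constant_term[OF KS Phi] k by (simp add: eps_def)
    then show ?thesis by simp
  qed
  have "(\<Sum>p\<le>P. of_real (Phc p) * ?z ^ (2 * p)) = complex_of_real ((real k + 1 / 2) * eps A N * pi)"
    using Phi sk st(3) by metis
  moreover have "(\<Sum>q=1..Q. of_real (Xic q) * ?z ^ (2 * q - 1)) = - \<i> * complex_of_real (XiR A x0 (s k))"
    using Xi sk by (simp only: bspec[OF Xi sk]) (simp flip: mult.assoc)
  moreover have "- (2 * of_int K + 1) / 2 * (complex_of_real ((real k + 1 / 2) * eps A N * pi) - of_nat N * ?e * pi)
      - - \<i> * complex_of_real (XiR A x0 (s k)) / 2 = - (2 * of_int K + 1) / 2 * (of_nat k + 1 / 2 - of_nat N) * ?e * pi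
      + \<i> * complex_of_real (XiR A x0 (s k)) / 2"
    by (simp add: field_simps)
  ultimately have base: "Qfun M (- Xic 1 / 2) tc ?z = - (2 * of_int K + 1) / 2 * (of_nat k + 1 / 2 - of_nat N) * ?e * pi
      + \<i> * complex_of_real (XiR A x0 (s k)) / 2"
    unfolding M tc Qfun_base_point[OF Q] Phi0 by (simp only:)
  let ?\<phi> = "\<lambda>z::complex. z * X + z ^ n * T"
  let ?q = "Qfun M (- Xic 1 / 2 + eps A N * \<kappa> * X) (\<lambda>m. tc m + (if m = n then eps A N * \<kappa> ^ n * T else 0)) ?z"
  have e0: "?e \<noteq> 0" using e by simp
  \<comment> \<open>Three contributions: the quantized phase, the term that cancels the modulus of
    \<open>tautil\<close>, and \<open>\<phi>\<close> at the rescaled pole.\<close>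
  have "2 * \<i> * ?q / ?e
     = - (\<i> * (2 * of_int K + 1) * (of_nat k + 1 / 2 - of_nat N) * pi) + - complex_of_real (XiR A x0 (s k) / eps A N)
      + 2 * \<i> * ?\<phi> (\<i> * (\<kappa> * s k))"
  proof -
    have "\<i> * (\<kappa> * s k) = \<kappa> * ?z" by simp
    then show ?thesis unfolding Qfun_perturb[OF n] base using e0 by (simp add: field_simps)
  qed
  note ex = this
  have t: "complex_of_real (tautil A x0 N k) * exp (- complex_of_real (XiR A x0 (s k) / eps A N)) = (-1) ^ (k + 1)"
  proof -
    have "complex_of_real (exp w) * exp (- complex_of_real w) = 1" for w
      by (simp add: exp_minus exp_of_real)
    then show ?thesis by (simp add: tautil_def s_def[symmetric] del: of_real_divide)
  qed
  have ex: "complex_of_real (tautil A x0 N k) * exp (2 * \<i> * ?q / ?e)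
     = \<i> * (-1) powi (K + int N) * exp (2 * \<i> * ?\<phi> (\<i> * (\<kappa> * s k)))"
    unfolding exp_half_integer_phase[symmetric, of K N k] ex
    by (simp only: exp_add t[symmetric] mult_ac)
  have "ccoef A x0 N M (- Xic 1 / 2 + eps A N * \<kappa> * X) (\<lambda>m. tc m + (if m = n then eps A N * \<kappa> ^ n * T else 0)) k
     = (complex_of_real (tautil A x0 N k) * exp (2 * \<i> * ?q / ?e))
       * (\<Prod>j<N. \<i> * s k + \<i> * s j) / (\<Prod>j\<in>{..<N} - {k}. \<i> * s k - \<i> * s j)"
    by (simp add: ccoef_def Let_def s_def)
  also have "\<dots> = \<i> * (-1) powi (K + int N) * (gres ?\<phi> N (\<lambda>k. \<kappa> * s k) k / \<kappa>)"
    unfolding ex gres_scale[OF k less_imp_neq[OF \<kappa>, symmetric]] using \<kappa> by simp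
  finally show ?thesis by (simp add: s_def)
qed

section \<open>Comparison of the two potentials\<close>

lemma pole_system_cong:
  "pole_system e N y r \<alpha> \<gamma> \<Longrightarrow> (\<And>k. k < N \<Longrightarrow> r k = r' k) \<Longrightarrow> pole_system e N y r' \<alpha> \<gamma>"
  by (simp add: pole_system_def)

text \<open>An explicit bound for every positive \<open>N\<close> with
  \<open>\<kappa> * A x0 \<le> 1 / 16\<close>, the condition that keeps all \<open>y k\<close>
  within reach of the pole estimates. The moments differ by \<open>O(\<kappa>)\<close>, and the
  potentials carry a factor \<open>1 / \<kappa>\<close>.\<close>

lemma psitil_near_PsiR:
  fixes Phc Xic :: "nat \<Rightarrow> real" and K :: int and P Q :: nat
  assumes KS: "semicircular_KS A Xm Xp x0"
    and Phi: "\<forall>s\<in>{0<..<A x0}. complex_of_real (PhiR A x0 s)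
                     = (\<Sum>p\<le>P. of_real (Phc p) * (\<i> * of_real s) ^ (2 * p))"
    and Xi: "\<forall>s\<in>{0<..<A x0}. complex_of_real (XiR A x0 s)
                     = \<i> * (\<Sum>q=1..Q. of_real (Xic q) * (\<i> * of_real s) ^ (2 * q - 1))"
    and Q: "1 \<le> Q" and M: "M = max (2 * P) (2 * Q - 1)" and n: "2 \<le> n" "n \<le> M"
    and tc: "tc = (\<lambda>m. if even m then - (2 * real_of_int K + 1) / 2 * (if m div 2 \<le> P then Phc (m div 2) else 0)
                   else - (if (m + 1) div 2 \<le> Q then Xic ((m + 1) div 2) else 0) / 2)"
    and \<nu>: "\<nu> = integral {0..A x0} (PhiR A x0) / (2 * pi)" and \<kappa>: "\<kappa> = eps A N / \<nu>"
    and N: "0 < N" "\<kappa> * A x0 \<le> 1 / 16"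
    and X: "\<bar>X\<bar> \<le> B" "\<bar>T\<bar> \<le> B"
  shows "cmod (psitil A x0 N M (- Xic 1 / 2 + eps A N * \<kappa> * X) (\<lambda>m. tc m + (if m = n then eps A N * \<kappa> ^ n * T else 0))
      - \<i> * (-1) powi (K + int N) * of_real (\<nu> / eps A N) * PsiR M X (\<lambda>m. if m = n then T else 0))
    \<le> 8 * A x0 * asyb (2 * B + 2 ^ n * B)"
proof -
  let ?psi = "psitil A x0 N M (- Xic 1 / 2 + eps A N * \<kappa> * X) (\<lambda>m. tc m + (if m = n then eps A N * \<kappa> ^ n * T else 0))"
  define s where "s = stil A x0 N"
  define y where "y = (\<lambda>k. \<kappa> * s k)"
  define \<phi> where "\<phi> = (\<lambda>z::complex. z * X + z ^ n * T)"
  define \<tau> where "\<tau> = \<i> * (-1) powi (K + int N)"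
  \<comment> \<open>Bounds \<open>\<phi>\<close> on the disc of radius 2, where the uniform
    estimates live, and depends on \<open>X\<close> and \<open>T\<close> only through
    \<open>B\<close>.\<close>
  define L where "L = 2 * B + 2 ^ n * B"
  define c where "c = ccoef A x0 N M (- Xic 1 / 2 + eps A N * \<kappa> * X) (\<lambda>m. tc m + (if m = n then eps A N * \<kappa> ^ n * T else 0))"
  note tp = trunc_phase_properties[OF KS]
  note st = stil_properties[OF KS, of _ N, folded s_def]
  have B: "0 \<le> B" using X(1) by linarith
  have \<nu>0: "0 < \<nu>" using integral_PhiR(2)[OF KS] by (simp add: \<nu>)
  have e0: "0 < eps A N"
    using tp(3)[of 0 "A x0"] tp(1,4,5) N(1) by (simp add: eps_def)
  have \<kappa>0: "0 < \<kappa>" using e0 \<nu>0 by (simp add: \<kappa>)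
  have \<tau>: "\<tau> * cnj \<tau> = 1"
    by (simp add: \<tau>_def power_int_minus_left)
  then have \<tau>0: "\<tau> \<noteq> 0" by auto
  have t2: "\<tau> * \<tau> = -1" by (simp add: \<tau>_def power_int_minus_left)
  have inj: "inj_on s {..<N}"
  proof (rule inj_onI)
    fix j k assume "j \<in> {..<N}" "k \<in> {..<N}" "s j = s k"
    then have "(real j + 1 / 2) * (eps A N * pi) = (real k + 1 / 2) * (eps A N * pi)"
      using st(3)[of j] st(3)[of k] by (metis lessThan_iff mult.assoc)
    then show "j = k" using e0 by auto
  qed
  then have injy: "inj_on y {..<N}" using \<kappa>0 by (auto simp: y_def inj_on_def)
  have ypos: "0 < y k" and yle: "y k \<le> \<kappa> * A x0" if "k < N" for k
    using st(1,2)[OF that] \<kappa>0 by (simp_all add: y_def)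
  \<comment> \<open>This fixes the meaning of \<open>\<nu>\<close>: the integral of the phase is
    \<open>2 * pi * \<nu>\<close>, so the rescaled poles sum to nearly 2, the coefficient of
    \<open>1 / z\<close> in \<open>thetaR\<close>.\<close>
  have sumy: "\<bar>(\<Sum>k<N. y k) - 2\<bar> \<le> \<kappa> * A x0"
  proof -
    have "\<bar>(eps A N * pi) * (\<Sum>k<N. s k) - integral {0..A x0} (trunc_phase A Xm Xp)\<bar> \<le> (eps A N * pi) * A x0"
    proof (rule sum_quantized_values[OF tp(1-3)])
      show "trunc_phase A Xm Xp 0 = real N * (eps A N * pi)" using tp(4) N(1) by (simp add: eps_def)
      fix k assume "k < N"
      then show "0 < s k \<and> s k < A x0 \<and> trunc_phase A Xm Xp (s k) = (real k + 1 / 2) * (eps A N * pi)"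
        using st PhiR_eq_trunc_phase[OF KS, of "s k"] by simp
    qed (use tp(5) e0 in auto)
    moreover have "(eps A N * pi) * (\<Sum>k<N. s k) - integral {0..A x0} (trunc_phase A Xm Xp) = pi * \<nu> * ((\<Sum>k<N. y k) - 2)"
    proof -
      have "integral {0..A x0} (trunc_phase A Xm Xp) = 2 * pi * \<nu>" by (simp add: \<nu> integral_PhiR(1)[OF KS])
      moreover have "(\<Sum>k<N. y k) = eps A N / \<nu> * (\<Sum>k<N. s k)" by (simp only: y_def \<kappa> sum_distrib_left)
      ultimately show ?thesis using \<nu>0 by (simp only:) (simp add: field_simps)
    qed
    moreover have "(eps A N * pi) * A x0 = pi * \<nu> * (\<kappa> * A x0)" using \<nu>0 by (simp add: \<kappa>)
    ultimately show ?thesis using \<nu>0 by (simp add: abs_mult)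
  qed
  have sumy1: "\<bar>(\<Sum>k<N. y k) - 2\<bar> \<le> 1" using sumy N(2) by linarith
  have sumsq: "(\<Sum>k<N. (y k)\<^sup>2) \<le> 3 * (\<kappa> * A x0)"
  proof -
    have "(\<Sum>k<N. (y k)\<^sup>2) \<le> (\<Sum>k<N. \<kappa> * A x0 * y k)"
      unfolding power2_eq_square by (intro sum_mono mult_right_mono) (use ypos yle in \<open>auto intro: less_imp_le\<close>)
    also have "\<dots> = \<kappa> * A x0 * (\<Sum>k<N. y k)" by (simp add: sum_distrib_left)
    also have "\<dots> \<le> \<kappa> * A x0 * 3" using sumy1 \<kappa>0 tp(1) by (intro mult_left_mono) auto
    finally show ?thesis by simp
  qed
  have \<phi>hol: "\<phi> holomorphic_on UNIV" unfolding \<phi>_def by (intro holomorphic_intros)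
  have \<phi>c: "cnj (\<phi> (cnj z)) = \<phi> z" for z by (simp add: \<phi>_def)
  have \<phi>L: "cmod (\<phi> z) \<le> L" if "cmod z \<le> 2" for z
  proof -
    have "cmod (\<phi> z) \<le> cmod z * \<bar>X\<bar> + cmod z ^ n * \<bar>T\<bar>"
      unfolding \<phi>_def by (rule norm_triangle_le) (simp add: norm_mult norm_power)
    also have "\<dots> \<le> 2 * B + 2 ^ n * B"
      by (intro add_mono mult_mono power_mono) (use that X B in auto)
    finally show ?thesis by (simp add: L_def)
  qed
  obtain U W p q where rs: "row_sol (\<lambda>z. exp (2 * \<i> * \<phi> z) * exp (4 * \<i> / z)) U W p q"
    and asy: "\<And>N y \<alpha> \<gamma>. inj_on y {..<N} \<Longrightarrow> (\<And>k. k < N \<Longrightarrow> 0 < y k) \<Longrightarrow> (\<And>k. k < N \<Longrightarrow> y k \<le> 1 / 16)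
       \<Longrightarrow> \<bar>(\<Sum>k<N. y k) - 2\<bar> \<le> 1 \<Longrightarrow> pole_system 1 N y (gres \<phi> N y) \<alpha> \<gamma>
       \<Longrightarrow> cmod ((\<Sum>k<N. \<gamma> k) - deriv W 0) \<le> asyb L * (\<bar>(\<Sum>k<N. y k) - 2\<bar> + (\<Sum>k<N. (y k)\<^sup>2))"
    using limit_row_sol_asymptotics[OF \<phi>hol \<phi>c \<phi>L] by blast
  have "2 * \<i> * thetaR M X (\<lambda>m. if m = n then T else 0) z = 2 * \<i> * \<phi> z + 4 * \<i> / z" for z
  proof -
    have "(\<Sum>m=2..M. z ^ m * complex_of_real (if m = n then T else 0)) = (\<Sum>m=2..M. if m = n then z ^ n * T else 0)"
      by (rule sum.cong) auto
    also have "\<dots> = z ^ n * T" using n by simp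
    finally show ?thesis by (simp add: thetaR_def \<phi>_def algebra_simps)
  qed
  then have Psi: "PsiR M X (\<lambda>m. if m = n then T else 0) = 2 * \<i> * deriv W 0"
    by (intro PsiR_eq[of _ _ _ U W p q]) (use rs in \<open>simp add: exp_add\<close>)
  obtain \<alpha> \<gamma> where sys: "pole_system 1 N y (gres \<phi> N y) \<alpha> \<gamma>"
    using pole_system_exists[OF injy ypos] by blast
  have c: "c k = \<tau> * (gres \<phi> N y k / \<kappa>)" if "k < N" for k
    unfolding c_def \<tau>_def \<phi>_def y_def s_def by (rule ccoef_eq_gres[OF KS Phi Xi Q M n tc that e0 \<kappa>0])
  have c0: "c k \<noteq> 0" if "k < N" for k
  proof -
    have "\<i> * complex_of_real (y k) + \<i> * complex_of_real (y j) \<noteq> 0" if "j < N" for j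
      using ypos[OF that] ypos[OF \<open>k < N\<close>] by (simp add: complex_eq_iff)
    moreover have "\<i> * complex_of_real (y k) - \<i> * complex_of_real (y j) \<noteq> 0" if "j \<in> {..<N} - {k}" for j
      using inj_onD[OF injy, of k j] that \<open>k < N\<close> by auto
    ultimately have "gres \<phi> N y k \<noteq> 0" by (simp add: gres_def)
    then show ?thesis using c[OF that] \<tau>0 \<kappa>0 by simp
  qed
  have "pole_system 1 N s (\<lambda>k. gres \<phi> N y k / \<kappa>) (\<lambda>k. \<alpha> k / \<kappa>) (\<lambda>k. \<gamma> k / \<kappa>)"
    using sys \<kappa>0 unfolding y_def by (rule pole_system_scale)
  from pole_system_rotate[OF this \<tau>]
  have "pole_system 1 N s (\<lambda>k. gres \<phi> N y k / \<kappa> / \<tau>) (\<lambda>k. \<alpha> k / \<kappa>) (\<lambda>k. \<tau> * (\<gamma> k / \<kappa>))" .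
  moreover have "gres \<phi> N y k / \<kappa> / \<tau> = - c k" if "k < N" for k
  proof -
    \<comment> \<open>Since \<open>\<tau> * \<tau> = -1\<close>, dividing by \<open>\<tau>\<close>
      yields exactly the sign that \<open>r = - c\<close> requires.\<close>
    have ti: "1 / \<tau> = - \<tau>" using t2 \<tau>0 by (simp add: divide_eq_eq)
    have "gres \<phi> N y k / \<kappa> / \<tau> = gres \<phi> N y k / \<kappa> * (1 / \<tau>)" by simp
    then show ?thesis unfolding ti by (simp add: c[OF that] mult.commute)
  qed
  ultimately have "pole_system 1 N s (\<lambda>k. - c k) (\<lambda>k. \<alpha> k / \<kappa>) (\<lambda>k. \<tau> * (\<gamma> k / \<kappa>))"
    by (rule pole_system_cong)
  then have "?psi
     = 2 * \<i> * (\<Sum>k<N. \<tau> * (\<gamma> k / \<kappa>))"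
    using inj st(1) c0 unfolding c_def s_def by (intro psitil_eq)
  also have "\<dots> = 2 * \<i> * \<tau> / \<kappa> * (\<Sum>k<N. \<gamma> k)"
    by (simp add: sum_distrib_left sum_divide_distrib mult.assoc)
  finally have psi: "?psi = \<dots>" .
  have "cmod ((\<Sum>k<N. \<gamma> k) - deriv W 0) \<le> asyb L * (\<bar>(\<Sum>k<N. y k) - 2\<bar> + (\<Sum>k<N. (y k)\<^sup>2))"
    by (rule asy[OF injy ypos _ sumy1 sys]) (use yle N(2) in force)+
  \<comment> \<open>One \<open>\<kappa> * A x0\<close> comes from the sum of the \<open>y k\<close>
    and three from the sum of their squares.\<close>
  also have "\<dots> \<le> asyb L * (4 * (\<kappa> * A x0))"
    using sumy sumsq by (intro mult_left_mono) (auto simp: asyb_def)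
  finally have d: "cmod ((\<Sum>k<N. \<gamma> k) - deriv W 0) \<le> asyb L * (4 * (\<kappa> * A x0))" .
  have "cmod \<tau> = 1" by (simp add: \<tau>_def norm_mult norm_power_int)
  have "\<nu> / eps A N = 1 / \<kappa>" by (simp add: \<kappa>)
  then have "2 * \<i> * \<tau> / \<kappa> * (\<Sum>k<N. \<gamma> k) - \<tau> * of_real (\<nu> / eps A N) * (2 * \<i> * deriv W 0)
     = 2 * \<i> * \<tau> / \<kappa> * ((\<Sum>k<N. \<gamma> k) - deriv W 0)"
    by (simp only: of_real_divide of_real_1) (simp add: algebra_simps flip: add_divide_distrib)
  also have "cmod \<dots> = 2 / \<kappa> * cmod ((\<Sum>k<N. \<gamma> k) - deriv W 0)"
    using \<kappa>0 \<open>cmod \<tau> = 1\<close> by (simp add: norm_mult norm_divide)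
  \<comment> \<open>The amplification \<open>1 / \<kappa>\<close> meets an error of order
    \<open>\<kappa>\<close>, so a constant remains.\<close>
  also have "\<dots> \<le> 2 / \<kappa> * (asyb L * (4 * (\<kappa> * A x0)))"
    using d \<kappa>0 by (intro mult_left_mono) auto
  also have "\<dots> = 8 * A x0 * asyb L" using \<kappa>0 by simp
  finally show ?thesis unfolding psi Psi by (simp only: \<tau>_def L_def)
qed

theorem theorem4:
  fixes A :: "real \<Rightarrow> real" and Xm Xp x0 :: real
    and P Q :: nat and Phc Xic :: "nat \<Rightarrow> real"
    and K :: int and n :: nat and t0 :: real
  assumes KS: "semicircular_KS A Xm Xp x0"
    and Phi_poly: "\<forall>s\<in>{0<..<A x0}. complex_of_real (PhiR A x0 s)
                     = (\<Sum>p\<le>P. of_real (Phc p) * (\<i> * of_real s) ^ (2 * p))"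
    and Xi_poly: "\<forall>s\<in>{0<..<A x0}. complex_of_real (XiR A x0 s)
                     = \<i> * (\<Sum>q=1..Q. of_real (Xic q) * (\<i> * of_real s) ^ (2 * q - 1))"
    and Qpos: "1 \<le> Q"
    and Phi_deg: "Phc P \<noteq> 0"
    and Xi_deg: "Xic Q \<noteq> 0"
    and n_range: "2 \<le> n" "n \<le> max (2 * P) (2 * Q - 1)"
  shows
    "let M = max (2 * P) (2 * Q - 1);
         PhiE = (\<lambda>p. if p \<le> P then Phc p else 0);
         XiE = (\<lambda>q. if q \<le> Q then Xic q else 0);
         tc = (\<lambda>m. if even m then - (2 * real_of_int K + 1) / 2 * PhiE (m div 2)
                   else - XiE ((m + 1) div 2) / 2);
         xc = - Xic 1 / 2;
         \<nu> = integral {0 .. A x0} (PhiR A x0) / (2 * pi);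
         tn = (\<lambda>m. if m = n then tc m - t0 else tc m);
         psi = (\<lambda>N x t. psitil A x0 N M x (\<lambda>m. tn m + t * (if m = n then 1 else 0)))
     in \<forall>B>0. \<exists>C. \<forall>\<^sub>F N in sequentially. \<forall>X T. \<bar>X\<bar> \<le> B \<longrightarrow> \<bar>T\<bar> \<le> B \<longrightarrow>
          cmod (psi N (xc + (eps A N)^2 / \<nu> * X) (t0 + (eps A N) ^ (n + 1) / \<nu> ^ n * T)
                - \<i> * (-1) powi (K + int N) * of_real (\<nu> / eps A N)
                    * PsiR M X (\<lambda>m. if m = n then T else 0)) \<le> C"
proof -
  define M where "M = max (2 * P) (2 * Q - 1)"
  define \<nu> where "\<nu> = integral {0..A x0} (PhiR A x0) / (2 * pi)"
  define tc where "tc = (\<lambda>m. if even m then - (2 * real_of_int K + 1) / 2 * (if m div 2 \<le> P then Phc (m div 2) else 0)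
                   else - (if (m + 1) div 2 \<le> Q then Xic ((m + 1) div 2) else 0) / 2)"
  have nM: "n \<le> M" using n_range(2) by (simp add: M_def)
  have lim: "(\<lambda>N. eps A N / \<nu> * A x0) \<longlonglongrightarrow> 0"
  proof -
    have "(\<lambda>N. integral UNIV A / pi / \<nu> * A x0 * (1 / real N)) \<longlonglongrightarrow> integral UNIV A / pi / \<nu> * A x0 * 0"
      by (intro tendsto_mult tendsto_const lim_1_over_n)
    then show ?thesis by (simp add: eps_def mult_ac)
  qed
  \<comment> \<open>From such \<open>N\<close> on, the explicit estimate applies.\<close>
  have small: "\<forall>\<^sub>F N in sequentially. eps A N / \<nu> * A x0 < 1 / 16"
    by (rule order_tendstoD(2)[OF lim]) simp
  have "\<forall>\<^sub>F N in sequentially. \<forall>X T. \<bar>X\<bar> \<le> B \<longrightarrow> \<bar>T\<bar> \<le> B \<longrightarrow>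
     cmod (psitil A x0 N M (- Xic 1 / 2 + (eps A N)\<^sup>2 / \<nu> * X)
            (\<lambda>m. (if m = n then tc m - t0 else tc m) + (t0 + eps A N ^ (n + 1) / \<nu> ^ n * T) * (if m = n then 1 else 0))
        - \<i> * (-1) powi (K + int N) * of_real (\<nu> / eps A N) * PsiR M X (\<lambda>m. if m = n then T else 0))
      \<le> 8 * A x0 * asyb (2 * B + 2 ^ n * B)" for B
    using small eventually_gt_at_top[of 0]
  proof eventually_elim
    case (elim N)
    show ?case
    proof (intro allI impI, goal_cases)
      case (1 X T)
      have "(eps A N)\<^sup>2 / \<nu> * X = eps A N * (eps A N / \<nu>) * X" by (simp add: power2_eq_square)
      \<comment> \<open>The shift of the base time by \<open>t0\<close> cancels against the
        \<open>t0\<close> in the time argument.\<close>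
      moreover have "(\<lambda>m. (if m = n then tc m - t0 else tc m) + (t0 + eps A N ^ (n + 1) / \<nu> ^ n * T) * (if m = n then 1 else 0))
         = (\<lambda>m. tc m + (if m = n then eps A N * (eps A N / \<nu>) ^ n * T else 0))"
        by (auto simp: power_divide)
      ultimately show ?case
        using psitil_near_PsiR[OF KS Phi_poly Xi_poly Qpos M_def n_range(1) nM tc_def \<nu>_def refl elim(2) less_imp_le[OF elim(1)] 1]
        by (simp only:)
    qed
  qed
  note bound = this[unfolded tc_def]
  show ?thesis unfolding Let_def M_def[symmetric] \<nu>_def[symmetric]
    by (intro allI impI exI) (rule bound)
qed

end
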